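(* Let $Z=\mathbb{R}^d$ and let $Z_n$ be a sequence of stochastic (Markov) processes in $\mathbb{R}^d$ with generators $A_n$. Assume that $A_n$ has a decomposition $A_n=A_{1,n}+A_{2,n}$ on a common core, and that $A_{1,n}$ and $A_{2,n}$ independently generate stochastic processes $X_n$ and $Y_n$. Assume moreover: (a) $A_n$, $A_{1,n}$ and $A_{2,n}$ share a common unique invariant measure $\pi_n$, and $\pi_n$ satisfies a large deviation principle on $\mathbb{R}^d$ with speed $n$ and rate function $S\in C^1(\mathbb{R}^d)$; (b) $\pi_n$ is reversible for $A_{2,n}$; (c) each of the processes $Z_n$, $X_n$, $Y_n$ satisfies a large deviation principle on $D_{\mathbb{R}^d}([0,\infty))$ with speed $n$ and with rate function of Lagrangian form, with Lagrangians $\mathcal{L}$, $\mathcal{L}_1$, $\mathcal{L}_2$ respectively; these Lagrangians correspond to Hamiltonians $H$, $H_1$, $H_2$ satisfying $H=H_1+H_2$ and $$Hf(z)=\mathcal{H}(z,\mathrm{d}f(z)),\quad H_1f(z)=\mathcal{H}_1(z,\mathrm{d}f(z)),\quad H_2f(z)=\mathcal{H}_2(z,\mathrm{d}f(z));$$ (d) $\mathcal{H}_1(z,\xi)=\langle W(z),\xi\rangle$ for some vector field $W\in C(\mathbb{R}^d;\mathbb{R}^d)$, and $\mathcal{H}_2$ is continuous and convex in the second coordinate. Then the limiting dynamics of $Z_n$ are pre-GENERIC for $S$ with vector field $W$ and dissipation potentials $(\Psi,\Psi^* )$, where $$\Psi^*(z,\xi)=\mathcal{H}_2\bigl(z,\xi+\tfrac12\mathrm{d}S(z)\bigr)-\mathcal{H}_2\bigl(z,\tfrac12\mathrm{d}S(z)\bigr)$$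 and $\Psi(z,v)=\sup_{\xi}\{\langle v,\xi\rangle-\Psi^*(z,\xi)\}$ is its Legendre transform.
   Context: $D_{\mathbb{R}^d}([0,\infty))$ is the Skorokhod space of càdlàg paths. A rate function is of Lagrangian form with Lagrangian $\mathcal{L}$ if it equals $I(\gamma)=I_0(\gamma(0))+\int_0^\infty\mathcal{L}(\gamma(s),\dot\gamma(s))\,\mathrm{d}s$ for absolutely continuous $\gamma$ and $+\infty$ otherwise, where $I_0$ is the large deviation rate function (speed $n$) of the laws of the processes at time zero. The Lagrangians $\mathcal{L},\mathcal{L}_1,\mathcal{L}_2:\mathbb{R}^d\times\mathbb{R}^d\to[0,\infty]$ and Hamiltonian functions $\mathcal{H},\mathcal{H}_1,\mathcal{H}_2:\mathbb{R}^d\times\mathbb{R}^d\to\mathbb{R}$ are convex in the second variable and Legendre duals of each other in that variable, e.g. $\mathcal{L}(z,v)=\sup_\xi\{\langle v,\xi\rangle-\mathcal{H}(z,\xi)\}$, with $\mathcal{H}(z,0)=\mathcal{H}_1(z,0)=\mathcal{H}_2(z,0)=0$. The limiting dynamics of $Z_n$ is $\dot z=\mathbf{F}(z)$, where $\mathbf{F}$ is the zero-cost flow of $\mathcal{L}$: $\mathcal{L}(z,v)=0$ if and only if $v=\mathbf{F}(z)$. Dissipation potentials: a pair $\Psi,\Psi^*$ with values in $[0,\infty]$, Legendre duals of each other in the second argument, such that $\Psi,\Psi^*$ are strictly convex (in the second argument) and continuously differentiable, and $\Psi(z,0)=\Psi^*(z,0)=0$. Symmetric means even in the second argument. Pre-GENERIC: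 $\mathbf{F}$ is pre-GENERIC for $S$ with dissipation potentials $(\Psi,\Psi^* )$ and vector field $W$ if $(\Psi,\Psi^* )$ are symmetric dissipation potentials, $\langle W(z),\mathrm{d}S(z)\rangle=0$ for all $z$, and for all $z$ $$\Psi(z,\mathbf{F}(z)-W(z))+\Psi^*\bigl(z,-\tfrac12\mathrm{d}S(z)\bigr)+\tfrac12\langle \mathbf{F}(z),\mathrm{d}S(z)\rangle=0.$$
   Formalization: Strict convexity and C¹ of Ψ, Ψ* are concluded only if H₂ and L₂ have them in the second variable; all other pre-GENERIC clauses hold outright. X_n and Y_n start from π_n, since with arbitrary initial laws the claim fails. *)

theory Defs
  imports "HOL-Probability.Probability"
begin

section \<open>Path space\<close>

text \<open>
  Paths on \<open>[0,\<infinity>)\<close> are functions on the reals that carry no information on negative times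
  (\<^const>\<open>extensional\<close>), so that equal paths are equal functions.
\<close>

definition cadlag :: "(real \<Rightarrow> 'a::topological_space) set" where
  "cadlag = {\<gamma> \<in> extensional {0..}.
     (\<forall>t\<ge>0. (\<gamma> \<longlongrightarrow> \<gamma> t) (at_right t)) \<and> (\<forall>t>0. \<exists>l. (\<gamma> \<longlongrightarrow> l) (at_left t))}"

definition time_change :: "(real \<Rightarrow> real) \<Rightarrow> bool" where
  "time_change l \<longleftrightarrow> strict_mono_on {0..} l \<and> l ` {0..} = {0..}"

text \<open>
  A sequence converges in the Skorokhod (J1) topology of \<open>D([0,\<infinity>))\<close> iff for every \<open>T\<close> there are
  time changes \<open>l\<^sub>n\<close> with \<open>sup\<^sub>t\<^sub>\<le>\<^sub>T \<bar>l\<^sub>n t - t\<bar> \<rightarrow> 0\<close> and \<open>sup\<^sub>t\<^sub>\<le>\<^sub>T dist (x\<^sub>n t) (x (l\<^sub>n t)) \<rightarrow> 0\<close>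
  (Ethier and Kurtz, Markov Processes, Proposition 3.5.3), that is, iff it is eventually in each
  of the following sets. As the topology is metrizable, these sets form a neighbourhood base at
  \<open>x\<close>; they need not be open themselves.
\<close>

definition skorokhod_nhd :: "(real \<Rightarrow> 'a::metric_space) \<Rightarrow> real \<Rightarrow> real \<Rightarrow> (real \<Rightarrow> 'a) set" where
  "skorokhod_nhd x T \<epsilon> =
     {y \<in> cadlag. \<exists>l. time_change l \<and>
        (\<forall>t\<in>{0..T}. \<bar>l t - t\<bar> < \<epsilon> \<and> dist (y t) (x (l t)) < \<epsilon>)}"

definition skorokhod :: "(real \<Rightarrow> 'a::metric_space) topology" where
  "skorokhod = topology (\<lambda>U. U \<subseteq> cadlag \<and> (\<forall>x\<in>U. \<exists>T \<epsilon>. \<epsilon> > 0 \<and> skorokhod_nhd x T \<epsilon> \<subseteq> U))"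

lemma skorokhod_nhd_mono:
  "T' \<le> T \<Longrightarrow> \<epsilon> \<le> \<epsilon>' \<Longrightarrow> skorokhod_nhd x T \<epsilon> \<subseteq> skorokhod_nhd x T' \<epsilon>'"
  unfolding skorokhod_nhd_def
  by clarsimp (meson atLeastAtMost_iff less_le_trans order_trans)

lemma openin_skorokhod:
  "openin skorokhod U \<longleftrightarrow>
     U \<subseteq> cadlag \<and> (\<forall>x\<in>U. \<exists>T \<epsilon>. \<epsilon> > 0 \<and> skorokhod_nhd x T \<epsilon> \<subseteq> U)"
proof -
  have "istopology (\<lambda>U :: (real \<Rightarrow> 'a) set.
          U \<subseteq> cadlag \<and> (\<forall>x\<in>U. \<exists>T \<epsilon>. \<epsilon> > 0 \<and> skorokhod_nhd x T \<epsilon> \<subseteq> U))"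
    unfolding istopology_def
  proof (intro conjI allI impI; (elim conjE)?)
    fix U V :: "(real \<Rightarrow> 'a) set"
    assume U: "\<forall>x\<in>U. \<exists>T \<epsilon>. \<epsilon> > 0 \<and> skorokhod_nhd x T \<epsilon> \<subseteq> U"
      and V: "\<forall>x\<in>V. \<exists>T \<epsilon>. \<epsilon> > 0 \<and> skorokhod_nhd x T \<epsilon> \<subseteq> V"
    show "\<forall>x\<in>U \<inter> V. \<exists>T \<epsilon>. \<epsilon> > 0 \<and> skorokhod_nhd x T \<epsilon> \<subseteq> U \<inter> V"
    proof
      fix x assume "x \<in> U \<inter> V"
      with U V obtain T \<epsilon> T' \<epsilon>' where
        "\<epsilon> > 0" "skorokhod_nhd x T \<epsilon> \<subseteq> U" "\<epsilon>' > 0" "skorokhod_nhd x T' \<epsilon>' \<subseteq> V"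
        by blast
      then show "\<exists>T \<epsilon>. \<epsilon> > 0 \<and> skorokhod_nhd x T \<epsilon> \<subseteq> U \<inter> V"
        using skorokhod_nhd_mono[of T "max T T'" "min \<epsilon> \<epsilon>'" \<epsilon> x]
          skorokhod_nhd_mono[of T' "max T T'" "min \<epsilon> \<epsilon>'" \<epsilon>' x]
        by (intro exI[of _ "max T T'"] exI[of _ "min \<epsilon> \<epsilon>'"]) auto
    qed
  next
    fix \<K> :: "(real \<Rightarrow> 'a) set set"
    assume "\<forall>K\<in>\<K>. K \<subseteq> cadlag \<and> (\<forall>x\<in>K. \<exists>T \<epsilon>. \<epsilon> > 0 \<and> skorokhod_nhd x T \<epsilon> \<subseteq> K)"
    then show "\<forall>x\<in>\<Union>\<K>. \<exists>T \<epsilon>. \<epsilon> > 0 \<and> skorokhod_nhd x T \<epsilon> \<subseteq> \<Union>\<K>"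
      by (meson Union_upper UnionE order_trans)
  qed auto
  then show ?thesis
    unfolding skorokhod_def by (simp add: topology_inverse')
qed

lemma topspace_skorokhod: "topspace skorokhod = cadlag"
proof -
  have "openin skorokhod (cadlag :: (real \<Rightarrow> 'a::metric_space) set)"
    unfolding openin_skorokhod by (auto simp: skorokhod_nhd_def intro: exI[of _ "1::real"])
  then show ?thesis
    by (metis openin_skorokhod openin_subset openin_topspace subset_antisym)
qed


section \<open>Large deviation principles\<close>

definition borel_of :: "'a topology \<Rightarrow> 'a measure" where
  "borel_of T = sigma (topspace T) {U. openin T U}"

lemma borel_of_euclidean: "borel_of euclidean = borel"
  by (simp add: borel_of_def borel_def)

definition rate_function :: "'a topology \<Rightarrow> ('a \<Rightarrow> ereal) \<Rightarrow> bool" where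
  "rate_function T I \<longleftrightarrow>
     (\<forall>x\<in>topspace T. 0 \<le> I x) \<and> (\<forall>c. closedin T {x \<in> topspace T. I x \<le> c})"

definition elog :: "real \<Rightarrow> ereal" where
  "elog p = (if p \<le> 0 then -\<infinity> else ereal (ln p))"

text \<open>Large deviation principle with speed \<open>n\<close>.\<close>

definition LDP :: "'a topology \<Rightarrow> (nat \<Rightarrow> 'a measure) \<Rightarrow> ('a \<Rightarrow> ereal) \<Rightarrow> bool" where
  "LDP T M I \<longleftrightarrow>
     rate_function T I \<and>
     (\<forall>n. prob_space (M n) \<and> sets (M n) = sets (borel_of T)) \<and>
     (\<forall>C. closedin T C \<longrightarrow>
        limsup (\<lambda>n. ereal (1 / real n) * elog (measure (M n) C)) \<le> - (INF x\<in>C. I x)) \<and>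
     (\<forall>G. openin T G \<longrightarrow>
        - (INF x\<in>G. I x) \<le> liminf (\<lambda>n. ereal (1 / real n) * elog (measure (M n) G)))"

text \<open>
  \<open>has_velocity \<gamma> g\<close>: the path \<open>\<gamma>\<close> is absolutely continuous on compact time intervals with almost
  everywhere derivative \<open>g\<close>. The function \<open>g\<close> is unique up to null sets, so the choice made in
  \<open>velocity\<close> does not affect integrals of it.
\<close>

definition has_velocity :: "(real \<Rightarrow> 'a::euclidean_space) \<Rightarrow> (real \<Rightarrow> 'a) \<Rightarrow> bool" where
  "has_velocity \<gamma> g \<longleftrightarrow>
     (\<forall>T\<ge>0. set_integrable lborel {0..T} g \<and> \<gamma> T = \<gamma> 0 + set_lebesgue_integral lborel {0..T} g)"

definition abs_cont :: "(real \<Rightarrow> 'a::euclidean_space) \<Rightarrow> bool" where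
  "abs_cont \<gamma> \<longleftrightarrow> (\<exists>g. has_velocity \<gamma> g)"

definition velocity :: "(real \<Rightarrow> 'a::euclidean_space) \<Rightarrow> real \<Rightarrow> 'a" where
  "velocity \<gamma> = (SOME g. has_velocity \<gamma> g)"

definition lagrangian_rate ::
  "('a::euclidean_space \<Rightarrow> ereal) \<Rightarrow> ('a \<Rightarrow> 'a \<Rightarrow> ereal) \<Rightarrow> (real \<Rightarrow> 'a) \<Rightarrow> ereal" where
  "lagrangian_rate I0 L \<gamma> =
     (if abs_cont \<gamma>
      then I0 (\<gamma> 0) + enn2ereal (\<integral>\<^sup>+ s\<in>{0..}. e2ennreal (L (\<gamma> s) (velocity \<gamma> s)) \<partial>lborel)
      else \<infinity>)"

definition initial_law :: "(real \<Rightarrow> 'a::euclidean_space) measure \<Rightarrow> 'a measure" where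
  "initial_law Q = distr Q borel (\<lambda>\<gamma>. \<gamma> 0)"

definition LDP_lagrangian ::
  "(nat \<Rightarrow> (real \<Rightarrow> 'a::euclidean_space) measure) \<Rightarrow> ('a \<Rightarrow> 'a \<Rightarrow> ereal) \<Rightarrow> bool" where
  "LDP_lagrangian Q L \<longleftrightarrow>
     (\<exists>I0. LDP euclidean (\<lambda>n. initial_law (Q n)) I0 \<and> LDP skorokhod Q (lagrangian_rate I0 L))"


section \<open>Markov processes and generators\<close>

definition transition_function :: "(real \<Rightarrow> 'a::euclidean_space \<Rightarrow> 'a measure) \<Rightarrow> bool" where
  "transition_function P \<longleftrightarrow>
     (\<forall>t\<ge>0. P t \<in> borel \<rightarrow>\<^sub>M prob_algebra borel) \<and>
     (\<forall>x. P 0 x = return borel x) \<and>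
     (\<forall>s\<ge>0. \<forall>t\<ge>0. \<forall>x. P (s + t) x = P s x \<bind> P t)"

definition semigroup ::
  "(real \<Rightarrow> 'a::euclidean_space \<Rightarrow> 'a measure) \<Rightarrow> real \<Rightarrow> ('a \<Rightarrow> real) \<Rightarrow> 'a \<Rightarrow> real" where
  "semigroup P t f x = (\<integral>y. f y \<partial>P t x)"

definition bounded_borel :: "('a::euclidean_space \<Rightarrow> real) set" where
  "bounded_borel = {f \<in> borel_measurable borel. bounded (range f)}"

text \<open>
  \<open>L\<close> is a sup-norm closed, measure-determining subspace of the bounded Borel functions, as in
  Ethier and Kurtz, Chapter 4. The Feller case is the one where \<open>L\<close> consists of the continuous
  functions vanishing at infinity.
\<close>

definition domain_space :: "('a::euclidean_space \<Rightarrow> real) set \<Rightarrow> bool" where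
  "domain_space L \<longleftrightarrow>
     L \<subseteq> bounded_borel \<and>
     (\<lambda>x. 0) \<in> L \<and>
     (\<forall>f\<in>L. \<forall>g\<in>L. \<forall>a b. (\<lambda>x. a * f x + b * g x) \<in> L) \<and>
     (\<forall>fs f. (\<forall>k. fs k \<in> L) \<and> uniform_limit UNIV fs f sequentially \<longrightarrow> f \<in> L) \<and>
     (\<forall>\<mu> \<nu>. prob_space \<mu> \<and> sets \<mu> = sets borel \<and> prob_space \<nu> \<and> sets \<nu> = sets borel \<and>
        (\<forall>f\<in>L. (\<integral>x. f x \<partial>\<mu>) = (\<integral>x. f x \<partial>\<nu>)) \<longrightarrow> \<mu> = \<nu>)"

definition strongly_continuous ::
  "('a::euclidean_space \<Rightarrow> real) set \<Rightarrow> (real \<Rightarrow> 'a \<Rightarrow> 'a measure) \<Rightarrow> bool" where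
  "strongly_continuous L P \<longleftrightarrow>
     (\<forall>t\<ge>0. \<forall>f\<in>L. semigroup P t f \<in> L) \<and>
     (\<forall>f\<in>L. uniform_limit UNIV (\<lambda>t. semigroup P t f) f (at_right 0))"

text \<open>Operators are given by their graphs.\<close>

definition generator ::
  "('a::euclidean_space \<Rightarrow> real) set \<Rightarrow> (real \<Rightarrow> 'a \<Rightarrow> 'a measure) \<Rightarrow>
   (('a \<Rightarrow> real) \<times> ('a \<Rightarrow> real)) set" where
  "generator L P =
     {(f, g). f \<in> L \<and> g \<in> L \<and>
        uniform_limit UNIV (\<lambda>t x. (semigroup P t f x - f x) / t) g (at_right 0)}"

definition generates ::
  "('a::euclidean_space \<Rightarrow> real) set \<Rightarrow> (('a \<Rightarrow> real) \<times> ('a \<Rightarrow> real)) set \<Rightarrow>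
   (real \<Rightarrow> 'a \<Rightarrow> 'a measure) \<Rightarrow> bool" where
  "generates L A P \<longleftrightarrow>
     domain_space L \<and> transition_function P \<and> strongly_continuous L P \<and> A = generator L P"

definition core :: "(('a \<Rightarrow> real) \<times> ('a \<Rightarrow> real)) set \<Rightarrow> ('a \<Rightarrow> real) set \<Rightarrow> bool" where
  "core A D \<longleftrightarrow>
     D \<subseteq> Domain A \<and>
     (\<lambda>x. 0) \<in> D \<and> (\<forall>f\<in>D. \<forall>g\<in>D. \<forall>a b. (\<lambda>x. a * f x + b * g x) \<in> D) \<and>
     (\<forall>(f, g)\<in>A. \<exists>fs gs. (\<forall>k. fs k \<in> D \<and> (fs k, gs k) \<in> A) \<and>
        uniform_limit UNIV fs f sequentially \<and> uniform_limit UNIV gs g sequentially)"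

definition decomposes_on_common_core ::
  "(('a \<Rightarrow> real) \<times> ('a \<Rightarrow> real)) set \<Rightarrow> (('a \<Rightarrow> real) \<times> ('a \<Rightarrow> real)) set \<Rightarrow>
   (('a \<Rightarrow> real) \<times> ('a \<Rightarrow> real)) set \<Rightarrow> bool" where
  "decomposes_on_common_core A A1 A2 \<longleftrightarrow>
     (\<exists>D. core A D \<and> core A1 D \<and> core A2 D \<and>
        (\<forall>f\<in>D. \<forall>g1 g2. (f, g1) \<in> A1 \<and> (f, g2) \<in> A2 \<longrightarrow> (f, \<lambda>x. g1 x + g2 x) \<in> A))"

definition invariant_measure ::
  "(('a::euclidean_space \<Rightarrow> real) \<times> ('a \<Rightarrow> real)) set \<Rightarrow> 'a measure \<Rightarrow> bool" where
  "invariant_measure A \<pi> \<longleftrightarrow>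
     prob_space \<pi> \<and> sets \<pi> = sets borel \<and> (\<forall>(f, g)\<in>A. (\<integral>x. g x \<partial>\<pi>) = 0)"

definition reversible_measure ::
  "(('a::euclidean_space \<Rightarrow> real) \<times> ('a \<Rightarrow> real)) set \<Rightarrow> 'a measure \<Rightarrow> bool" where
  "reversible_measure A \<pi> \<longleftrightarrow>
     prob_space \<pi> \<and> sets \<pi> = sets borel \<and>
     (\<forall>(f, Af)\<in>A. \<forall>(g, Ag)\<in>A. (\<integral>x. f x * Ag x \<partial>\<pi>) = (\<integral>x. Af x * g x \<partial>\<pi>))"

definition past :: "real \<Rightarrow> (real \<Rightarrow> 'a::euclidean_space) measure" where
  "past t = sigma cadlag {{\<gamma> \<in> cadlag. \<gamma> s \<in> B} | s B. 0 \<le> s \<and> s \<le> t \<and> B \<in> sets borel}"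

text \<open>\<open>Q\<close> is the law on path space of a Markov process with transition function \<open>P\<close>.\<close>

definition markov_law ::
  "(real \<Rightarrow> 'a::euclidean_space \<Rightarrow> 'a measure) \<Rightarrow> (real \<Rightarrow> 'a) measure \<Rightarrow> bool" where
  "markov_law P Q \<longleftrightarrow>
     prob_space Q \<and> sets Q = sets (borel_of skorokhod) \<and>
     (\<forall>s\<ge>0. \<forall>t\<ge>0. \<forall>f\<in>bounded_borel.
        AE \<gamma> in Q. real_cond_exp Q (past t) (\<lambda>\<gamma>. f (\<gamma> (t + s))) \<gamma> = semigroup P s f (\<gamma> t))"


section \<open>Hamiltonians, Lagrangians and pre-GENERIC structure\<close>

definition grad :: "('a::euclidean_space \<Rightarrow> real) \<Rightarrow> 'a \<Rightarrow> 'a" where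
  "grad f z = (THE D. GDERIV f z :> D)"

definition C1 :: "('a::euclidean_space \<Rightarrow> real) \<Rightarrow> bool" where
  "C1 f \<longleftrightarrow> (\<exists>D. (\<forall>z. GDERIV f z :> D z) \<and> continuous_on UNIV D)"

definition legendre :: "('a::euclidean_space \<Rightarrow> ereal) \<Rightarrow> 'a \<Rightarrow> ereal" where
  "legendre f v = (SUP \<xi>. ereal (v \<bullet> \<xi>) - f \<xi>)"

text \<open>The convexity notions below are meant for functions that do not take the value \<open>-\<infinity>\<close>.\<close>

definition convex_ereal :: "('a::euclidean_space \<Rightarrow> ereal) \<Rightarrow> bool" where
  "convex_ereal f \<longleftrightarrow>
     (\<forall>x y t. 0 < t \<and> t < 1 \<longrightarrow>
        f ((1 - t) *\<^sub>R x + t *\<^sub>R y) \<le> ereal (1 - t) * f x + ereal t * f y)"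

definition strictly_convex_ereal :: "('a::euclidean_space \<Rightarrow> ereal) \<Rightarrow> bool" where
  "strictly_convex_ereal f \<longleftrightarrow>
     (\<forall>x y t. x \<noteq> y \<and> f x < \<infinity> \<and> f y < \<infinity> \<and> 0 < t \<and> t < 1 \<longrightarrow>
        f ((1 - t) *\<^sub>R x + t *\<^sub>R y) < ereal (1 - t) * f x + ereal t * f y)"

text \<open>
  Continuous differentiability of a function that may take the value \<open>\<infinity>\<close> is understood in the
  interior of its effective domain.
\<close>

definition C1_ereal :: "('a::euclidean_space \<Rightarrow> ereal) \<Rightarrow> bool" where
  "C1_ereal f \<longleftrightarrow>
     (\<exists>D. (\<forall>v\<in>interior {v. f v < \<infinity>}. GDERIV (\<lambda>v. real_of_ereal (f v)) v :> D v) \<and>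
        continuous_on (interior {v. f v < \<infinity>}) D)"

definition hamiltonian_lagrangian ::
  "('a::euclidean_space \<Rightarrow> 'a \<Rightarrow> real) \<Rightarrow> ('a \<Rightarrow> 'a \<Rightarrow> ereal) \<Rightarrow> bool" where
  "hamiltonian_lagrangian \<H> \<L> \<longleftrightarrow>
     (\<forall>z. convex_on UNIV (\<H> z) \<and> \<H> z 0 = 0 \<and>
        convex_ereal (\<L> z) \<and> (\<forall>v. 0 \<le> \<L> z v) \<and>
        (\<forall>v. \<L> z v = legendre (\<lambda>\<xi>. ereal (\<H> z \<xi>)) v) \<and>
        (\<forall>\<xi>. ereal (\<H> z \<xi>) = legendre (\<L> z) \<xi>))"

definition regular :: "('a::euclidean_space \<Rightarrow> 'a \<Rightarrow> ereal) \<Rightarrow> bool" where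
  "regular \<Psi> \<longleftrightarrow> (\<forall>z. strictly_convex_ereal (\<Psi> z) \<and> C1_ereal (\<Psi> z))"

definition dual_potentials ::
  "('a::euclidean_space \<Rightarrow> 'a \<Rightarrow> ereal) \<Rightarrow> ('a \<Rightarrow> 'a \<Rightarrow> ereal) \<Rightarrow> bool" where
  "dual_potentials \<Psi> \<Psi>s \<longleftrightarrow>
     (\<forall>z. (\<forall>v. 0 \<le> \<Psi> z v) \<and> (\<forall>\<xi>. 0 \<le> \<Psi>s z \<xi>) \<and>
        convex_ereal (\<Psi> z) \<and> convex_ereal (\<Psi>s z) \<and>
        (\<forall>v. \<Psi> z v = legendre (\<Psi>s z) v) \<and> (\<forall>\<xi>. \<Psi>s z \<xi> = legendre (\<Psi> z) \<xi>) \<and>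
        \<Psi> z 0 = 0 \<and> \<Psi>s z 0 = 0)"

definition dissipation_potentials ::
  "('a::euclidean_space \<Rightarrow> 'a \<Rightarrow> ereal) \<Rightarrow> ('a \<Rightarrow> 'a \<Rightarrow> ereal) \<Rightarrow> bool" where
  "dissipation_potentials \<Psi> \<Psi>s \<longleftrightarrow> dual_potentials \<Psi> \<Psi>s \<and> regular \<Psi> \<and> regular \<Psi>s"

definition symmetric :: "('a::euclidean_space \<Rightarrow> 'a \<Rightarrow> ereal) \<Rightarrow> bool" where
  "symmetric \<Psi> \<longleftrightarrow> (\<forall>z v. \<Psi> z (- v) = \<Psi> z v)"

definition generic_relations ::
  "('a::euclidean_space \<Rightarrow> 'a) \<Rightarrow> ('a \<Rightarrow> real) \<Rightarrow> ('a \<Rightarrow> 'a) \<Rightarrow>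
   ('a \<Rightarrow> 'a \<Rightarrow> ereal) \<Rightarrow> ('a \<Rightarrow> 'a \<Rightarrow> ereal) \<Rightarrow> bool" where
  "generic_relations F S W \<Psi> \<Psi>s \<longleftrightarrow>
     (\<forall>z. W z \<bullet> grad S z = 0) \<and>
     (\<forall>z. \<Psi> z (F z - W z) + \<Psi>s z (- ((1/2) *\<^sub>R grad S z)) + ereal ((1/2) * (F z \<bullet> grad S z)) = 0)"

definition pre_GENERIC ::
  "('a::euclidean_space \<Rightarrow> 'a) \<Rightarrow> ('a \<Rightarrow> real) \<Rightarrow> ('a \<Rightarrow> 'a) \<Rightarrow>
   ('a \<Rightarrow> 'a \<Rightarrow> ereal) \<Rightarrow> ('a \<Rightarrow> 'a \<Rightarrow> ereal) \<Rightarrow> bool" where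
  "pre_GENERIC F S W \<Psi> \<Psi>s \<longleftrightarrow>
     dissipation_potentials \<Psi> \<Psi>s \<and> symmetric \<Psi> \<and> symmetric \<Psi>s \<and> generic_relations F S W \<Psi> \<Psi>s"

text \<open>
  All of \<open>pre_GENERIC\<close> except strict convexity and differentiability of the two potentials; it
  also covers degenerate cases such as \<open>\<Psi>s = 0\<close>.
\<close>

definition pre_GENERIC_without_regularity ::
  "('a::euclidean_space \<Rightarrow> 'a) \<Rightarrow> ('a \<Rightarrow> real) \<Rightarrow> ('a \<Rightarrow> 'a) \<Rightarrow>
   ('a \<Rightarrow> 'a \<Rightarrow> ereal) \<Rightarrow> ('a \<Rightarrow> 'a \<Rightarrow> ereal) \<Rightarrow> bool" where
  "pre_GENERIC_without_regularity F S W \<Psi> \<Psi>s \<longleftrightarrow>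
     dual_potentials \<Psi> \<Psi>s \<and> symmetric \<Psi> \<and> symmetric \<Psi>s \<and> generic_relations F S W \<Psi> \<Psi>s"

end

theory Submission
  imports Defs "HOL-Complex_Analysis.Great_Picard" "HOL-Real_Asymp.Real_Asymp"
begin

text \<open>
  The algebra behind the theorem is short: if \<open>\<H>2 z\<close> is symmetric under \<open>\<xi> \<mapsto> dS(z) - \<xi>\<close> and
  \<open>\<langle>W, dS\<rangle> = 0\<close>, then \<open>\<Psi>*\<close> is even, \<open>\<Psi>\<close> is \<open>\<L>2\<close> plus an affine function, and the pre-GENERIC
  relation is \<open>\<L>2(z, F - W) = \<L>(z, F) = 0\<close>. Both facts have to be read off the path-space
  large deviations.

  Stationarity (reversibility) of \<open>\<pi>\<^sub>n\<close> at the level of generators makes the law of \<open>\<gamma> t\<close>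
  (of the pair \<open>(\<gamma> 0, \<gamma> t)\<close>) invariant (exchangeable), so every cheap path through small balls at
  times \<open>0\<close> and \<open>t\<close> has an equally cheap partner with the times exchanged. For \<open>X\<^sub>n\<close>, finite cost
  forces \<open>\<gamma>' = W(\<gamma>)\<close>; comparing \<open>S\<close> at both ends of short trajectories gives \<open>\<langle>W, dS\<rangle> = 0\<close>. For
  \<open>Y\<^sub>n\<close>, the differential inclusion \<open>\<gamma>' \<in> \<partial>\<H>2(\<gamma>, p)\<close> provides a short path whose cost is
  \<open>\<integral> \<langle>\<gamma>', p\<rangle> - \<H>2(\<gamma>, p)\<close>, while the cost of its partner is at least
  \<open>\<integral> \<langle>\<eta>', q\<rangle> - \<H>2(\<eta>, q)\<close> with \<open>q = dS - p\<close>; hence \<open>\<H>2(z, p) \<le> \<H>2(z, q)\<close>, and equality by exchanging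
  \<open>p\<close> and \<open>q\<close>. The inclusion is solved backwards because the large deviation principle
  only provides global cheap continuations from a dense set of points.
\<close>

section \<open>Reflection symmetry implies pre-GENERIC\<close>

text \<open>The exchange of times moves the boundary term of the rate function. A segment from x to
  y costs about S(x) + \<langle>y - x, p\<rangle> - t H(z, p), its partner from y to x at least S(y)
  + \<langle>x - y, q\<rangle> - t H(z, q). With S(x) - S(y) replaced by \<langle>x - y,
  dS(z)\<rangle>, all terms of the size of the displacement cancel exactly for q = dS(z) - p, and
  H(z, p) - H(z, q) survives at order t.

  Three obstacles shape the details. \<open>\<H>2\<close> need not be differentiable in \<xi>, so
  the optimal velocity is a subgradient without a continuous choice; the segment is a limit of Euler
  polygons along almost optimal velocities. Rate functions have closed, not necessarily compact,
  sublevel sets, so every transfer of paths works with strict inequalities and a slack \<delta>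
  instead of minimisers. Finally, \<open>\<H>2\<close> is controlled only near z, so transferred
  paths must be shown to stay there. Parameters are chosen in the order tolerance \<kappa>, radius
  r, duration t, slack \<delta>; limits are taken backwards: \<delta> to 0 with t fixed, division by
  t, then \<kappa> to 0.\<close>

lemma legendre_shift:
  fixes h :: "'a::euclidean_space \<Rightarrow> real"
  shows "legendre (\<lambda>\<xi>. ereal (h (\<xi> + a) - h a)) v =
    legendre (\<lambda>\<xi>. ereal (h \<xi>)) v + ereal (h a - v \<bullet> a)"
proof -
  have "legendre (\<lambda>\<xi>. ereal (h \<xi>)) v = (SUP \<xi>. ereal (v \<bullet> (\<xi> + a)) - ereal (h (\<xi> + a)))"
    unfolding legendre_def
  proof (intro SUP_eq)
    fix \<xi> :: 'a
    show "\<exists>\<eta>\<in>UNIV. ereal (v \<bullet> \<xi>) - ereal (h \<xi>) \<le> ereal (v \<bullet> (\<eta> + a)) - ereal (h (\<eta> + a))"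
      by (intro bexI[of _ "\<xi> - a"]) auto
  qed auto
  also have "\<dots> + ereal (h a - v \<bullet> a) =
      (SUP \<xi>. (ereal (v \<bullet> (\<xi> + a)) - ereal (h (\<xi> + a))) + ereal (h a - v \<bullet> a))"
    by (subst SUP_ereal_add_left) auto
  also have "\<dots> = legendre (\<lambda>\<xi>. ereal (h (\<xi> + a) - h a)) v"
    unfolding legendre_def by (intro SUP_cong) (auto simp: inner_add_right)
  finally show ?thesis ..
qed

text \<open>Dual counterpart of the translation rule: an affine term shifts the argument of the
  transform. Nonnegativity excludes the value -\<infinity>, so sums and differences of extended
  reals can be regrouped.\<close>

lemma legendre_add_affine:
  fixes f :: "'a::euclidean_space \<Rightarrow> ereal"
  assumes "\<And>v. 0 \<le> f v"
  shows "legendre (\<lambda>v. f v + ereal (c - v \<bullet> a)) \<xi> = legendre f (\<xi> + a) - ereal c"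
proof -
  have "legendre f (\<xi> + a) - ereal c = legendre f (\<xi> + a) + ereal (- c)"
    by (simp add: minus_ereal_def)
  also have "\<dots> = (SUP v. ereal ((\<xi> + a) \<bullet> v) - f v + ereal (- c))"
    unfolding legendre_def by (subst SUP_ereal_add_left) auto
  also have "\<dots> = legendre (\<lambda>v. f v + ereal (c - v \<bullet> a)) \<xi>"
    unfolding legendre_def
  proof (intro SUP_cong refl)
    fix v show "ereal ((\<xi> + a) \<bullet> v) - f v + ereal (- c) = ereal (\<xi> \<bullet> v) - (f v + ereal (c - v \<bullet> a))"
      using assms[of v] by (cases "f v") (auto simp: inner_add_left inner_add_right inner_commute[of v])
  qed
  finally show ?thesis ..
qed

lemma convex_ereal_add_affine:
  fixes f :: "'a::euclidean_space \<Rightarrow> ereal"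
  assumes "convex_ereal f" and nn: "\<And>v. 0 \<le> f v"
  shows "convex_ereal (\<lambda>v. f v + ereal (c - v \<bullet> a))"
  unfolding convex_ereal_def
proof (intro allI impI)
  fix x y :: 'a and t :: real assume t: "0 < t \<and> t < 1"
  define w where "w = (1 - t) *\<^sub>R x + t *\<^sub>R y"
  have le: "f w \<le> ereal (1 - t) * f x + ereal t * f y"
    using assms(1) t unfolding convex_ereal_def w_def by blast
  have w: "c - w \<bullet> a = (1 - t) * (c - x \<bullet> a) + t * (c - y \<bullet> a)"
    by (simp add: w_def inner_add_left algebra_simps)
  show "f w + ereal (c - w \<bullet> a)
      \<le> ereal (1 - t) * (f x + ereal (c - x \<bullet> a)) + ereal t * (f y + ereal (c - y \<bullet> a))"
    unfolding w using le t nn[of x] nn[of y] nn[of w]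
    by (cases "f x"; cases "f y"; cases "f w") (auto simp: algebra_simps)
qed

lemma strictly_convex_ereal_add_affine:
  fixes f :: "'a::euclidean_space \<Rightarrow> ereal"
  assumes "strictly_convex_ereal f" and nn: "\<And>v. 0 \<le> f v"
  shows "strictly_convex_ereal (\<lambda>v. f v + ereal (c - v \<bullet> a))"
  unfolding strictly_convex_ereal_def
proof (intro allI impI)
  fix x y :: 'a and t :: real
  assume A: "x \<noteq> y \<and> f x + ereal (c - x \<bullet> a) < \<infinity> \<and> f y + ereal (c - y \<bullet> a) < \<infinity> \<and> 0 < t \<and> t < 1"
  then have fin: "f x < \<infinity>" "f y < \<infinity>" by auto
  define w where "w = (1 - t) *\<^sub>R x + t *\<^sub>R y"
  have less: "f w < ereal (1 - t) * f x + ereal t * f y"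
    using assms(1) A fin unfolding strictly_convex_ereal_def w_def by blast
  have w: "c - w \<bullet> a = (1 - t) * (c - x \<bullet> a) + t * (c - y \<bullet> a)"
    by (simp add: w_def inner_add_left algebra_simps)
  show "f w + ereal (c - w \<bullet> a)
      < ereal (1 - t) * (f x + ereal (c - x \<bullet> a)) + ereal t * (f y + ereal (c - y \<bullet> a))"
    unfolding w using less A fin nn[of x] nn[of y] nn[of w]
    by (cases "f x"; cases "f y"; cases "f w") (auto simp: algebra_simps)
qed

lemma C1_ereal_add_affine:
  fixes f :: "'a::euclidean_space \<Rightarrow> ereal"
  assumes "C1_ereal f" and nn: "\<And>v. 0 \<le> f v"
  shows "C1_ereal (\<lambda>v. f v + ereal (c - v \<bullet> a))"
proof -
  let ?V = "{v. f v < \<infinity>}"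
  obtain D where D: "\<And>v. v \<in> interior ?V \<Longrightarrow> GDERIV (\<lambda>v. real_of_ereal (f v)) v :> D v"
    and cont: "continuous_on (interior ?V) D"
    using assms(1) unfolding C1_ereal_def by blast
  have dom: "{v. f v + ereal (c - v \<bullet> a) < \<infinity>} = ?V" by auto
  have "GDERIV (\<lambda>v. real_of_ereal (f v + ereal (c - v \<bullet> a))) v :> D v - a" if v: "v \<in> interior ?V" for v
  proof -
    have "GDERIV (\<lambda>v. real_of_ereal (f v) + (c - v \<bullet> a)) v :> D v + (0 - a)"
    proof (intro GDERIV_add GDERIV_diff D v GDERIV_const)
      show "GDERIV (\<lambda>v. v \<bullet> a) v :> a"
        unfolding gderiv_def by (auto intro!: derivative_eq_intros simp: inner_commute)
    qed
    then have "((\<lambda>v. real_of_ereal (f v) + (c - v \<bullet> a)) has_derivative (\<lambda>h. h \<bullet> (D v - a))) (at v)"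
      by (simp add: gderiv_def)
    then have "((\<lambda>v. real_of_ereal (f v + ereal (c - v \<bullet> a))) has_derivative (\<lambda>h. h \<bullet> (D v - a))) (at v)"
    \<comment> \<open>\<open>real_of_ereal\<close> is additive only at finite values, so the two
      functions are compared on the interior of the effective domain, which a finite affine term
      leaves unchanged.\<close>
    proof (rule has_derivative_transform_within_open[OF _ open_interior v])
      fix w assume "w \<in> interior ?V"
      then have "f w < \<infinity>" using interior_subset by blast
      then show "real_of_ereal (f w) + (c - w \<bullet> a) = real_of_ereal (f w + ereal (c - w \<bullet> a))"
        using nn[of w] by (cases "f w") auto
    qed
    then show ?thesis by (simp add: gderiv_def)
  qed
  then show ?thesis
    unfolding C1_ereal_def dom using cont by (intro exI[of _ "\<lambda>v. D v - a"]) (auto intro!: continuous_intros)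
qed

lemma strictly_convex_ereal_shift:
  fixes h :: "'a::euclidean_space \<Rightarrow> real"
  assumes "strictly_convex_ereal (\<lambda>\<xi>. ereal (h \<xi>))"
  shows "strictly_convex_ereal (\<lambda>\<xi>. ereal (h (\<xi> + a) - h a))"
  unfolding strictly_convex_ereal_def
proof (intro allI impI)
  fix x y :: 'a and t :: real
  assume A: "x \<noteq> y \<and> ereal (h (x + a) - h a) < \<infinity> \<and> ereal (h (y + a) - h a) < \<infinity> \<and> 0 < t \<and> t < 1"
  then have "ereal (h ((1 - t) *\<^sub>R (x + a) + t *\<^sub>R (y + a)))
      < ereal (1 - t) * ereal (h (x + a)) + ereal t * ereal (h (y + a))"
    using assms unfolding strictly_convex_ereal_def by simp
  moreover have "(1 - t) *\<^sub>R (x + a) + t *\<^sub>R (y + a) = (1 - t) *\<^sub>R x + t *\<^sub>R y + a"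
    by (simp add: algebra_simps)
  ultimately show "ereal (h ((1 - t) *\<^sub>R x + t *\<^sub>R y + a) - h a)
      < ereal (1 - t) * ereal (h (x + a) - h a) + ereal t * ereal (h (y + a) - h a)"
    by (simp add: algebra_simps)
qed

lemma C1_ereal_shift:
  fixes h :: "'a::euclidean_space \<Rightarrow> real"
  assumes "C1_ereal (\<lambda>\<xi>. ereal (h \<xi>))"
  shows "C1_ereal (\<lambda>\<xi>. ereal (h (\<xi> + a) - h a))"
proof -
  obtain D where D: "\<And>v. GDERIV h v :> D v" and cont: "continuous_on UNIV D"
    using assms unfolding C1_ereal_def by auto
  have "GDERIV (\<lambda>\<xi>. h (\<xi> + a) - h a) v :> D (v + a)" for v
  proof -
    have "((\<lambda>\<xi>. h (\<xi> + a)) has_derivative (\<lambda>x. x \<bullet> D (v + a))) (at v)"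
      using D[of "v + a"] unfolding gderiv_def
      by (rule has_derivative_compose[of "\<lambda>\<xi>. \<xi> + a" "\<lambda>x. x", rotated]) (auto intro!: derivative_eq_intros)
    then show ?thesis unfolding gderiv_def by (auto intro!: derivative_eq_intros)
  qed
  moreover have "continuous_on UNIV (\<lambda>v. D (v + a))"
    by (rule continuous_on_compose2[OF cont]) (auto intro!: continuous_intros)
  ultimately show ?thesis unfolding C1_ereal_def by (intro exI[of _ "\<lambda>v. D (v + a)"]) auto
qed

text \<open>
  Reflection of the Hamiltonian about \<open>dS/2\<close> is the only input needed from reversibility, and
  orthogonality of \<open>W\<close> and \<open>dS\<close> the only one from invariance.
\<close>

lemma pre_GENERIC_of_reflection_symmetry:
  fixes \<H>2 :: "'a::euclidean_space \<Rightarrow> 'a \<Rightarrow> real"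
  assumes dual: "hamiltonian_lagrangian \<H>2 \<L>2"
    and reflection: "\<And>z \<xi>. \<H>2 z (grad S z - \<xi>) = \<H>2 z \<xi>"
    and orth: "\<And>z. W z \<bullet> grad S z = 0"
    and zero: "\<And>z. \<L>2 z (F z - W z) = 0"
    and \<Psi>s: "\<And>z \<xi>. \<Psi>s z \<xi> = ereal (\<H>2 z (\<xi> + (1/2) *\<^sub>R grad S z) - \<H>2 z ((1/2) *\<^sub>R grad S z))"
    and \<Psi>: "\<And>z v. \<Psi> z v = legendre (\<Psi>s z) v"
  shows "pre_GENERIC_without_regularity F S W \<Psi> \<Psi>s \<and>
    (regular (\<lambda>z \<xi>. ereal (\<H>2 z \<xi>)) \<and> regular \<L>2 \<longrightarrow> pre_GENERIC F S W \<Psi> \<Psi>s)"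
proof -
  define a where "a z = (1/2) *\<^sub>R grad S z" for z
  have \<Psi>s_eq: "\<Psi>s z = (\<lambda>\<xi>. ereal (\<H>2 z (\<xi> + a z) - \<H>2 z (a z)))" for z
    by (simp add: \<Psi>s a_def fun_eq_iff)
  have L: "\<L>2 z v = legendre (\<lambda>\<xi>. ereal (\<H>2 z \<xi>)) v" "ereal (\<H>2 z \<xi>) = legendre (\<L>2 z) \<xi>"
    "0 \<le> \<L>2 z v" "convex_ereal (\<L>2 z)" "convex_on UNIV (\<H>2 z)" "\<H>2 z 0 = 0" for z v \<xi>
    using dual unfolding hamiltonian_lagrangian_def by blast+
  have \<Psi>_eq: "\<Psi> z = (\<lambda>v. \<L>2 z v + ereal (\<H>2 z (a z) - v \<bullet> a z))" for z
    unfolding \<Psi> \<Psi>s_eq legendre_shift L(1)[symmetric] by (rule refl)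
  have dS: "grad S z = a z + a z" for z
    unfolding a_def by (simp flip: scaleR_add_left)
  have even: "\<H>2 z (a z - \<xi>) = \<H>2 z (\<xi> + a z)" for z \<xi>
    using reflection[of z "\<xi> + a z"] unfolding dS by (simp add: algebra_simps)
  \<comment> \<open>\<open>a z\<close> is the midpoint of \<open>a z - \<xi>\<close> and
    \<open>\<xi> + a z\<close>, where \<open>\<H>2 z\<close> takes equal values by reflection;
    convexity makes it a minimiser.\<close>
  have \<Psi>s_nonneg: "0 \<le> \<Psi>s z \<xi>" for z \<xi>
  proof -
    have "\<H>2 z ((1 - 1/2) *\<^sub>R (a z - \<xi>) + (1/2) *\<^sub>R (\<xi> + a z))
        \<le> (1 - 1/2) * \<H>2 z (a z - \<xi>) + (1/2) * \<H>2 z (\<xi> + a z)"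
      by (rule convex_onD[OF L(5)]) auto
    moreover have "(1 - 1/2) *\<^sub>R (a z - \<xi>) + (1/2) *\<^sub>R (\<xi> + a z) = a z"
      by (simp add: algebra_simps flip: scaleR_add_left)
    ultimately show ?thesis using even[of z \<xi>] by (simp add: \<Psi>s_eq)
  qed
  have \<Psi>s_0: "\<Psi>s z 0 = 0" for z by (simp add: \<Psi>s_eq)
  have \<Psi>_nonneg: "0 \<le> \<Psi> z v" for z v
    unfolding \<Psi> legendre_def using \<Psi>s_0 by (intro SUP_upper2[of 0]) auto
  have \<Psi>_0: "\<Psi> z 0 = 0" for z
  proof (rule antisym)
    show "\<Psi> z 0 \<le> 0" unfolding \<Psi> legendre_def
      using \<Psi>s_nonneg[of z] by (intro SUP_least) (auto simp: \<Psi>s_eq)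
  qed (rule \<Psi>_nonneg)
  \<comment> \<open>Biconjugation is inherited: \<open>\<H>2\<close> is the transform of
    \<open>\<L>2\<close>, and \<open>\<Psi>\<close> differs from \<open>\<L>2\<close> by an affine
    term.\<close>
  have conj: "\<Psi>s z \<xi> = legendre (\<Psi> z) \<xi>" for z \<xi>
    unfolding \<Psi>_eq legendre_add_affine[OF L(3)] L(2)[symmetric] by (simp add: \<Psi>s_eq)
  have convs: "convex_ereal (\<Psi>s z)" for z
    unfolding convex_ereal_def
  proof (intro allI impI)
    fix x y :: 'a and t :: real assume t: "0 < t \<and> t < 1"
    have "\<H>2 z ((1 - t) *\<^sub>R (x + a z) + t *\<^sub>R (y + a z))
        \<le> (1 - t) * \<H>2 z (x + a z) + t * \<H>2 z (y + a z)"
      by (rule convex_onD[OF L(5)]) (use t in auto)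
    moreover have "(1 - t) *\<^sub>R (x + a z) + t *\<^sub>R (y + a z) = (1 - t) *\<^sub>R x + t *\<^sub>R y + a z"
      by (simp add: algebra_simps)
    ultimately show "\<Psi>s z ((1 - t) *\<^sub>R x + t *\<^sub>R y) \<le> ereal (1 - t) * \<Psi>s z x + ereal t * \<Psi>s z y"
      by (simp add: \<Psi>s_eq algebra_simps)
  qed
  have conv: "convex_ereal (\<Psi> z)" for z
    unfolding \<Psi>_eq by (rule convex_ereal_add_affine[OF L(4) L(3)])
  have dual\<Psi>: "dual_potentials \<Psi> \<Psi>s"
    unfolding dual_potentials_def
    by (intro allI conjI) (fact \<Psi>_nonneg \<Psi>s_nonneg convs conv conj \<Psi> \<Psi>_0 \<Psi>s_0)+
  have syms: "symmetric \<Psi>s" unfolding symmetric_def by (simp add: \<Psi>s_eq even)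
  have sym: "symmetric \<Psi>" unfolding symmetric_def \<Psi> legendre_def
  proof (intro allI SUP_eq)
    fix z v \<xi>
    show "\<exists>\<eta>\<in>UNIV. ereal (- v \<bullet> \<xi>) - \<Psi>s z \<xi> \<le> ereal (v \<bullet> \<eta>) - \<Psi>s z \<eta>"
      using syms unfolding symmetric_def by (intro bexI[of _ "- \<xi>"]) auto
    show "\<exists>\<eta>\<in>UNIV. ereal (v \<bullet> \<xi>) - \<Psi>s z \<xi> \<le> ereal (- v \<bullet> \<eta>) - \<Psi>s z \<eta>"
      using syms unfolding symmetric_def by (intro bexI[of _ "- \<xi>"]) auto
  qed
  have gen: "generic_relations F S W \<Psi> \<Psi>s"
    unfolding generic_relations_def
  proof (intro conjI allI orth)
    fix z
    \<comment> \<open>At the zero-cost velocity only the affine part of \<open>\<Psi>\<close> is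
      left, and \<open>\<H>2 z 0 = 0\<close> turns \<open>\<Psi>s\<close> at \<open>- a z\<close>
      into \<open>- \<H>2 z (a z)\<close>. The sum is \<open>- (F z - W z) \<bullet> a z\<close>,
      which orthogonality reduces to minus the entropy term.\<close>
    have "\<Psi> z (F z - W z) = ereal (\<H>2 z (a z) - (F z - W z) \<bullet> a z)"
      unfolding \<Psi>_eq by (simp add: zero)
    moreover have "\<Psi>s z (- ((1/2) *\<^sub>R grad S z)) = ereal (- \<H>2 z (a z))"
      unfolding \<Psi>s_eq by (simp add: L(6) flip: a_def)
    moreover have "W z \<bullet> a z = 0" using orth[of z] by (simp add: a_def)
    ultimately show "\<Psi> z (F z - W z) + \<Psi>s z (- ((1/2) *\<^sub>R grad S z)) + ereal ((1/2) * (F z \<bullet> grad S z)) = 0"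
      by (simp add: inner_diff_left a_def)
  qed
  have "regular \<Psi> \<and> regular \<Psi>s" if "regular (\<lambda>z \<xi>. ereal (\<H>2 z \<xi>)) \<and> regular \<L>2"
    using that unfolding regular_def \<Psi>_eq \<Psi>s_eq
    using strictly_convex_ereal_add_affine[of "\<L>2 _", OF _ L(3)] C1_ereal_add_affine[of "\<L>2 _", OF _ L(3)]
      strictly_convex_ereal_shift[of "\<H>2 _"] C1_ereal_shift[of "\<H>2 _"] by simp
  then show ?thesis
    unfolding pre_GENERIC_without_regularity_def pre_GENERIC_def dissipation_potentials_def
    using dual\<Psi> sym syms gen by blast
qed

section \<open>Stationary and reversible semigroups\<close>

text \<open>The increments are little-o of h uniformly in the starting time, so telescoping over N
  equal steps bounds the total change by any e. It acts as a one-sided derivative test, since a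
  generator controls right difference quotients.\<close>

lemma eq_of_small_increments:
  fixes u :: "real \<Rightarrow> real"
  assumes T: "0 \<le> T"
    and small: "\<And>e. e > 0 \<Longrightarrow> \<exists>d>0. \<forall>h s. 0 < h \<and> h < d \<and> 0 \<le> s \<and> s + h \<le> T \<longrightarrow> \<bar>u (s + h) - u s\<bar> \<le> e * h"
  shows "u T = u 0"
proof (cases "T = 0")
  case False
  with T have T: "T > 0" by simp
  have "\<bar>u T - u 0\<bar> \<le> e" if e: "e > 0" for e
  proof -
    obtain d where d: "d > 0"
      "\<And>h s. 0 < h \<Longrightarrow> h < d \<Longrightarrow> 0 \<le> s \<Longrightarrow> s + h \<le> T \<Longrightarrow> \<bar>u (s + h) - u s\<bar> \<le> e / T * h"
      using small[of "e / T"] e T by (auto simp: divide_pos_pos)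
    obtain N :: nat where N: "T / d < real N" using reals_Archimedean2 by blast
    have "0 < T / d" using T d(1) by simp
    with N have N0: "0 < real N" by linarith
    define h where "h = T / real N"
    have h: "0 < h" "h < d" "real N * h = T"
      using N N0 T d(1) by (auto simp: h_def field_simps)
    have "\<bar>u T - u 0\<bar> = \<bar>\<Sum>i<N. u (real (Suc i) * h) - u (real i * h)\<bar>"
      using sum_lessThan_telescope[of "\<lambda>i. u (real i * h)" N] h(3) by simp
    also have "\<dots> \<le> (\<Sum>i<N. \<bar>u (real (Suc i) * h) - u (real i * h)\<bar>)" by (rule sum_abs)
    also have "\<dots> \<le> (\<Sum>i<N. e / T * h)"
    proof (rule sum_mono)
      fix i assume "i \<in> {..<N}"
      then have "real (Suc i) * h \<le> real N * h" using h(1) by (intro mult_right_mono) auto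
      then have "\<bar>u (real i * h + h) - u (real i * h)\<bar> \<le> e / T * h"
        using h by (intro d(2)) (auto simp: algebra_simps)
      then show "\<bar>u (real (Suc i) * h) - u (real i * h)\<bar> \<le> e / T * h"
        by (simp add: algebra_simps)
    qed
    also have "\<dots> = e" using h(3) T by (simp add: field_simps)
    finally show ?thesis .
  qed
  then have "\<bar>u T - u 0\<bar> \<le> 0" using field_le_epsilon[of "\<bar>u T - u 0\<bar>" 0] by simp
  then show ?thesis by simp
qed simp

text \<open>Only the oscillation over one mesh enters, cell by cell, so the error is uniform in any
  parameter on which \<phi> depends. This lets time averages of a semigroup be approximated inside a
  space closed under uniform limits.\<close>

lemma riemann_sum_error:
  fixes \<phi> :: "real \<Rightarrow> real"
  assumes cont: "continuous_on {0..} \<phi>" and k: "0 < k"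
    and osc: "\<And>s s'. 0 \<le> s \<Longrightarrow> 0 \<le> s' \<Longrightarrow> \<bar>s - s'\<bar> \<le> k \<Longrightarrow> \<bar>\<phi> s - \<phi> s'\<bar> \<le> e"
  shows "\<bar>integral {0..real n * k} \<phi> - k * (\<Sum>i<n. \<phi> (real i * k))\<bar> \<le> e * (real n * k)"
proof (induction n)
  case (Suc n)
  let ?a = "real n * k" and ?b = "real (Suc n) * k"
  have a: "0 \<le> ?a" "?b = ?a + k" using k by (auto simp: algebra_simps)
  have int: "\<phi> integrable_on {c..d}" if "0 \<le> c" for c d
    using that by (intro integrable_continuous_real continuous_on_subset[OF cont]) auto
  have "integral {0..?b} \<phi> = integral {0..?a} \<phi> + integral {?a..?b} \<phi>"
    using Henstock_Kurzweil_Integration.integral_combine[of 0 ?a ?b \<phi>] int[of 0 ?b] a k by auto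
  moreover have "\<bar>integral {?a..?b} \<phi> - k * \<phi> ?a\<bar> \<le> e * k"
  proof -
    have "integral {?a..?b} \<phi> - k * \<phi> ?a = integral {?a..?b} (\<lambda>s. \<phi> s - \<phi> ?a)"
      using a k int[of ?a ?b] by (subst integral_diff) (auto simp: content_real)
    moreover have "norm (integral {?a..?b} (\<lambda>s. \<phi> s - \<phi> ?a)) \<le> e * (?b - ?a)"
      using a k osc[OF order_trans[OF a(1)] a(1)] by (intro integral_bound continuous_intros continuous_on_subset[OF cont]) auto
    ultimately show ?thesis using a by simp
  qed
  ultimately show ?case using Suc.IH a by (simp add: algebra_simps)
qed simp

section \<open>Bounded Borel functions and their integrals\<close>

lemma bounded_borelD:
  assumes "f \<in> bounded_borel"
  shows "f \<in> borel_measurable borel" "\<exists>M. \<forall>x. \<bar>f x\<bar> \<le> M"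
  using assms unfolding bounded_borel_def bounded_iff by auto

lemma bounded_borelI:
  assumes "f \<in> borel_measurable borel" "\<And>x. \<bar>f x\<bar> \<le> M"
  shows "f \<in> bounded_borel"
  using assms unfolding bounded_borel_def bounded_iff by auto

lemma integrable_bounded_borel:
  assumes "prob_space \<pi>" "sets \<pi> = sets borel" "f \<in> bounded_borel"
  shows "integrable \<pi> f"
proof -
  interpret prob_space \<pi> by fact
  obtain M where "\<forall>x. \<bar>f x\<bar> \<le> M" using bounded_borelD[OF assms(3)] by auto
  then show ?thesis
    using bounded_borelD(1)[OF assms(3)] measurable_cong_sets[OF assms(2) HOL.refl]
    by (intro integrable_const_bound[where B=M]) auto
qed

lemma bounded_borel_mult:
  assumes "f \<in> bounded_borel" "g \<in> bounded_borel"
  shows "(\<lambda>x. f x * g x) \<in> bounded_borel"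
proof -
  obtain M N where "\<And>x. \<bar>f x\<bar> \<le> M" "\<And>x. \<bar>g x\<bar> \<le> N" using bounded_borelD assms by metis
  then have "\<bar>f x * g x\<bar> \<le> M * N" for x
    unfolding abs_mult by (intro mult_mono) (auto intro: order_trans[OF abs_ge_zero])
  then show ?thesis using bounded_borelD(1) assms by (intro bounded_borelI[where M="M * N"] borel_measurable_times) auto
qed

lemma integral_close:
  assumes \<pi>: "prob_space \<pi>" "sets \<pi> = sets borel" "f \<in> bounded_borel" "g \<in> bounded_borel"
    and le: "\<And>x. \<bar>f x - g x\<bar> \<le> e"
  shows "\<bar>(\<integral>x. f x \<partial>\<pi>) - (\<integral>x. g x \<partial>\<pi>)\<bar> \<le> e"
proof -
  interpret prob_space \<pi> by fact
  have i: "integrable \<pi> f" "integrable \<pi> g" using \<pi> integrable_bounded_borel by auto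
  have "\<bar>(\<integral>x. f x \<partial>\<pi>) - (\<integral>x. g x \<partial>\<pi>)\<bar> = \<bar>\<integral>y. f y - g y \<partial>\<pi>\<bar>" using i by simp
  also have "\<dots> \<le> (\<integral>y. \<bar>f y - g y\<bar> \<partial>\<pi>)" by (rule integral_abs_bound)
  also have "\<dots> \<le> (\<integral>y. e \<partial>\<pi>)" using i le by (intro integral_mono) auto
  finally show ?thesis by (simp add: prob_space)
qed

section \<open>Semigroups with a generator on a domain space\<close>

locale generated_semigroup =
  fixes L :: "('a::euclidean_space \<Rightarrow> real) set" and A P
  assumes gen: "generates L A P"
begin

lemma dom: "domain_space L" and trans: "transition_function P"
  and sc: "strongly_continuous L P" and A_def: "A = generator L P"
  using gen unfolding generates_def by auto

lemma L_bounded_borel: "f \<in> L \<Longrightarrow> f \<in> bounded_borel"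
  using dom unfolding domain_space_def by auto

lemma L_comb: "f \<in> L \<Longrightarrow> g \<in> L \<Longrightarrow> (\<lambda>x. a * f x + b * g x) \<in> L"
  using dom unfolding domain_space_def by blast

lemma L_scale: "f \<in> L \<Longrightarrow> (\<lambda>x. a * f x) \<in> L"
  using L_comb[of f f a 0] by simp

lemma L_sum: "finite I \<Longrightarrow> (\<And>i. i \<in> I \<Longrightarrow> f i \<in> L) \<Longrightarrow> (\<lambda>x. \<Sum>i\<in>I. f i x) \<in> L"
proof (induction I rule: finite_induct)
  case empty then show ?case using dom unfolding domain_space_def by simp
next
  case (insert i I) then show ?case using L_comb[of "f i" _ 1 1] by simp
qed

lemma L_closed: "(\<And>k. fs k \<in> L) \<Longrightarrow> uniform_limit UNIV fs f sequentially \<Longrightarrow> f \<in> L"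
  using dom unfolding domain_space_def by blast

lemma semigroup_L: "t \<ge> 0 \<Longrightarrow> f \<in> L \<Longrightarrow> semigroup P t f \<in> L"
  using sc unfolding strongly_continuous_def by auto

lemma kernel: "t \<ge> 0 \<Longrightarrow> P t \<in> borel \<rightarrow>\<^sub>M prob_algebra borel"
  using trans unfolding transition_function_def by auto

lemma prob_kernel: "t \<ge> 0 \<Longrightarrow> prob_space (P t x)" and sets_kernel: "t \<ge> 0 \<Longrightarrow> sets (P t x) = sets borel"
  using measurable_space[OF kernel, of t x] by (auto simp: space_prob_algebra)

lemma integrable_kernel:
  assumes "t \<ge> 0" "f \<in> bounded_borel" shows "integrable (P t x) f"
proof -
  interpret prob_space "P t x" by (rule prob_kernel[OF assms(1)])
  obtain M where "\<forall>x. \<bar>f x\<bar> \<le> M" using bounded_borelD[OF assms(2)] by auto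
  then show ?thesis
    using bounded_borelD(1)[OF assms(2)] measurable_cong_sets[OF sets_kernel[OF assms(1)] HOL.refl]
    by (intro integrable_const_bound[where B=M]) auto
qed

lemma semigroup_comb:
  assumes "t \<ge> 0" "f \<in> bounded_borel" "g \<in> bounded_borel"
  shows "semigroup P t (\<lambda>x. a * f x + b * g x) x = a * semigroup P t f x + b * semigroup P t g x"
  unfolding semigroup_def using integrable_kernel[OF assms(1)] assms by simp

lemma semigroup_scaled_sum:
  assumes "t \<ge> 0" "\<And>i. i \<in> I \<Longrightarrow> f i \<in> bounded_borel"
  shows "semigroup P t (\<lambda>x. a * (\<Sum>i\<in>I. f i x)) x = a * (\<Sum>i\<in>I. semigroup P t (f i) x)"
  unfolding semigroup_def using integrable_kernel[OF assms(1)] assms by simp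

lemma semigroup_contraction:
  assumes t: "t \<ge> 0" "f \<in> bounded_borel" "g \<in> bounded_borel" and le: "\<And>y. \<bar>f y - g y\<bar> \<le> e"
  shows "\<bar>semigroup P t f x - semigroup P t g x\<bar> \<le> e"
proof -
  interpret prob_space "P t x" by (rule prob_kernel[OF t(1)])
  have i: "integrable (P t x) f" "integrable (P t x) g" using t integrable_kernel by auto
  have "\<bar>semigroup P t f x - semigroup P t g x\<bar> = \<bar>\<integral>y. f y - g y \<partial>P t x\<bar>"
    using i by (simp add: semigroup_def)
  also have "\<dots> \<le> (\<integral>y. \<bar>f y - g y\<bar> \<partial>P t x)" by (rule integral_abs_bound)
  also have "\<dots> \<le> (\<integral>y. e \<partial>P t x)" using i le by (intro integral_mono) auto
  finally show ?thesis by (simp add: prob_space)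
qed

lemma semigroup_bound:
  assumes "t \<ge> 0" "f \<in> bounded_borel" "\<And>y. \<bar>f y\<bar> \<le> M"
  shows "\<bar>semigroup P t f x\<bar> \<le> M"
  using semigroup_contraction[of t f "\<lambda>x. 0" M x] assms
  by (auto simp: semigroup_def bounded_borel_def)

lemma semigroup_0: "f \<in> bounded_borel \<Longrightarrow> semigroup P 0 f = f"
  using trans unfolding transition_function_def semigroup_def
  by (auto simp: integral_return bounded_borel_def)

lemma semigroup_add:
  assumes "s \<ge> 0" "t \<ge> 0" "f \<in> bounded_borel"
  shows "semigroup P (s + t) f = semigroup P s (semigroup P t f)"
proof
  fix x
  interpret prob_space "P s x" by (rule prob_kernel[OF assms(1)])
  obtain M where M: "\<And>x. \<bar>f x\<bar> \<le> M" using bounded_borelD[OF assms(3)] by auto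
  have "P (s + t) x = P s x \<bind> P t" using trans assms unfolding transition_function_def by blast
  moreover have "(\<integral>y. f y \<partial>(P s x \<bind> P t)) = (\<integral>y. \<integral>z. f z \<partial>P t y \<partial>P s x)"
  proof (rule integral_bind[where K=borel and B=M and B'=1])
    show "P t \<in> P s x \<rightarrow>\<^sub>M subprob_algebra borel"
      using measurable_prob_algebraD[OF kernel[OF assms(2)]]
        measurable_cong_sets[OF sets_kernel[OF assms(1)] HOL.refl] by blast
    show "f \<in> borel_measurable borel" using bounded_borelD[OF assms(3)] by simp
    show "AE y in P s x. emeasure (P t y) (space (P t y)) \<le> ennreal 1"
      using prob_space.emeasure_space_1[OF prob_kernel[OF assms(2)]] by simp
    show "finite_measure (P s x)" by unfold_locales
  qed (auto simp: M)
  ultimately show "semigroup P (s + t) f x = semigroup P s (semigroup P t f) x"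
    by (simp add: semigroup_def)
qed

text \<open>Strong continuity is given at time 0 only. The semigroup property and contractivity
  carry that modulus to every time, uniformly in the state.\<close>

lemma time_modulus:
  assumes f: "f \<in> L" and e: "e > 0"
  obtains d where "d > 0"
    "\<And>s s' x. 0 \<le> s \<Longrightarrow> 0 \<le> s' \<Longrightarrow> \<bar>s - s'\<bar> < d \<Longrightarrow> \<bar>semigroup P s f x - semigroup P s' f x\<bar> \<le> e"
proof -
  have "uniform_limit UNIV (\<lambda>t. semigroup P t f) f (at_right 0)"
    using sc f unfolding strongly_continuous_def by auto
  from uniform_limitD[OF this e] obtain d where d: "d > 0"
    "\<And>h x. 0 < h \<Longrightarrow> h < d \<Longrightarrow> \<bar>semigroup P h f x - f x\<bar> < e"
    unfolding eventually_at_right_field by (auto simp: dist_real_def)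
  have *: "\<bar>semigroup P s' f x - semigroup P s f x\<bar> \<le> e" if "0 \<le> s" "s < s'" "s' - s < d" for s s' x
  proof -
    have "semigroup P s' f = semigroup P s (semigroup P (s' - s) f)"
      using semigroup_add[of s "s' - s" f] that L_bounded_borel f by simp
    moreover have "\<bar>semigroup P s (semigroup P (s' - s) f) x - semigroup P s f x\<bar> \<le> e"
      using that d(2)[of "s' - s"] f
      by (intro semigroup_contraction L_bounded_borel semigroup_L) (auto intro: less_imp_le)
    ultimately show ?thesis by simp
  qed
  show thesis
  proof (rule that[OF d(1)])
    fix s s' :: real and x assume "0 \<le> s" "0 \<le> s'" "\<bar>s - s'\<bar> < d"
    then show "\<bar>semigroup P s f x - semigroup P s' f x\<bar> \<le> e"
      using *[of s s' x] *[of s' s x] e by (cases s s' rule: linorder_cases) auto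
  qed
qed

text \<open>The error at time s is \<open>semigroup P s\<close> applied to the error at time 0;
  contractivity makes the bound uniform in s and in the state. The form \<open>e * h\<close> is the
  one consumed by \<open>eq_of_small_increments\<close>.\<close>

lemma generatorD:
  assumes "(f, g) \<in> A"
  shows "f \<in> L" "g \<in> L"
    "e > 0 \<Longrightarrow> \<exists>d>0. \<forall>h s x. 0 < h \<and> h < d \<and> 0 \<le> s \<longrightarrow>
      \<bar>semigroup P (s + h) f x - semigroup P s f x - h * semigroup P s g x\<bar> \<le> e * h"
proof -
  show L: "f \<in> L" "g \<in> L" using assms unfolding A_def generator_def by auto
  have bb: "f \<in> bounded_borel" "g \<in> bounded_borel" using L L_bounded_borel by auto
  have lim: "uniform_limit UNIV (\<lambda>t x. (semigroup P t f x - f x) / t) g (at_right 0)"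
    using assms unfolding A_def generator_def by auto
  assume e: "e > 0"
  from uniform_limitD[OF lim e] obtain d where d: "d > 0"
    "\<And>h x. 0 < h \<Longrightarrow> h < d \<Longrightarrow> \<bar>(semigroup P h f x - f x) / h - g x\<bar> < e"
    unfolding eventually_at_right_field by (auto simp: dist_real_def)
  have "\<bar>semigroup P (s + h) f x - semigroup P s f x - h * semigroup P s g x\<bar> \<le> e * h"
    if h: "0 < h" "h < d" "0 \<le> s" for h s x
  proof -
    have bbh: "semigroup P h f \<in> bounded_borel" using h L by (intro L_bounded_borel semigroup_L) auto
    have comb: "(\<lambda>x. 1 * f x + h * g x) \<in> bounded_borel" using L by (intro L_bounded_borel L_comb)
    have "\<bar>semigroup P h f y - (1 * f y + h * g y)\<bar> \<le> e * h" for y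
    proof -
      have "\<bar>(semigroup P h f y - f y) / h - g y\<bar> * h \<le> e * h"
        using d(2)[OF h(1,2), of y] h(1) by (intro mult_right_mono) auto
      moreover have "\<bar>(semigroup P h f y - f y) / h - g y\<bar> * h = \<bar>semigroup P h f y - (1 * f y + h * g y)\<bar>"
        using h(1) by (simp add: abs_if field_simps)
      ultimately show ?thesis by simp
    qed
    from semigroup_contraction[OF h(3) bbh comb this, of x]
    show ?thesis
      using semigroup_add[of s h f] semigroup_comb[OF h(3) bb, of 1 h x] h bb(1)
      by (simp add: algebra_simps)
  qed
  then show "\<exists>d>0. \<forall>h s x. 0 < h \<and> h < d \<and> 0 \<le> s \<longrightarrow>
      \<bar>semigroup P (s + h) f x - semigroup P s f x - h * semigroup P s g x\<bar> \<le> e * h"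
    using d(1) by blast
qed

text \<open>Semigroup operators commute, so the domain is preserved and the generator passes through
  \<open>semigroup P s\<close>. Invariance and reversibility can thus be applied at every time along
  the evolution.\<close>

lemma semigroup_generator:
  assumes fg: "(f, g) \<in> A" and s: "0 \<le> s"
  shows "(semigroup P s f, semigroup P s g) \<in> A"
proof -
  note L = generatorD(1,2)[OF fg]
  have "uniform_limit UNIV (\<lambda>t x. (semigroup P t (semigroup P s f) x - semigroup P s f x) / t)
      (semigroup P s g) (at_right 0)"
  proof (rule uniform_limitI)
    fix e :: real assume e: "e > 0"
    obtain d where d: "d > 0" "\<And>h x. 0 < h \<Longrightarrow> h < d \<Longrightarrow>
      \<bar>semigroup P (s + h) f x - semigroup P s f x - h * semigroup P s g x\<bar> \<le> e / 2 * h"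
      using generatorD(3)[OF fg, of "e / 2"] e s by auto
    have "dist ((semigroup P h (semigroup P s f) x - semigroup P s f x) / h) (semigroup P s g x) < e"
      if h: "0 < h" "h < d" for h x
    proof -
      have "semigroup P h (semigroup P s f) = semigroup P (s + h) f"
        using semigroup_add[of h s f] s h L L_bounded_borel by (simp add: add.commute)
      then have "\<bar>semigroup P h (semigroup P s f) x - semigroup P s f x - h * semigroup P s g x\<bar> / h
          \<le> e / 2"
        using d(2)[OF h, of x] h(1) by (simp add: field_simps)
      moreover have "\<bar>semigroup P h (semigroup P s f) x - semigroup P s f x - h * semigroup P s g x\<bar> / h
          = dist ((semigroup P h (semigroup P s f) x - semigroup P s f x) / h) (semigroup P s g x)"
        using h(1) by (simp add: dist_real_def abs_if field_simps)
      ultimately show ?thesis using e by linarith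
    qed
    then show "\<forall>\<^sub>F h in at_right 0. \<forall>x\<in>UNIV.
        dist ((semigroup P h (semigroup P s f) x - semigroup P s f x) / h) (semigroup P s g x) < e"
      unfolding eventually_at_right_field using d(1) by auto
  qed
  then show ?thesis using L s semigroup_L unfolding A_def generator_def by auto
qed


text \<open>The average \<open>F 0\<close> of \<open>semigroup P s f\<close> over
  \<open>{0..h}\<close> lies in the domain with generator value
  \<open>(semigroup P h f - f) / h\<close>, and strong continuity keeps it close to f. It is treated
  as a uniform limit of Riemann sums, so that membership in \<open>L\<close> and commutation with
  the semigroup are inherited from finite sums.\<close>

lemma domain_dense:
  assumes f: "f \<in> L" and e: "e > 0"
  obtains f' g' where "(f', g') \<in> A" "\<And>x. \<bar>f' x - f x\<bar> \<le> e"
proof -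
  have bb: "f \<in> bounded_borel" using f by (rule L_bounded_borel)
  have cont: "continuous_on {0..} (\<lambda>s. semigroup P s f x)" for x
    unfolding continuous_on_iff
  proof (intro ballI allI impI)
    fix s e :: real assume s: "s \<in> {0..}" and e: "0 < e"
    obtain d where d: "d > 0" "\<And>s s' x. 0 \<le> s \<Longrightarrow> 0 \<le> s' \<Longrightarrow> \<bar>s - s'\<bar> < d \<Longrightarrow>
        \<bar>semigroup P s f x - semigroup P s' f x\<bar> \<le> e / 2"
      using time_modulus[OF f, of "e / 2"] e by auto
    show "\<exists>d>0. \<forall>s'\<in>{0..}. dist s' s < d \<longrightarrow> dist (semigroup P s' f x) (semigroup P s f x) < e"
      using d(1) d(2)[of _ s x] s e by (intro exI[of _ d]) (fastforce simp: dist_real_def)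
  qed
  have int: "(\<lambda>s. semigroup P s f x) integrable_on {a..b}" if "0 \<le> a" for a b x
    using that by (intro integrable_continuous_real continuous_on_subset[OF cont]) auto
  obtain h0 where h0: "h0 > 0" "\<And>s s' x. 0 \<le> s \<Longrightarrow> 0 \<le> s' \<Longrightarrow> \<bar>s - s'\<bar> < h0 \<Longrightarrow>
      \<bar>semigroup P s f x - semigroup P s' f x\<bar> \<le> e"
    using time_modulus[OF f e] by auto
  \<comment> \<open>Half of h0: the modulus holds for times strictly closer than h0, while the
    average runs over the closed interval \<open>{0..h}\<close>.\<close>
  define h where "h = h0 / 2"
  have h: "h > 0" "h < h0" using h0(1) by (auto simp: h_def)
  define F where "F c x = integral {0..h} (\<lambda>s. semigroup P (c + s) f x) / h" for c x
  define R where "R c N x = (1 / real (Suc N)) * (\<Sum>i<Suc N. semigroup P (c + real i * (h / real (Suc N))) f x)" for c N x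
  have R: "\<exists>N0. \<forall>N\<ge>N0. \<forall>c x. 0 \<le> c \<longrightarrow> \<bar>R c N x - F c x\<bar> \<le> \<epsilon>" if \<epsilon>: "\<epsilon> > 0" for \<epsilon>
  proof -
    obtain d where d: "d > 0" "\<And>s s' x. 0 \<le> s \<Longrightarrow> 0 \<le> s' \<Longrightarrow> \<bar>s - s'\<bar> < d \<Longrightarrow>
        \<bar>semigroup P s f x - semigroup P s' f x\<bar> \<le> \<epsilon>"
      using time_modulus[OF f \<epsilon>] by auto
    obtain N0 :: nat where N0: "h / d < real N0" using reals_Archimedean2 by blast
    have "\<bar>R c N x - F c x\<bar> \<le> \<epsilon>" if N: "N \<ge> N0" and c: "0 \<le> c" for N c x
    proof -
      define k where "k = h / real (Suc N)"
      have "h / d < real (Suc N)" using N N0 by simp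
      then have k: "0 < k" "k < d" "real (Suc N) * k = h"
        using h d(1) by (auto simp: k_def field_simps)
      let ?\<phi> = "\<lambda>s. semigroup P (c + s) f x"
      have "\<bar>integral {0..real (Suc N) * k} ?\<phi> - k * (\<Sum>i<Suc N. ?\<phi> (real i * k))\<bar> \<le> \<epsilon> * (real (Suc N) * k)"
      proof (rule riemann_sum_error)
        show "continuous_on {0..} ?\<phi>"
          using c by (intro continuous_on_compose2[OF cont]) (auto intro!: continuous_intros)
      qed (use k d c in auto)
      then have "\<bar>k * (\<Sum>i<Suc N. ?\<phi> (real i * k)) - integral {0..h} ?\<phi>\<bar> / h \<le> \<epsilon>"
        unfolding k(3) using h by (simp add: field_simps abs_minus_commute)
      moreover have "R c N x = k * (\<Sum>i<Suc N. ?\<phi> (real i * k)) / h"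
        unfolding R_def k_def using h by simp
      ultimately show ?thesis unfolding F_def using h
        by (simp flip: diff_divide_distrib)
    qed
    then show ?thesis by blast
  qed
  have R_L: "R c N \<in> L" if "0 \<le> c" for c N
    unfolding R_def using that h f
    by (intro L_scale L_sum semigroup_L) auto
  have F_L: "F c \<in> L" if c: "0 \<le> c" for c
  proof (rule L_closed)
    show "uniform_limit UNIV (R c) (F c) sequentially"
    proof (rule uniform_limitI)
      fix \<epsilon> :: real assume \<epsilon>: "\<epsilon> > 0"
      then obtain N0 where "\<And>N x. N \<ge> N0 \<Longrightarrow> \<bar>R c N x - F c x\<bar> \<le> \<epsilon> / 2"
        using R[of "\<epsilon> / 2"] c by auto
      from this have "dist (R c N x) (F c x) < \<epsilon>" if "N \<ge> N0" for N x
        using order.strict_trans1[of "\<bar>R c N x - F c x\<bar>" "\<epsilon> / 2" \<epsilon>] that \<epsilon>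
        unfolding dist_real_def by simp
      then show "\<forall>\<^sub>F N in sequentially. \<forall>x\<in>UNIV. dist (R c N x) (F c x) < \<epsilon>"
        unfolding eventually_sequentially by blast
    qed
  qed (rule R_L[OF c])
  have shift: "semigroup P k (F 0) x = F k x" if k: "0 \<le> k" for k x
  proof -
    have "\<bar>semigroup P k (F 0) x - F k x\<bar> \<le> 0 + \<epsilon>" if \<epsilon>: "\<epsilon> > 0" for \<epsilon>
    proof -
      obtain N where N: "\<And>c x. 0 \<le> c \<Longrightarrow> \<bar>R c N x - F c x\<bar> \<le> \<epsilon> / 2"
        using R[of "\<epsilon> / 2"] \<epsilon> by auto
      have "\<bar>semigroup P k (R 0 N) x - semigroup P k (F 0) x\<bar> \<le> \<epsilon> / 2"
        using k N by (intro semigroup_contraction L_bounded_borel R_L F_L) auto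
      moreover have "semigroup P k (R 0 N) x = R k N x"
      proof -
        have "semigroup P k (R 0 N) x = (1 / real (Suc N)) *
            (\<Sum>i<Suc N. semigroup P k (semigroup P (0 + real i * (h / real (Suc N))) f) x)"
          unfolding R_def using k h f
          by (intro semigroup_scaled_sum L_bounded_borel semigroup_L) auto
        also have "\<dots> = R k N x"
          unfolding R_def using semigroup_add[OF k _ bb] h by simp
        finally show ?thesis .
      qed
      moreover have "\<bar>R k N x - F k x\<bar> \<le> \<epsilon> / 2" using N k by simp
      ultimately show ?thesis by linarith
    qed
    then have "\<bar>semigroup P k (F 0) x - F k x\<bar> \<le> 0" by (rule field_le_epsilon)
    then show ?thesis by simp
  qed
  \<comment> \<open>The difference of the averages started at k and at 0 collapses to integrals over
    the end pieces \<open>{h..h + k}\<close> and \<open>{0..k}\<close>, whence this generator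
    value.\<close>
  define g where "g x = (1 / h) * semigroup P h f x + (- 1 / h) * f x" for x
  have g_L: "g \<in> L" unfolding g_def using h f by (intro L_comb semigroup_L) auto
  have "uniform_limit UNIV (\<lambda>t x. (semigroup P t (F 0) x - F 0 x) / t) g (at_right 0)"
  proof (rule uniform_limitI)
    fix \<epsilon> :: real assume \<epsilon>: "\<epsilon> > 0"
    \<comment> \<open>Each of the two end pieces contributes an error
      \<open>\<epsilon>' * k\<close>; after division by \<open>h * k\<close> they add up to
      \<open>\<epsilon> / 2\<close>.\<close>
    define \<epsilon>' where "\<epsilon>' = \<epsilon> * h / 4"
    have \<epsilon>': "\<epsilon>' > 0" using \<epsilon> h by (simp add: \<epsilon>'_def)
    obtain d where d: "d > 0" "\<And>s s' x. 0 \<le> s \<Longrightarrow> 0 \<le> s' \<Longrightarrow> \<bar>s - s'\<bar> < d \<Longrightarrow>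
        \<bar>semigroup P s f x - semigroup P s' f x\<bar> \<le> \<epsilon>'"
      using time_modulus[OF f \<epsilon>'] by auto
    have "dist ((semigroup P k (F 0) x - F 0 x) / k) (g x) < \<epsilon>" if k: "0 < k" "k < d" for k x
    proof -
      let ?\<phi> = "\<lambda>s. semigroup P s f x"
      have local: "\<bar>integral {a..a + k} ?\<phi> - k * ?\<phi> a\<bar> \<le> \<epsilon>' * k" if a: "0 \<le> a" for a
      proof -
        have "integral {a..a + k} ?\<phi> - k * ?\<phi> a = integral {a..a + k} (\<lambda>s. ?\<phi> s - ?\<phi> a)"
          using a k int[of a] by (subst integral_diff) (auto simp: content_real)
        moreover have "norm (integral {a..a + k} (\<lambda>s. ?\<phi> s - ?\<phi> a)) \<le> \<epsilon>' * (a + k - a)"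
          using a k d(2) by (intro integral_bound continuous_intros continuous_on_subset[OF cont]) auto
        ultimately show ?thesis by simp
      qed
      have "integral {0..h} (\<lambda>s. semigroup P (k + s) f x) = integral {k..h + k} ?\<phi>"
        using integral_shift_Icc_real[of 0 h ?\<phi> k] by (simp add: comp_def)
      moreover have "integral {0..k} ?\<phi> + integral {k..h + k} ?\<phi> = integral {0..h + k} ?\<phi>"
        "integral {0..h} ?\<phi> + integral {h..h + k} ?\<phi> = integral {0..h + k} ?\<phi>"
        using h k by (auto intro!: Henstock_Kurzweil_Integration.integral_combine int)
      ultimately have "h * (F k x - F 0 x) = integral {h..h + k} ?\<phi> - integral {0..0 + k} ?\<phi>"
        unfolding F_def using h by (simp add: right_diff_distrib)
      moreover have "h * k * g x = k * ?\<phi> h - k * ?\<phi> 0"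
        unfolding g_def using h by (simp add: semigroup_0[OF bb] field_simps)
      ultimately have "\<bar>h * (F k x - F 0 x) - h * k * g x\<bar> \<le> 2 * (\<epsilon>' * k)"
        using local[of h] local[of 0] h by linarith
      then have "\<bar>h * (F k x - F 0 x) - h * k * g x\<bar> / (h * k) \<le> \<epsilon> / 2"
        using h k unfolding \<epsilon>'_def by (simp add: field_simps)
      moreover have "\<bar>h * (F k x - F 0 x) - h * k * g x\<bar> / (h * k) = \<bar>(F k x - F 0 x) / k - g x\<bar>"
      proof -
        have "h * (F k x - F 0 x) - h * k * g x = (h * k) * ((F k x - F 0 x) / k - g x)"
          using k by (simp add: field_simps)
        then show ?thesis using h k by (simp add: abs_mult)
      qed
      ultimately show ?thesis using \<epsilon> k by (simp add: shift dist_real_def)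
    qed
    then show "\<forall>\<^sub>F t in at_right 0. \<forall>x\<in>UNIV. dist ((semigroup P t (F 0) x - F 0 x) / t) (g x) < \<epsilon>"
      unfolding eventually_at_right_field using d(1) by auto
  qed
  then have "(F 0, g) \<in> A" using F_L g_L unfolding A_def generator_def by auto
  moreover have "\<bar>F 0 x - f x\<bar> \<le> e" for x
  proof -
    have "integral {0..h} (\<lambda>s. semigroup P s f x) - h * f x = integral {0..h} (\<lambda>s. semigroup P s f x - f x)"
      using h int[of 0] by (subst integral_diff) (auto simp: content_real)
    moreover have "norm (integral {0..h} (\<lambda>s. semigroup P s f x - f x)) \<le> e * (h - 0)"
      using h h0(2)[of _ 0] by (intro integral_bound continuous_intros continuous_on_subset[OF cont]) (auto simp: semigroup_0[OF bb])
    ultimately have "\<bar>h * F 0 x - h * f x\<bar> \<le> h * e" unfolding F_def using h by (simp add: mult.commute)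
    then show ?thesis using h by (simp add: abs_mult flip: right_diff_distrib)
  qed
  ultimately show thesis by (rule that)
qed

section \<open>Integrated consequences of invariance and reversibility\<close>

text \<open>Along the evolution of a domain element the integral has the derivative
  \<open>\<integral>x. semigroup P s g x \<partial>\<pi>\<close>, which vanishes since
  \<open>semigroup P s g\<close> is again a value of the generator. Density of the domain extends
  this to \<open>L\<close>.\<close>

lemma stationary:
  assumes inv: "invariant_measure A \<pi>" and f: "f \<in> L" and t: "0 \<le> t"
  shows "(\<integral>x. semigroup P t f x \<partial>\<pi>) = (\<integral>x. f x \<partial>\<pi>)"
proof -
  have \<pi>: "prob_space \<pi>" "sets \<pi> = sets borel"
    and zero: "\<And>f g. (f, g) \<in> A \<Longrightarrow> (\<integral>x. g x \<partial>\<pi>) = 0"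
    using inv unfolding invariant_measure_def by auto
  have gen: "(\<integral>x. semigroup P t f x \<partial>\<pi>) = (\<integral>x. f x \<partial>\<pi>)" if fg: "(f, g) \<in> A" for f g
  proof -
    note L = generatorD(1,2)[OF fg]
    let ?u = "\<lambda>t. \<integral>x. semigroup P t f x \<partial>\<pi>"
    have "?u t = ?u 0"
    proof (rule eq_of_small_increments[OF t])
      fix e :: real assume "e > 0"
      from generatorD(3)[OF fg this] obtain d where d: "d > 0"
        "\<And>h s x. 0 < h \<Longrightarrow> h < d \<Longrightarrow> 0 \<le> s \<Longrightarrow>
          \<bar>semigroup P (s + h) f x - semigroup P s f x - h * semigroup P s g x\<bar> \<le> e * h" by blast
      have "\<bar>?u (s + h) - ?u s\<bar> \<le> e * h" if hs: "0 < h" "h < d" "0 \<le> s" for h s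
      proof -
        have b: "semigroup P s f \<in> L" "semigroup P s g \<in> L" "semigroup P (s + h) f \<in> L"
          using L hs by (auto intro!: semigroup_L)
        have "\<bar>?u (s + h) - (\<integral>x. 1 * semigroup P s f x + h * semigroup P s g x \<partial>\<pi>)\<bar> \<le> e * h"
          using d(2)[OF hs] by (intro integral_close[OF \<pi>] L_bounded_borel L_comb b) (auto simp: algebra_simps)
        moreover have "(\<integral>x. semigroup P s g x \<partial>\<pi>) = 0"
          using zero semigroup_generator[OF fg hs(3)] by blast
        ultimately show ?thesis
          using b[THEN L_bounded_borel, THEN integrable_bounded_borel[OF \<pi>]] by simp
      qed
      then show "\<exists>d>0. \<forall>h s. 0 < h \<and> h < d \<and> 0 \<le> s \<and> s + h \<le> t \<longrightarrow> \<bar>?u (s + h) - ?u s\<bar> \<le> e * h"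
        using d(1) by blast
    qed
    then show ?thesis using semigroup_0 L L_bounded_borel by simp
  qed
  have "\<bar>(\<integral>x. semigroup P t f x \<partial>\<pi>) - (\<integral>x. f x \<partial>\<pi>)\<bar> \<le> 0 + e" if e: "e > 0" for e
  proof -
    obtain f' g' where fg: "(f', g') \<in> A" and close: "\<And>x. \<bar>f' x - f x\<bar> \<le> e / 2"
      using domain_dense[OF f, of "e / 2"] e by auto
    have L: "f' \<in> L" using generatorD(1)[OF fg] .
    have "\<bar>(\<integral>x. f' x \<partial>\<pi>) - (\<integral>x. f x \<partial>\<pi>)\<bar> \<le> e / 2"
      by (intro integral_close[OF \<pi>] L_bounded_borel f L close)
    moreover have "\<bar>(\<integral>x. semigroup P t f' x \<partial>\<pi>) - (\<integral>x. semigroup P t f x \<partial>\<pi>)\<bar> \<le> e / 2"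
      by (intro integral_close[OF \<pi>] semigroup_contraction L_bounded_borel semigroup_L f L close t)
    ultimately show ?thesis using gen[OF fg] by linarith
  qed
  then have "\<bar>(\<integral>x. semigroup P t f x \<partial>\<pi>) - (\<integral>x. f x \<partial>\<pi>)\<bar> \<le> 0" by (rule field_le_epsilon)
  then show ?thesis by simp
qed


text \<open>Interpolate by the integral of
  \<open>semigroup P s f x * semigroup P (T - s) g x\<close>: its values at \<open>s = T\<close> and
  \<open>s = 0\<close> are the two sides, and its derivative is the difference of two forms that
  symmetry of the generator equates.\<close>

lemma reversible_symmetric_domain:
  assumes rev: "reversible_measure A \<pi>" and f: "(f, f') \<in> A" and g: "(g, g') \<in> A" and T: "0 \<le> T"
  shows "(\<integral>x. semigroup P T f x * g x \<partial>\<pi>) = (\<integral>x. f x * semigroup P T g x \<partial>\<pi>)"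
proof -
  have \<pi>: "prob_space \<pi>" "sets \<pi> = sets borel"
    and sym: "\<And>f f' g g'. (f, f') \<in> A \<Longrightarrow> (g, g') \<in> A \<Longrightarrow> (\<integral>x. f x * g' x \<partial>\<pi>) = (\<integral>x. f' x * g x \<partial>\<pi>)"
    using rev unfolding reversible_measure_def by auto
  note L = generatorD(1,2)[OF f] generatorD(1,2)[OF g]
  obtain M N where M: "\<And>x. \<bar>f x\<bar> \<le> M" and N: "\<And>x. \<bar>g x\<bar> \<le> N"
    using L L_bounded_borel bounded_borelD(2) by metis
  have MN: "0 \<le> M" "0 \<le> N" using M N by (auto intro: order_trans[OF abs_ge_zero])
  let ?u = "\<lambda>s. \<integral>x. semigroup P s f x * semigroup P (T - s) g x \<partial>\<pi>"
  have "?u T = ?u 0"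
  proof (rule eq_of_small_increments[OF T])
    fix e :: real assume e: "e > 0"
    \<comment> \<open>Each remainder is weighted by the sup bound M or N of the other factor; the
      added 1 keeps the denominator positive.\<close>
    define e' where "e' = e / (M + N + 1)"
    have e': "e' > 0" "(M + N) * e' \<le> e" using e MN by (auto simp: e'_def field_simps)
    obtain d1 where d1: "d1 > 0" "\<And>h s x. 0 < h \<Longrightarrow> h < d1 \<Longrightarrow> 0 \<le> s \<Longrightarrow>
        \<bar>semigroup P (s + h) f x - semigroup P s f x - h * semigroup P s f' x\<bar> \<le> e' * h"
      using generatorD(3)[OF f e'(1)] by blast
    obtain d2 where d2: "d2 > 0" "\<And>h s x. 0 < h \<Longrightarrow> h < d2 \<Longrightarrow> 0 \<le> s \<Longrightarrow>
        \<bar>semigroup P (s + h) g x - semigroup P s g x - h * semigroup P s g' x\<bar> \<le> e' * h"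
      using generatorD(3)[OF g e'(1)] by blast
    have "\<bar>?u (s + h) - ?u s\<bar> \<le> e * h" if h: "0 < h" "h < min d1 d2" "0 \<le> s" "s + h \<le> T" for h s
    proof -
      define r where "r = T - (s + h)"
      have r: "0 \<le> r" "T - s = r + h" using h by (auto simp: r_def)
      define p where "p = semigroup P s f" define p' where "p' = semigroup P s f'"
      define q where "q = semigroup P r g" define q' where "q' = semigroup P r g'"
      define p1 where "p1 = semigroup P (s + h) f" define q1 where "q1 = semigroup P (r + h) g"
      note defs = p_def p'_def q_def q'_def p1_def q1_def
      have bb: "p \<in> bounded_borel" "p' \<in> bounded_borel" "q \<in> bounded_borel" "q' \<in> bounded_borel"
          "p1 \<in> bounded_borel" "q1 \<in> bounded_borel"
        unfolding defs using h r L by (auto intro!: L_bounded_borel semigroup_L)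
      note bbm = bb[THEN bounded_borel_mult] bb
      have comb: "(\<lambda>x. F x + c * (G x - H x)) \<in> bounded_borel"
        if FGH: "F \<in> bounded_borel" "G \<in> bounded_borel" "H \<in> bounded_borel" for F G H :: "'a \<Rightarrow> real" and c
      proof -
        obtain a b k where "\<And>x. \<bar>F x\<bar> \<le> a" "\<And>x. \<bar>G x\<bar> \<le> b" "\<And>x. \<bar>H x\<bar> \<le> k" using FGH[THEN bounded_borelD(2)] by auto
        then have "\<bar>F x + c * (G x - H x)\<bar> \<le> a + \<bar>c\<bar> * (b + k)" for x
          by (intro order_trans[OF abs_triangle_ineq] add_mono order_trans[OF abs_triangle_ineq4])
            (auto simp: abs_mult intro!: mult_left_mono order_trans[OF abs_triangle_ineq4] add_mono)
        then show ?thesis using FGH[THEN bounded_borelD(1)] by (intro bounded_borelI[where M="a + \<bar>c\<bar> * (b + k)"] borel_measurable_add borel_measurable_times borel_measurable_diff borel_measurable_const) auto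
      qed
      have "\<bar>(\<integral>x. p1 x * q x \<partial>\<pi>) - (\<integral>x. p x * q1 x + h * (p' x * q x - p x * q' x) \<partial>\<pi>)\<bar> \<le> e * h"
      proof (intro integral_close[OF \<pi>] comb bbm)
        fix x
        \<comment> \<open>Expanding the first factor from time s and the second from time
          \<open>r = T - (s + h)\<close> makes the identity exact, without a cross term of second
          order in h.\<close>
        have "p1 x * q x - (p x * q1 x + h * (p' x * q x - p x * q' x)) =
            (p1 x - p x - h * p' x) * q x - p x * (q1 x - q x - h * q' x)" by (simp add: algebra_simps)
        also have "\<bar>\<dots>\<bar> \<le> \<bar>p1 x - p x - h * p' x\<bar> * \<bar>q x\<bar> + \<bar>p x\<bar> * \<bar>q1 x - q x - h * q' x\<bar>"
          by (metis abs_triangle_ineq4 abs_mult)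
        also have "\<dots> \<le> (e' * h) * N + M * (e' * h)"
        proof (intro add_mono mult_mono)
          show "\<bar>p1 x - p x - h * p' x\<bar> \<le> e' * h" unfolding defs using h by (intro d1) auto
          show "\<bar>q1 x - q x - h * q' x\<bar> \<le> e' * h" unfolding defs using h r by (intro d2) auto
          show "\<bar>q x\<bar> \<le> N" unfolding defs using r L N by (intro semigroup_bound L_bounded_borel) auto
          show "\<bar>p x\<bar> \<le> M" unfolding defs using h L M by (intro semigroup_bound L_bounded_borel) auto
        qed (use MN e' h in auto)
        also have "\<dots> = ((M + N) * e') * h" by (simp add: algebra_simps)
        also have "\<dots> \<le> e * h" using e' h by (intro mult_right_mono) auto
        finally show "\<bar>p1 x * q x - (p x * q1 x + h * (p' x * q x - p x * q' x))\<bar> \<le> e * h" .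
      qed
      moreover have "(\<integral>x. p x * q' x \<partial>\<pi>) = (\<integral>x. p' x * q x \<partial>\<pi>)"
        unfolding defs using h r by (intro sym semigroup_generator f g)
      moreover have "(\<integral>x. p x * q1 x + h * (p' x * q x - p x * q' x) \<partial>\<pi>) =
          (\<integral>x. p x * q1 x \<partial>\<pi>) + h * ((\<integral>x. p' x * q x \<partial>\<pi>) - (\<integral>x. p x * q' x \<partial>\<pi>))"
        using integrable_bounded_borel[OF \<pi> bounded_borel_mult] bb by simp
      ultimately show ?thesis using r by (simp add: defs r_def[symmetric])
    qed
    then show "\<exists>d>0. \<forall>h s. 0 < h \<and> h < d \<and> 0 \<le> s \<and> s + h \<le> T \<longrightarrow> \<bar>?u (s + h) - ?u s\<bar> \<le> e * h"
      using d1(1) d2(1) by (intro exI[of _ "min d1 d2"]) auto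
  qed
  then show ?thesis using semigroup_0 L L_bounded_borel by simp
qed

lemma reversible_symmetric:
  assumes rev: "reversible_measure A \<pi>" and f: "f \<in> L" and g: "g \<in> L" and T: "0 \<le> T"
  shows "(\<integral>x. semigroup P T f x * g x \<partial>\<pi>) = (\<integral>x. f x * semigroup P T g x \<partial>\<pi>)"
proof -
  have \<pi>: "prob_space \<pi>" "sets \<pi> = sets borel"
    using rev unfolding reversible_measure_def by auto
  obtain M N where M: "\<And>x. \<bar>f x\<bar> \<le> M" and N: "\<And>x. \<bar>g x\<bar> \<le> N"
    using f g L_bounded_borel bounded_borelD(2) by metis
  have MN: "0 \<le> M" "0 \<le> N" using M N by (auto intro: order_trans[OF abs_ge_zero])
  \<comment> \<open>The cross term \<open>(a' x - a x) * (b' x - b x)\<close> is of second order;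
    \<open>e \<le> 1\<close> bounds it by e, which accounts for the 1 in the constant.\<close>
  have approx: "\<bar>(\<integral>x. a' x * b' x \<partial>\<pi>) - (\<integral>x. a x * b x \<partial>\<pi>)\<bar> \<le> (K + J + 1) * e"
    if bb: "a \<in> bounded_borel" "b \<in> bounded_borel" "a' \<in> bounded_borel" "b' \<in> bounded_borel"
      and e: "e > 0" "e \<le> 1" and le: "\<And>x. \<bar>a' x - a x\<bar> \<le> e" "\<And>x. \<bar>b' x - b x\<bar> \<le> e"
        "\<And>x. \<bar>a x\<bar> \<le> K" "\<And>x. \<bar>b x\<bar> \<le> J" for a b a' b' :: "'a \<Rightarrow> real" and K J e
  proof (intro integral_close[OF \<pi>] bounded_borel_mult bb)
    fix x
    have "a' x * b' x - a x * b x = (a' x - a x) * b x + a x * (b' x - b x) + (a' x - a x) * (b' x - b x)"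
      by (simp add: algebra_simps)
    also have "\<bar>\<dots>\<bar> \<le> \<bar>a' x - a x\<bar> * \<bar>b x\<bar> + \<bar>a x\<bar> * \<bar>b' x - b x\<bar> + \<bar>a' x - a x\<bar> * \<bar>b' x - b x\<bar>"
      unfolding abs_mult[symmetric] by linarith
    also have "\<dots> \<le> e * J + K * e + 1 * e"
      by (intro add_mono mult_mono le order_trans[OF le(1)[of x] e(2)] abs_ge_zero
          order_trans[OF abs_ge_zero le(3)[of x]]) (use e in auto)
    finally show "\<bar>a' x * b' x - a x * b x\<bar> \<le> (K + J + 1) * e" by (simp add: algebra_simps)
  qed
  have "\<bar>(\<integral>x. semigroup P T f x * g x \<partial>\<pi>) - (\<integral>x. f x * semigroup P T g x \<partial>\<pi>)\<bar> \<le> 0 + e" if e: "e > 0" for e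
  proof -
    define e' where "e' = min 1 (e / (2 * (M + N + 1)))"
    have J: "0 < 2 * (M + N + 1)" using MN by simp
    then have e': "e' > 0" "e' \<le> 1" using e unfolding e'_def by auto
    have "e' \<le> e / (2 * (M + N + 1))" by (simp add: e'_def)
    then have e'_le: "2 * ((M + N + 1) * e') \<le> e"
      using J by (simp only: pos_le_divide_eq) (simp add: algebra_simps)
    obtain f1 f2 where f1: "(f1, f2) \<in> A" "\<And>x. \<bar>f1 x - f x\<bar> \<le> e'" using domain_dense[OF f e'(1)] by auto
    obtain g1 g2 where g1: "(g1, g2) \<in> A" "\<And>x. \<bar>g1 x - g x\<bar> \<le> e'" using domain_dense[OF g e'(1)] by auto
    have L: "f1 \<in> L" "g1 \<in> L" using f1 g1 generatorD(1) by auto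
    have "\<bar>(\<integral>x. semigroup P T f1 x * g1 x \<partial>\<pi>) - (\<integral>x. semigroup P T f x * g x \<partial>\<pi>)\<bar> \<le> (M + N + 1) * e'"
      by (intro approx e' L_bounded_borel semigroup_L semigroup_contraction semigroup_bound L f g T f1(2) g1(2) M N)
    moreover have "\<bar>(\<integral>x. f1 x * semigroup P T g1 x \<partial>\<pi>) - (\<integral>x. f x * semigroup P T g x \<partial>\<pi>)\<bar> \<le> (M + N + 1) * e'"
      by (intro approx e' L_bounded_borel semigroup_L semigroup_contraction semigroup_bound L f g T f1(2) g1(2) M N)
    ultimately show ?thesis using reversible_symmetric_domain[OF rev f1(1) g1(1) T] e'_le by linarith
  qed
  then have "\<bar>(\<integral>x. semigroup P T f x * g x \<partial>\<pi>) - (\<integral>x. f x * semigroup P T g x \<partial>\<pi>)\<bar> \<le> 0"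
    by (rule field_le_epsilon)
  then show ?thesis by simp
qed

section \<open>Laws and pair laws determined by the domain space\<close>

text \<open>\<open>domain_space\<close> speaks of probability measures, so both measures are
  normalised. Equality of the masses is a separate assumption because \<open>L\<close> need not
  contain the constants.\<close>

lemma measure_determining:
  assumes \<mu>: "finite_measure \<mu>" "sets \<mu> = sets borel" and \<nu>: "finite_measure \<nu>" "sets \<nu> = sets borel"
    and mass: "measure \<mu> UNIV = measure \<nu> UNIV"
    and eq: "\<And>f. f \<in> L \<Longrightarrow> (\<integral>x. f x \<partial>\<mu>) = (\<integral>x. f x \<partial>\<nu>)"
  shows "\<mu> = \<nu>"
proof -
  interpret \<mu>: finite_measure \<mu> by fact
  interpret \<nu>: finite_measure \<nu> by fact
  define c where "c = measure \<mu> UNIV"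
  have space: "space \<mu> = UNIV" "space \<nu> = UNIV"
    using sets_eq_imp_space_eq[OF \<mu>(2)] sets_eq_imp_space_eq[OF \<nu>(2)] by auto
  show ?thesis
  proof (cases "c = 0")
    case True
    have "emeasure \<mu> B = 0" "emeasure \<nu> B = 0" for B
      using emeasure_space[of \<mu> B] emeasure_space[of \<nu> B] True mass
      unfolding space \<mu>.emeasure_eq_measure \<nu>.emeasure_eq_measure c_def
      by (auto simp: measure_le_0_iff)
    then show ?thesis by (intro measure_eqI) (auto simp: \<mu> \<nu>)
  next
    case False
    then have c: "c > 0" unfolding c_def by (simp add: less_le)
    define N where "N \<mu> = density \<mu> (\<lambda>_. ennreal (1 / c))" for \<mu> :: "'a measure"
    have N: "emeasure (N \<kappa>) B = ennreal (1 / c) * emeasure \<kappa> B" if "B \<in> sets borel" "sets \<kappa> = sets borel" for \<kappa> B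
      unfolding N_def using that by (subst emeasure_density_const) auto
    have prob: "prob_space (N \<kappa>)" if "finite_measure \<kappa>" "sets \<kappa> = sets borel" "measure \<kappa> UNIV = c" for \<kappa>
    proof
      have "emeasure (N \<kappa>) UNIV = ennreal (1 / c) * ennreal c"
        using that N[of UNIV \<kappa>] by (simp add: finite_measure.emeasure_eq_measure)
      also have "\<dots> = 1" using c by (simp flip: ennreal_mult')
      finally show "emeasure (N \<kappa>) (space (N \<kappa>)) = 1"
        using sets_eq_imp_space_eq[OF that(2)] by (simp add: N_def)
    qed
    have int: "(\<integral>x. f x \<partial>N \<kappa>) = (1 / c) * (\<integral>x. f x \<partial>\<kappa>)" if "f \<in> L" "sets \<kappa> = sets borel" for f \<kappa>
      unfolding N_def using bounded_borelD(1)[OF L_bounded_borel[OF that(1)]] that(2) c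
        measurable_cong_sets[OF that(2) HOL.refl]
      by (subst integral_density) auto
    have "N \<mu> = N \<nu>"
    proof -
      have "prob_space (N \<mu>)" "prob_space (N \<nu>)" "sets (N \<mu>) = sets borel" "sets (N \<nu>) = sets borel"
        using prob \<mu> \<nu> mass c_def by (auto simp: N_def)
      moreover have "\<forall>f\<in>L. (\<integral>x. f x \<partial>N \<mu>) = (\<integral>x. f x \<partial>N \<nu>)" using int eq \<mu>(2) \<nu>(2) by simp
      ultimately show ?thesis using dom unfolding domain_space_def by blast
    qed
    then have "ennreal (1 / c) * emeasure \<mu> B = ennreal (1 / c) * emeasure \<nu> B" if "B \<in> sets borel" for B
      using N[OF that] \<mu>(2) \<nu>(2) by metis
    then show ?thesis
      using c by (intro measure_eqI) (auto simp: \<mu> \<nu> ennreal_mult_cancel_left)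
  qed
qed

text \<open>Read the weights as densities: the two sides are integrals of f against finite image
  measures, which \<open>L\<close> determines. This upgrades an identity from f in \<open>L\<close>
  to all Borel f while another factor is frozen in the weight.\<close>

lemma weighted_law_determining:
  assumes Q: "prob_space Q" and X[measurable]: "X1 \<in> Q \<rightarrow>\<^sub>M borel" "X2 \<in> Q \<rightarrow>\<^sub>M borel"
    and w[measurable]: "w1 \<in> borel_measurable Q" "w2 \<in> borel_measurable Q"
    and wb: "\<And>\<omega>. 0 \<le> w1 \<omega>" "\<And>\<omega>. 0 \<le> w2 \<omega>" "\<And>\<omega>. w1 \<omega> \<le> K" "\<And>\<omega>. w2 \<omega> \<le> K"
    and mass: "(\<integral>\<omega>. w1 \<omega> \<partial>Q) = (\<integral>\<omega>. w2 \<omega> \<partial>Q)"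
    and eq: "\<And>f. f \<in> L \<Longrightarrow> (\<integral>\<omega>. w1 \<omega> * f (X1 \<omega>) \<partial>Q) = (\<integral>\<omega>. w2 \<omega> * f (X2 \<omega>) \<partial>Q)"
    and f: "f \<in> borel_measurable borel"
  shows "(\<integral>\<omega>. w1 \<omega> * f (X1 \<omega>) \<partial>Q) = (\<integral>\<omega>. w2 \<omega> * f (X2 \<omega>) \<partial>Q)"
proof -
  interpret prob_space Q by fact
  define law where "law w X = distr (density Q (\<lambda>\<omega>. ennreal (w \<omega>))) borel X" for w and X :: "'b \<Rightarrow> 'a"
  have law: "(\<integral>x. g x \<partial>law w X) = (\<integral>\<omega>. w \<omega> * g (X \<omega>) \<partial>Q)"
    if [measurable]: "g \<in> borel_measurable borel" "w \<in> borel_measurable Q" "X \<in> Q \<rightarrow>\<^sub>M borel"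
      and "\<And>\<omega>. 0 \<le> w \<omega>" for g :: "'a \<Rightarrow> real" and w X
    unfolding law_def using that(4) by (subst integral_distr) (auto simp: integral_density)
  have fin: "finite_measure (law w X)" and m: "measure (law w X) UNIV = (\<integral>\<omega>. w \<omega> \<partial>Q)"
    if [measurable]: "w \<in> borel_measurable Q" "X \<in> Q \<rightarrow>\<^sub>M borel"
      and b: "\<And>\<omega>. 0 \<le> w \<omega>" "\<And>\<omega>. w \<omega> \<le> K" for w X
  proof -
    have "integrable Q w" using b by (intro integrable_const_bound[where B=K]) auto
    then have e: "emeasure (law w X) UNIV = ennreal (\<integral>\<omega>. w \<omega> \<partial>Q)"
      unfolding law_def using b
      by (simp add: emeasure_distr emeasure_density nn_integral_eq_integral cong: nn_integral_cong)
    show "finite_measure (law w X)"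
      by (rule finite_measureI) (use e in \<open>simp add: law_def\<close>)
    show "measure (law w X) UNIV = (\<integral>\<omega>. w \<omega> \<partial>Q)"
      unfolding measure_def e using b by (simp add: enn2real_ennreal integral_nonneg)
  qed
  have "law w1 X1 = law w2 X2"
  proof (rule measure_determining)
    fix g assume g: "g \<in> L"
    then show "(\<integral>x. g x \<partial>law w1 X1) = (\<integral>x. g x \<partial>law w2 X2)"
      using bounded_borelD(1)[OF L_bounded_borel[OF g]] wb eq by (simp add: law)
  next
    show "measure (law w1 X1) UNIV = measure (law w2 X2) UNIV"
      using m[OF w(1) X(1) wb(1,3)] m[OF w(2) X(2) wb(2,4)] mass by simp
    show "finite_measure (law w1 X1)" "finite_measure (law w2 X2)"
      using fin[OF w(1) X(1) wb(1,3)] fin[OF w(2) X(2) wb(2,4)] by auto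
  qed (simp_all add: law_def)
  then show ?thesis using law[OF f w(1) X(1) wb(1)] law[OF f w(2) X(2) wb(2)] by simp
qed

text \<open>\<open>L\<close> separates laws on the state space, not directly laws of pairs. Test
  functions are therefore replaced by indicators one coordinate at a time, the other coordinate
  acting as a weight.\<close>

lemma exchangeable_pair:
  assumes Q: "prob_space Q" and U[measurable]: "U \<in> Q \<rightarrow>\<^sub>M borel" and V[measurable]: "V \<in> Q \<rightarrow>\<^sub>M borel"
    and law: "\<And>f. f \<in> L \<Longrightarrow> (\<integral>\<omega>. f (U \<omega>) \<partial>Q) = (\<integral>\<omega>. f (V \<omega>) \<partial>Q)"
    and sym: "\<And>f g. f \<in> L \<Longrightarrow> g \<in> L \<Longrightarrow> (\<integral>\<omega>. f (U \<omega>) * g (V \<omega>) \<partial>Q) = (\<integral>\<omega>. f (V \<omega>) * g (U \<omega>) \<partial>Q)"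
    and B[measurable]: "B \<in> sets borel" and C[measurable]: "C \<in> sets borel"
  shows "measure Q {\<omega>\<in>space Q. U \<omega> \<in> B \<and> V \<omega> \<in> C} = measure Q {\<omega>\<in>space Q. V \<omega> \<in> B \<and> U \<omega> \<in> C}"
proof -
  interpret prob_space Q by fact
  have int: "integrable Q (\<lambda>\<omega>. f (X \<omega>))" if f: "f \<in> bounded_borel" and [measurable]: "X \<in> Q \<rightarrow>\<^sub>M borel" for f X
  proof -
    obtain M where "\<And>x. \<bar>f x\<bar> \<le> M" using bounded_borelD(2)[OF f] by auto
    then show ?thesis using bounded_borelD(1)[OF f] by (intro integrable_const_bound[where B=M]) auto
  qed
  have step0: "(\<integral>\<omega>. 1 * f (U \<omega>) \<partial>Q) = (\<integral>\<omega>. 1 * f (V \<omega>) \<partial>Q)" if "f \<in> borel_measurable borel" for f :: "'a \<Rightarrow> real"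
    by (rule weighted_law_determining[OF Q U V, where K=1 and ?w1.0="\<lambda>_. 1" and ?w2.0="\<lambda>_. 1"])
      (use that law in auto)
  have ind: "(indicator S :: 'a \<Rightarrow> real) \<in> bounded_borel" if "S \<in> sets borel" for S
    using that by (intro bounded_borelI[where M=1]) (auto simp: indicator_def)
  have step1: "(\<integral>\<omega>. indicator B (U \<omega>) * g (V \<omega>) \<partial>Q) = (\<integral>\<omega>. indicator B (V \<omega>) * g (U \<omega>) \<partial>Q)"
    if g: "g \<in> L" for g
  proof -
    obtain K where K: "\<And>x. \<bar>g x\<bar> \<le> K" using bounded_borelD L_bounded_borel g by metis
    \<comment> \<open>Weights must be nonnegative, so g is shifted by its bound K; the extra term
      with factor K is removed again by equality of the marginals.\<close>
    have K': "0 \<le> g x + K" "g x + K \<le> 2 * K" for x using K[of x] by linarith+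
    have [measurable]: "g \<in> borel_measurable borel" using bounded_borelD(1)[OF L_bounded_borel[OF g]] .
    have expand: "(\<integral>\<omega>. (g (X \<omega>) + K) * f (Y \<omega>) \<partial>Q) = (\<integral>\<omega>. f (Y \<omega>) * g (X \<omega>) \<partial>Q) + K * (\<integral>\<omega>. f (Y \<omega>) \<partial>Q)"
      if f: "f \<in> bounded_borel" and XY[measurable]: "X \<in> Q \<rightarrow>\<^sub>M borel" "Y \<in> Q \<rightarrow>\<^sub>M borel" for f X Y
    proof -
      have "integrable Q (\<lambda>\<omega>. f (Y \<omega>) * g (X \<omega>))"
        using K bounded_borelD(1)[OF f]
          by (intro Bochner_Integration.integrable_bound[OF integrable_mult_right[OF int[OF f XY(2)], of K]])
            (auto simp: abs_mult mult.commute[of K] intro!: mult_left_mono order_trans[OF K])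
      moreover have "(g (X \<omega>) + K) * f (Y \<omega>) = f (Y \<omega>) * g (X \<omega>) + K * f (Y \<omega>)" for \<omega>
        by (simp add: algebra_simps)
      ultimately show ?thesis using int[OF f XY(2)] by simp
    qed
    have "(\<integral>\<omega>. (g (V \<omega>) + K) * indicator B (U \<omega>) \<partial>Q) = (\<integral>\<omega>. (g (U \<omega>) + K) * indicator B (V \<omega>) \<partial>Q)"
    proof (rule weighted_law_determining[OF Q U V,
          where K="2 * K" and ?w1.0="\<lambda>\<omega>. g (V \<omega>) + K" and ?w2.0="\<lambda>\<omega>. g (U \<omega>) + K"])
      show "(\<integral>\<omega>. g (V \<omega>) + K \<partial>Q) = (\<integral>\<omega>. g (U \<omega>) + K \<partial>Q)"
        using law[OF g] int[OF L_bounded_borel[OF g] U] int[OF L_bounded_borel[OF g] V] by simp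
      fix f assume f: "f \<in> L"
      show "(\<integral>\<omega>. (g (V \<omega>) + K) * f (U \<omega>) \<partial>Q) = (\<integral>\<omega>. (g (U \<omega>) + K) * f (V \<omega>) \<partial>Q)"
        unfolding expand[OF L_bounded_borel[OF f] V U] expand[OF L_bounded_borel[OF f] U V]
        using sym[OF f g] law[OF f] by simp
    qed (use K' in auto)
    then show ?thesis
      unfolding expand[OF ind[OF B] V U] expand[OF ind[OF B] U V]
      using step0[of "indicator B"] by simp
  qed
  \<comment> \<open>Second coordinate: the indicator of B is now the weight, and the first
    replacement supplies the identity for test functions in \<open>L\<close>.\<close>
  have "(\<integral>\<omega>. indicator B (U \<omega>) * indicator C (V \<omega>) \<partial>Q) = (\<integral>\<omega>. indicator B (V \<omega>) * (indicator C (U \<omega>) :: real) \<partial>Q)"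
    by (rule weighted_law_determining[OF Q V U, where K=1 and ?w1.0="\<lambda>\<omega>. indicator B (U \<omega>)"
        and ?w2.0="\<lambda>\<omega>. indicator B (V \<omega>)"])
      (use step1 step0[of "indicator B"] in \<open>auto simp: indicator_def\<close>)
  moreover have "(\<integral>\<omega>. indicator B (X \<omega>) * (indicator C (Y \<omega>) :: real) \<partial>Q) = measure Q {\<omega>\<in>space Q. X \<omega> \<in> B \<and> Y \<omega> \<in> C}"
    if [measurable]: "X \<in> Q \<rightarrow>\<^sub>M borel" "Y \<in> Q \<rightarrow>\<^sub>M borel" for X Y :: "'b \<Rightarrow> 'a"
  proof -
    have "(\<integral>\<omega>. indicator B (X \<omega>) * (indicator C (Y \<omega>) :: real) \<partial>Q) =
        (\<integral>\<omega>. indicator {\<omega>\<in>space Q. X \<omega> \<in> B \<and> Y \<omega> \<in> C} \<omega> \<partial>Q)"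
      by (intro Bochner_Integration.integral_cong) (auto simp: indicator_def)
    then show ?thesis by simp
  qed
  ultimately show ?thesis by (simp add: U V)
qed

end

section \<open>Skorokhod space and transfer of large deviations\<close>

definition locally_in :: "real \<Rightarrow> 'a::metric_space set \<Rightarrow> (real \<Rightarrow> 'a) set" where
  "locally_in t G = {x \<in> cadlag. \<exists>a b r. a < t \<and> t < b \<and> 0 < r \<and> (\<forall>s\<in>{a..b}. 0 \<le> s \<longrightarrow> ball (x s) r \<subseteq> G)}"

text \<open>
  The evaluation \<open>x \<mapsto> x t\<close> is not continuous in the Skorokhod topology; requiring \<open>x\<close> to stay well
  inside \<open>G\<close> near time \<open>t\<close> gives an open set that agrees with \<open>x t \<in> G\<close> on continuous paths.
\<close>

lemma openin_locally_in: "openin skorokhod (locally_in t G)"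
  unfolding openin_skorokhod
proof (intro conjI ballI)
  show "locally_in t G \<subseteq> cadlag" by (auto simp: locally_in_def)
  fix x :: "real \<Rightarrow> 'a" assume "x \<in> locally_in t G"
  then obtain a b r where abr: "a < t" "t < b" "0 < r" "\<And>s. s \<in> {a..b} \<Longrightarrow> 0 \<le> s \<Longrightarrow> ball (x s) r \<subseteq> G"
    by (auto simp: locally_in_def)
  \<comment> \<open>The margins are halved: a time shift below \<epsilon> keeps the middle half of
    the window inside \<open>{a..b}\<close>, and a displacement below \<open>r / 2\<close> leaves
    half of the radius.\<close>
  define \<epsilon> where "\<epsilon> = min (r / 2) (min ((t - a) / 2) ((b - t) / 2))"
  have \<epsilon>: "0 < \<epsilon>" "\<epsilon> \<le> r / 2" "\<epsilon> \<le> (t - a) / 2" "\<epsilon> \<le> (b - t) / 2" using abr unfolding \<epsilon>_def by (auto simp: min_def)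
  have "skorokhod_nhd x b \<epsilon> \<subseteq> locally_in t G"
  proof
    fix y assume "y \<in> skorokhod_nhd x b \<epsilon>"
    then obtain l where y: "y \<in> cadlag" and l: "time_change l"
      "\<And>s. s \<in> {0..b} \<Longrightarrow> \<bar>l s - s\<bar> < \<epsilon> \<and> dist (y s) (x (l s)) < \<epsilon>"
      unfolding skorokhod_nhd_def by blast
    have l_nonneg: "0 \<le> l s" if "0 \<le> s" for s using l(1) that unfolding time_change_def by auto
    have "ball (y s) (r / 2) \<subseteq> G" if s: "s \<in> {(a + t) / 2..(b + t) / 2}" "0 \<le> s" for s
    proof -
      have "s \<in> {0..b}" using s abr by auto
      note ls = l(2)[OF this]
      have "l s \<in> {a..b}"
        using ls \<epsilon> s(1) unfolding atLeastAtMost_iff abs_less_iff by (auto simp: field_simps)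
      then have "ball (x (l s)) r \<subseteq> G" using abr(4) l_nonneg s by blast
      moreover have "ball (y s) (r / 2) \<subseteq> ball (x (l s)) r"
      proof
        fix w assume "w \<in> ball (y s) (r / 2)"
        then show "w \<in> ball (x (l s)) r"
          using ls \<epsilon>(2) dist_triangle[of "x (l s)" w "y s"] by (simp add: dist_commute)
      qed
      ultimately show ?thesis by blast
    qed
    then show "y \<in> locally_in t G"
      using y abr unfolding locally_in_def
      by (intro CollectI conjI exI[of _ "(a + t) / 2"] exI[of _ "(b + t) / 2"] exI[of _ "r / 2"]) auto
  qed
  then show "\<exists>T \<epsilon>. \<epsilon> > 0 \<and> skorokhod_nhd x T \<epsilon> \<subseteq> locally_in t G" using \<epsilon>(1) by blast
qed

lemma locally_in_cadlag: "x \<in> locally_in t G \<Longrightarrow> x \<in> cadlag"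
  by (simp add: locally_in_def)

lemma locally_in_eval: "x \<in> locally_in t G \<Longrightarrow> 0 \<le> t \<Longrightarrow> x t \<in> G"
  by (force simp: locally_in_def)

lemma continuous_locally_in:
  assumes x: "x \<in> cadlag" "continuous_on {0..} x" and G: "open G" and t: "0 \<le> t" "x t \<in> G"
  shows "x \<in> locally_in t G"
proof -
  obtain r where r: "r > 0" "ball (x t) r \<subseteq> G" using G t(2) open_contains_ball by blast
  obtain d where d: "d > 0" "\<And>s. 0 \<le> s \<Longrightarrow> dist s t < d \<Longrightarrow> dist (x s) (x t) < r / 2"
    using x(2) t(1) r(1) unfolding continuous_on_iff by (metis atLeast_iff half_gt_zero)
  have "ball (x s) (r / 2) \<subseteq> G" if "s \<in> {t - d / 2..t + d / 2}" "0 \<le> s" for s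
  proof -
    have "dist s t < d" using that d(1) by (auto simp: dist_real_def)
    note near = d(2)[OF that(2) this]
    have "ball (x s) (r / 2) \<subseteq> ball (x t) r"
    proof
      fix w assume "w \<in> ball (x s) (r / 2)"
      then show "w \<in> ball (x t) r"
        using near dist_triangle[of "x t" w "x s"] by (simp add: dist_commute)
    qed
    then show ?thesis using r(2) by blast
  qed
  then show ?thesis unfolding locally_in_def using x(1) d(1) r(1)
    by (intro CollectI conjI exI[of _ "t - d / 2"] exI[of _ "t + d / 2"] exI[of _ "r / 2"]) auto
qed

lemma openin_borel_of: "openin T U \<Longrightarrow> U \<in> sets (borel_of T)"
  unfolding borel_of_def by (subst sets_measure_of) (auto dest: openin_subset)

lemma space_borel_of: "space (borel_of T) = topspace T"
  unfolding borel_of_def by (subst space_measure_of) (auto dest: openin_subset)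

text \<open>By right continuity, \<open>x t \<in> G\<close> can be read off at times decreasing to
  t. At those times the path lies robustly inside G, an open condition in the sense of
  \<open>locally_in\<close>, so the event is a countable union of countable intersections of open
  sets.\<close>

lemma eval_measurable:
  fixes t :: real
  assumes t: "0 \<le> t"
  shows "(\<lambda>x :: real \<Rightarrow> 'a::metric_space. x t) \<in> borel_of skorokhod \<rightarrow>\<^sub>M borel"
proof (rule borel_measurableI)
  fix G :: "'a set" assume G: "open G"
  \<comment> \<open>For fixed m these offsets tend to 0 as k grows and all stay below
    \<open>1 / (real m + 1)\<close>, so one m serves every k.\<close>
  define h where "h m k = 1 / ((real m + 1) * (real k + 2))" for m k :: nat
  \<comment> \<open>Points of the shrunken set keep a fixed distance from the complement of G, and
    this survives the limit in k.\<close>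
  define G' where "G' m = {y. ball y (1 / (real m + 1)) \<subseteq> G}" for m :: nat
  have h: "0 < h m k" "h m k < 1 / (real m + 1)" for m k
  proof -
    have "1 / (real m + 1) * (1 / (real k + 2)) < 1 / (real m + 1) * 1"
      by (intro mult_strict_left_mono) auto
    then show "h m k < 1 / (real m + 1)" by (simp add: h_def)
  qed (simp add: h_def add_pos_pos)
  have "{x \<in> cadlag. x t \<in> G} = (\<Union>m. \<Inter>k. locally_in (t + h m k) (G' m))"
  proof (intro equalityI subsetI)
    fix x assume "x \<in> {x \<in> cadlag. x t \<in> G}"
    then have x: "x \<in> cadlag" "x t \<in> G" by auto
    \<comment> \<open>Three radii are spent: the motion of x after t, the ball demanded by
      \<open>locally_in\<close>, and the shrinking of G to \<open>G' m\<close>.\<close>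
    obtain r where r: "r > 0" "ball (x t) (3 * r) \<subseteq> G"
    proof -
      obtain r where "r > 0" "ball (x t) r \<subseteq> G" using G x(2) open_contains_ball by blast
      then show thesis by (intro that[of "r / 3"]) auto
    qed
    have "(x \<longlongrightarrow> x t) (at_right t)" using x(1) t unfolding cadlag_def by auto
    then have "\<forall>\<^sub>F s in at_right t. dist (x s) (x t) < r" using r(1) by (rule tendstoD)
    then obtain d where d: "d > t" "\<And>s. t < s \<Longrightarrow> s < d \<Longrightarrow> dist (x s) (x t) < r"
      unfolding eventually_at_right_field by blast
    obtain m where m: "1 / (real m + 1) < min (d - t) r"
      using reals_Archimedean[of "min (d - t) r"] d(1) r(1) by (auto simp: inverse_eq_divide add.commute)
    have "x \<in> locally_in (t + h m k) (G' m)" for k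
    proof -
      have hk: "0 < h m k" "h m k < 1 / (real m + 1)" by (rule h)+
      have "ball (x s) r \<subseteq> G' m" if s: "s \<in> {t..(t + h m k + t + 1 / (real m + 1)) / 2}" for s
      proof -
        have "h m k < d - t" "1 / (real m + 1) < d - t" using hk m by linarith+
        with s have "s < d" by simp
        then have sx: "dist (x s) (x t) < r" using d(2)[of s] s r(1) by (cases "s = t") auto
        show ?thesis
        proof
          fix y assume y: "y \<in> ball (x s) r"
          have "ball y (1 / (real m + 1)) \<subseteq> ball (x t) (3 * r)"
          proof
            fix w assume "w \<in> ball y (1 / (real m + 1))"
            then have "dist y w < r" using m by auto
            then show "w \<in> ball (x t) (3 * r)"
              using y sx dist_triangle[of "x t" w "x s"] dist_triangle[of "x s" w y] by (simp add: dist_commute)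
          qed
          then show "y \<in> G' m" using r(2) by (auto simp: G'_def)
        qed
      qed
      then show ?thesis unfolding locally_in_def using x(1) hk r(1)
        by (intro CollectI conjI exI[of _ t] exI[of _ "(t + h m k + t + 1 / (real m + 1)) / 2"] exI[of _ r]) auto
    qed
    then show "x \<in> (\<Union>m. \<Inter>k. locally_in (t + h m k) (G' m))" by blast
  next
    fix x :: "real \<Rightarrow> 'a" assume "x \<in> (\<Union>m. \<Inter>k. locally_in (t + h m k) (G' m))"
    then obtain m where m: "\<And>k. x \<in> locally_in (t + h m k) (G' m)" by blast
    then have x: "x \<in> cadlag" by (auto simp: locally_in_def)
    have "(\<lambda>k. 1 / (real m + 1) * (1 / (real k + 2))) \<longlonglongrightarrow> 1 / (real m + 1) * 0"
      by (intro tendsto_mult_left) real_asymp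
    then have lim0: "(\<lambda>k. t + h m k) \<longlonglongrightarrow> t + 0"
      by (intro tendsto_add tendsto_const) (simp add: h_def)
    have "filterlim (\<lambda>k. t + h m k) (at_right t) sequentially"
      using lim0 h(1)[of m] by (intro tendsto_imp_filterlim_at_right) auto
    moreover have "(x \<longlongrightarrow> x t) (at_right t)" using x t unfolding cadlag_def by auto
    ultimately have lim: "(\<lambda>k. x (t + h m k)) \<longlonglongrightarrow> x t" by (rule filterlim_compose[rotated])
    have "ball (x t) (1 / (real m + 1)) \<subseteq> G"
    proof
      fix w assume w: "w \<in> ball (x t) (1 / (real m + 1))"
      show "w \<in> G"
      proof (rule ccontr)
        assume "w \<notin> G"
        have far: "1 / (real m + 1) \<le> dist (x (t + h m k)) w" for k
        proof -
          have "x (t + h m k) \<in> G' m" using locally_in_eval[OF m] h(1)[of m k] t by simp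
          then have "w \<notin> ball (x (t + h m k)) (1 / (real m + 1))"
            using \<open>w \<notin> G\<close> unfolding G'_def by blast
          then show ?thesis by simp
        qed
        then have "1 / (real m + 1) \<le> dist (x t) w"
          by (intro tendsto_lowerbound[OF tendsto_dist[OF lim tendsto_const]] always_eventually allI far) simp
        with w show False by simp
      qed
    qed
    then have "x t \<in> G" by (rule subsetD) simp
    then show "x \<in> {x \<in> cadlag. x t \<in> G}" using x by simp
  qed
  also have "\<dots> \<in> sets (borel_of skorokhod)"
    by (intro sets.countable_UN sets.countable_INT) (auto intro: openin_borel_of openin_locally_in)
  finally have "{x \<in> cadlag. x t \<in> G} \<in> sets (borel_of skorokhod)" .
  moreover have "(\<lambda>x :: real \<Rightarrow> 'a. x t) -` G \<inter> space (borel_of skorokhod) = {x \<in> cadlag. x t \<in> G}"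
    by (auto simp: space_borel_of topspace_skorokhod)
  ultimately show "(\<lambda>x :: real \<Rightarrow> 'a. x t) -` G \<inter> space (borel_of skorokhod) \<in> sets (borel_of skorokhod)"
    by simp
qed

section \<open>Comparison of large deviation bounds\<close>

lemma elog_mono: "p \<le> q \<Longrightarrow> elog p \<le> elog q"
  unfolding elog_def by auto

text \<open>The lower bound on the open set and the upper bound on the closed set give that the
  infimum of J over C is at most \<open>I x\<close>. This infimum need not be attained; the strict
  level c still produces a point.\<close>

lemma LDP_transfer:
  assumes M: "LDP T M I" and N: "LDP U N J" and G: "openin T G" and C: "closedin U C"
    and le: "\<And>n. measure (M n) G \<le> measure (N n) C" and x: "x \<in> G" "I x < c"
  obtains y where "y \<in> C" "J y < c"
proof -
  have "- I x \<le> - (INF x\<in>G. I x)" using x by (simp add: INF_lower)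
  also have "\<dots> \<le> liminf (\<lambda>n. ereal (1 / real n) * elog (measure (M n) G))"
    using M G unfolding LDP_def by blast
  also have "\<dots> \<le> limsup (\<lambda>n. ereal (1 / real n) * elog (measure (M n) G))"
    by (rule Liminf_le_Limsup) simp
  also have "\<dots> \<le> limsup (\<lambda>n. ereal (1 / real n) * elog (measure (N n) C))"
    by (intro Limsup_mono always_eventually allI ereal_mult_left_mono elog_mono le) simp
  also have "\<dots> \<le> - (INF y\<in>C. J y)" using N C unfolding LDP_def by blast
  finally have "(INF y\<in>C. J y) \<le> I x" by simp
  then have "(INF y\<in>C. J y) < c" using x(2) by (rule le_less_trans)
  then show thesis using that by (auto simp: INF_less_iff)
qed

text \<open>Transfer from small open balls to closed balls puts points of a sublevel set of one rate
  arbitrarily near x, and sublevel sets are closed. The lemma identifies the unnamed initial rate in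
  \<open>LDP_lagrangian\<close>.\<close>

lemma LDP_rate_unique:
  fixes M :: "nat \<Rightarrow> 'a::metric_space measure"
  assumes I: "LDP euclidean M I" and J: "LDP euclidean M J"
  shows "I = J"
proof -
  have le: "J x \<le> I x" if I: "LDP euclidean M I" and J: "LDP euclidean M J" for I J and x :: 'a
  proof (rule dense_ge)
    fix c assume c: "I x < c"
    have "closed {x. J x \<le> c}" using J unfolding LDP_def rate_function_def by auto
    moreover have "\<exists>y\<in>{x. J x \<le> c}. dist y x < e" if e: "e > 0" for e
    proof -
      have "measure (M n) (ball x (e / 2)) \<le> measure (M n) (cball x (e / 2))" for n
      proof -
        have "prob_space (M n)" and "sets (M n) = sets borel"
          using I unfolding LDP_def borel_of_euclidean by auto
        then show ?thesis
          by (intro finite_measure.finite_measure_mono prob_space.finite_measure) auto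
      qed
      then obtain y where "y \<in> cball x (e / 2)" "J y < c"
        using LDP_transfer[OF I J, of "ball x (e / 2)" "cball x (e / 2)" x c] c e by auto
      then show ?thesis using e by (intro bexI[of _ y]) (auto simp: dist_commute)
    qed
    ultimately show "J x \<le> c" by (metis closed_approachable mem_Collect_eq)
  qed
  show ?thesis using le[OF I J] le[OF J I] by (intro ext antisym)
qed

section \<open>Paths of finite rate and their transfer\<close>

lemma has_velocityD:
  assumes "has_velocity \<gamma> g" "0 \<le> T"
  shows "set_integrable lborel {0..T} g" "\<gamma> T = \<gamma> 0 + (LINT s:{0..T}|lborel. g s)"
  using assms unfolding has_velocity_def by blast+

lemma has_velocity_continuous:
  assumes "has_velocity \<gamma> g" shows "continuous_on {0..} \<gamma>"
proof -
  have T: "continuous_on {0..T} \<gamma>" if "T \<ge> 0" for T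
  proof -
    have int: "set_integrable lborel {0..T} g" using assms that by (rule has_velocityD)
    have eq: "\<gamma> t = \<gamma> 0 + integral {0..t} g" if "t \<in> {0..T}" for t
      using has_velocityD[OF assms, of t] set_borel_integral_eq_integral(2)[of "{0..t}" g] that by simp
    have "continuous_on {0..T} (\<lambda>t. \<gamma> 0 + integral {0..t} g)"
      using set_borel_integral_eq_integral(1)[OF int]
      by (intro continuous_intros indefinite_integral_continuous_1)
    then show ?thesis by (rule continuous_on_eq) (rule eq[symmetric])
  qed
  show ?thesis unfolding continuous_on_eq_continuous_within
  proof
    fix t :: real assume t: "t \<in> {0..}"
    have "continuous (at t within {0..t + 1}) \<gamma>"
      using T[of "t + 1"] t by (auto simp: continuous_on_eq_continuous_within)
    moreover have "at t within {0..} = at t within {0..t + 1}"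
      by (rule at_within_nhd[of _ "{..<t + 1}"]) auto
    ultimately show "continuous (at t within {0..}) \<gamma>" by simp
  qed
qed

lemma lagrangian_rate_finite_continuous:
  assumes "lagrangian_rate I0 L \<gamma> < \<infinity>" shows "continuous_on {0..} \<gamma>"
  using assms has_velocity_continuous unfolding lagrangian_rate_def abs_cont_def by (auto split: if_splits)

lemma LDP_paths:
  assumes "LDP skorokhod Q I"
  shows "prob_space (Q n)" "sets (Q n) = sets (borel_of skorokhod)" "space (Q n) = cadlag"
  using assms sets_eq_imp_space_eq[of "Q n" "borel_of skorokhod"]
  unfolding LDP_def by (auto simp: space_borel_of topspace_skorokhod)

lemma closedin_not_locally_in: "closedin skorokhod (cadlag - locally_in s G)"
  using openin_closedin_eq[of skorokhod "locally_in s G"] openin_locally_in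
  by (auto simp: topspace_skorokhod)

text \<open>Robust membership gives an open set inside the first event and a closed set around the
  second, so \<open>LDP_transfer\<close> applies. Paths of finite rate are continuous, and for these
  the modified conditions coincide with the conditions on values.\<close>

lemma path_transfer:
  fixes Q :: "nat \<Rightarrow> (real \<Rightarrow> 'a::euclidean_space) measure"
  assumes Q: "LDP skorokhod Q (lagrangian_rate I0 L)"
    and times: "0 \<le> s" "0 \<le> t" "0 \<le> s'" "0 \<le> t'"
    and sets: "open B" "open C" "closed B'" "closed C'"
    and le: "\<And>n. measure (Q n) {\<gamma>\<in>space (Q n). \<gamma> s \<in> B \<and> \<gamma> t \<in> C} \<le> measure (Q n) {\<gamma>\<in>space (Q n). \<gamma> s' \<in> B' \<and> \<gamma> t' \<in> C'}"
    and \<gamma>: "\<gamma> \<in> cadlag" "\<gamma> s \<in> B" "\<gamma> t \<in> C" "lagrangian_rate I0 L \<gamma> < c"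
  obtains \<eta> where "\<eta> \<in> cadlag" "\<eta> s' \<in> B'" "\<eta> t' \<in> C'" "lagrangian_rate I0 L \<eta> < c"
proof -
  note Qn = LDP_paths[OF Q]
  let ?G = "locally_in s B \<inter> locally_in t C"
  \<comment> \<open>Paths that do not robustly avoid \<open>B'\<close> at \<open>s'\<close> or
    \<open>C'\<close> at \<open>t'\<close>: a closed set that contains the event.\<close>
  let ?C = "(cadlag - locally_in s' (- B')) \<inter> (cadlag - locally_in t' (- C'))"
  have ev: "(\<lambda>\<gamma>. \<gamma> u) \<in> Q n \<rightarrow>\<^sub>M borel" if "0 \<le> u" for u n
    using eval_measurable[OF that] measurable_cong_sets[OF Qn(2) HOL.refl] by blast
  have G: "openin skorokhod ?G" and C: "closedin skorokhod ?C"
    by (auto intro!: openin_Int closedin_Int openin_locally_in closedin_not_locally_in)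
  have leGC: "measure (Q n) ?G \<le> measure (Q n) ?C" for n
  proof -
    interpret prob_space "Q n" by (rule Qn)
    have [measurable]: "B \<in> sets borel" "C \<in> sets borel" "B' \<in> sets borel" "C' \<in> sets borel"
      using sets by auto
    note [measurable] = ev[OF times(1)] ev[OF times(2)] ev[OF times(3)] ev[OF times(4)]
    have "measure (Q n) ?G \<le> measure (Q n) {\<gamma>\<in>space (Q n). \<gamma> s \<in> B \<and> \<gamma> t \<in> C}"
    proof (rule finite_measure_mono)
      show "?G \<subseteq> {\<gamma>\<in>space (Q n). \<gamma> s \<in> B \<and> \<gamma> t \<in> C}"
        using locally_in_eval[OF _ times(1)] locally_in_eval[OF _ times(2)] locally_in_cadlag Qn(3) by blast
    qed measurable
    also have "\<dots> \<le> measure (Q n) {\<gamma>\<in>space (Q n). \<gamma> s' \<in> B' \<and> \<gamma> t' \<in> C'}" by (rule le)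
    also have "\<dots> \<le> measure (Q n) ?C"
    proof (rule finite_measure_mono)
      show "{\<gamma>\<in>space (Q n). \<gamma> s' \<in> B' \<and> \<gamma> t' \<in> C'} \<subseteq> ?C"
        using locally_in_eval[OF _ times(3)] locally_in_eval[OF _ times(4)] Qn(3) by blast
      have "cadlag - ?C = locally_in s' (- B') \<union> locally_in t' (- C')" by (auto simp: locally_in_def)
      then have "?C = space (Q n) - (locally_in s' (- B') \<union> locally_in t' (- C'))"
        by (auto simp: Qn)
      moreover have "locally_in u G \<in> events" for u G
        using openin_borel_of[OF openin_locally_in] Qn(2) by blast
      ultimately show "?C \<in> events" by (simp only: sets.Diff sets.top sets.Un)
    qed
    finally show ?thesis .
  qed
  have fin: "lagrangian_rate I0 L \<eta> < \<infinity>" if "lagrangian_rate I0 L \<eta> < c" for \<eta>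
    using that by (rule less_le_trans) simp
  have "\<gamma> \<in> ?G"
    using \<gamma> lagrangian_rate_finite_continuous[OF fin[OF \<gamma>(4)]] times sets
    by (intro IntI continuous_locally_in)
  then obtain \<eta> where \<eta>: "\<eta> \<in> ?C" "lagrangian_rate I0 L \<eta> < c"
    using LDP_transfer[OF Q Q G C leGC] \<gamma>(4) by blast
  then have cont: "continuous_on {0..} \<eta>" using lagrangian_rate_finite_continuous fin by blast
  have "\<eta> s' \<in> B'" "\<eta> t' \<in> C'"
    using \<eta>(1) continuous_locally_in[OF _ cont, of "- B'" s'] continuous_locally_in[OF _ cont, of "- C'" t']
      times sets by (auto simp: open_Compl)
  then show thesis using \<eta> by (intro that[of \<eta>]) auto
qed

text \<open>Compares the initial laws with the path laws. The lower bound needs an open ball around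
  z, so the path starts near z and not at z.\<close>

lemma cheap_path_near:
  fixes Q :: "nat \<Rightarrow> (real \<Rightarrow> 'a::euclidean_space) measure"
  assumes Q: "LDP skorokhod Q (lagrangian_rate I0 L)"
    and init: "LDP euclidean (\<lambda>n. initial_law (Q n)) I" and z: "I z < c" and r: "r > 0"
  obtains \<gamma> where "\<gamma> \<in> cadlag" "dist (\<gamma> 0) z \<le> r" "lagrangian_rate I0 L \<gamma> < c"
proof -
  note Qn = LDP_paths[OF Q]
  let ?C = "cadlag - locally_in 0 (- cball z r)"
  have le: "measure (initial_law (Q n)) (ball z r) \<le> measure (Q n) ?C" for n
  proof -
    interpret prob_space "Q n" by (rule Qn)
    have ev[measurable]: "(\<lambda>\<gamma>. \<gamma> 0) \<in> Q n \<rightarrow>\<^sub>M borel"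
      using eval_measurable[of 0] measurable_cong_sets[OF Qn(2) HOL.refl] by blast
    have "measure (initial_law (Q n)) (ball z r) = measure (Q n) ((\<lambda>\<gamma>. \<gamma> 0) -` ball z r \<inter> space (Q n))"
      unfolding initial_law_def by (rule measure_distr) auto
    also have "\<dots> \<le> measure (Q n) ?C"
    proof (rule finite_measure_mono)
      show "(\<lambda>\<gamma>. \<gamma> 0) -` ball z r \<inter> space (Q n) \<subseteq> ?C"
      proof
        fix \<gamma> assume "\<gamma> \<in> (\<lambda>\<gamma>. \<gamma> 0) -` ball z r \<inter> space (Q n)"
        then show "\<gamma> \<in> ?C" using locally_in_eval[of \<gamma> 0 "- cball z r"] Qn(3)[of n] by auto
      qed
      have "locally_in 0 (- cball z r) \<in> events"
        using openin_borel_of[OF openin_locally_in] Qn(2) by blast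
      then show "?C \<in> events" unfolding Qn(3)[of n, symmetric] by (rule sets.compl_sets)
    qed
    finally show ?thesis .
  qed
  obtain \<gamma> where \<gamma>: "\<gamma> \<in> ?C" "lagrangian_rate I0 L \<gamma> < c"
    using LDP_transfer[OF init Q _ closedin_not_locally_in le, of z c] z r by auto
  have "lagrangian_rate I0 L \<gamma> < \<infinity>" using \<gamma>(2) by (auto intro: less_le_trans)
  then have "continuous_on {0..} \<gamma>" by (rule lagrangian_rate_finite_continuous)
  then have "\<gamma> 0 \<in> cball z r" using \<gamma>(1) continuous_locally_in[of \<gamma> "- cball z r" 0] by (auto simp: open_Compl)
  then show thesis using \<gamma> by (intro that[of \<gamma>]) (auto simp: dist_commute)
qed

section \<open>Stationary and reversible laws on path space\<close>

context generated_semigroup begin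

lemma
  assumes Q: "markov_law P Q"
  shows prob_markov_law: "prob_space Q"
    and space_markov_law: "space Q = cadlag"
    and eval_markov_law: "0 \<le> t \<Longrightarrow> (\<lambda>\<gamma>. \<gamma> t) \<in> Q \<rightarrow>\<^sub>M borel"
proof -
  show "prob_space Q" using Q unfolding markov_law_def by simp
  have sets: "sets Q = sets (borel_of skorokhod)" using Q unfolding markov_law_def by simp
  show "space Q = cadlag" using sets_eq_imp_space_eq[OF sets] by (simp add: space_borel_of topspace_skorokhod)
  show "(\<lambda>\<gamma>. \<gamma> t) \<in> Q \<rightarrow>\<^sub>M borel" if "0 \<le> t"
    using eval_measurable[OF that] measurable_cong_sets[OF sets HOL.refl] by blast
qed

text \<open>Condition on the past at time 0: \<open>f (\<gamma> 0)\<close> is measurable there and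
  leaves the conditional expectation, which the Markov property evaluates to
  \<open>semigroup P t g (\<gamma> 0)\<close>.\<close>

lemma markov_pair_expectation:
  assumes Q: "markov_law P Q" and f: "f \<in> bounded_borel" and g: "g \<in> bounded_borel" and t: "0 \<le> t"
    and sg: "semigroup P t g \<in> borel_measurable borel"
  shows "(\<integral>\<gamma>. f (\<gamma> 0) * g (\<gamma> t) \<partial>Q) = (\<integral>x. f x * semigroup P t g x \<partial>initial_law Q)"
proof -
  interpret prob_space Q by (rule prob_markov_law[OF Q])
  note space = space_markov_law[OF Q] and ev = eval_markov_law[OF Q]
  have [measurable]: "f \<in> borel_measurable borel" "g \<in> borel_measurable borel"
    using f g by (auto dest: bounded_borelD)
  note [measurable] = sg
  \<comment> \<open>The constraints force \<open>s = 0\<close>, so \<open>past 0\<close> is the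
    sigma-algebra of the initial value.\<close>
  let ?gen = "{{\<gamma> \<in> cadlag. \<gamma> s \<in> B} | s B. 0 \<le> s \<and> s \<le> 0 \<and> B \<in> sets borel} :: (real \<Rightarrow> 'a) set set"
  have past: "space (past 0) = cadlag" "sets (past 0) = sigma_sets cadlag ?gen"
    unfolding past_def by (auto intro!: space_measure_of sets_measure_of)
  have sub: "subalgebra Q (past 0)"
    unfolding subalgebra_def
  proof
    show "space (past 0) = space Q" using past space by simp
    have "?gen \<subseteq> sets Q"
    proof
      fix A assume "A \<in> ?gen"
      then obtain s B where sB: "A = {\<gamma> \<in> cadlag. \<gamma> s \<in> B} \<and> 0 \<le> s \<and> s \<le> 0 \<and> B \<in> sets borel"
        unfolding mem_Collect_eq by (elim exE) (rule that)
      then have s: "s = 0" by (intro order_antisym) simp_all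
      have B: "B \<in> sets borel" and A: "A = {\<gamma> \<in> cadlag. \<gamma> 0 \<in> B}"
        using sB unfolding s by simp_all
      have "A = (\<lambda>\<gamma>. \<gamma> 0) -` B \<inter> space Q" unfolding A space by auto
      then show "A \<in> sets Q" using measurable_sets[OF ev[OF order_refl] B] by simp
    qed
    then show "sets (past 0) \<subseteq> sets Q"
      unfolding past using sets.sigma_sets_subset[of ?gen Q] unfolding space by blast
  qed
  interpret finite_measure_subalgebra Q "past 0"
    by (intro finite_measure_subalgebra.intro finite_measure_subalgebra_axioms.intro sub finite_measure_axioms)
  have ev0: "(\<lambda>\<gamma>. \<gamma> 0) \<in> (past 0 :: (real \<Rightarrow> 'a) measure) \<rightarrow>\<^sub>M borel"
  proof (rule measurableI)
    fix B :: "'a set" assume "B \<in> sets borel"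
    then have "{\<gamma> \<in> cadlag. \<gamma> 0 \<in> B} \<in> ?gen" by blast
    moreover have "(\<lambda>\<gamma>. \<gamma> 0) -` B \<inter> space (past 0) = {\<gamma> \<in> cadlag. \<gamma> 0 \<in> B}" unfolding past by auto
    ultimately show "(\<lambda>\<gamma>. \<gamma> 0) -` B \<inter> space (past 0) \<in> sets (past 0)" unfolding past by auto
  qed simp
  have f0: "(\<lambda>\<gamma>. f (\<gamma> 0)) \<in> borel_measurable (past 0)" by (rule measurable_compose[OF ev0]) measurable
  obtain M N where M: "\<And>x. \<bar>f x\<bar> \<le> M" and N: "\<And>x. \<bar>g x\<bar> \<le> N" using f g by (metis bounded_borelD(2))
  have "\<bar>f x * g y\<bar> \<le> M * N" for x y
    unfolding abs_mult using M N by (intro mult_mono) (auto intro: order_trans[OF abs_ge_zero])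
  note bound = this
  have ev0Q: "(\<lambda>\<gamma>. \<gamma> 0) \<in> Q \<rightarrow>\<^sub>M borel" using ev[of 0] by simp
  have meas: "(\<lambda>\<gamma>. f (\<gamma> 0)) \<in> borel_measurable Q" "(\<lambda>\<gamma>. g (\<gamma> t)) \<in> borel_measurable Q"
      "(\<lambda>\<gamma>. semigroup P t g (\<gamma> 0)) \<in> borel_measurable Q"
    by (rule measurable_compose[OF ev0Q bounded_borelD(1)[OF f]] measurable_compose[OF ev[OF t] bounded_borelD(1)[OF g]]
        measurable_compose[OF ev0Q sg])+
  have int: "integrable Q (\<lambda>\<gamma>. f (\<gamma> 0) * g (\<gamma> t))"
    using bound by (intro integrable_const_bound[where B="M * N"] borel_measurable_times meas) auto
  have "AE \<gamma> in Q. real_cond_exp Q (past 0) (\<lambda>\<gamma>. g (\<gamma> (0 + t))) \<gamma> = semigroup P t g (\<gamma> 0)"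
    using Q t g unfolding markov_law_def by blast
  then have AE: "AE \<gamma> in Q. f (\<gamma> 0) * real_cond_exp Q (past 0) (\<lambda>\<gamma>. g (\<gamma> t)) \<gamma> = f (\<gamma> 0) * semigroup P t g (\<gamma> 0)"
    by auto
  have "(\<integral>\<gamma>. f (\<gamma> 0) * g (\<gamma> t) \<partial>Q) = (\<integral>\<gamma>. f (\<gamma> 0) * real_cond_exp Q (past 0) (\<lambda>\<gamma>. g (\<gamma> t)) \<gamma> \<partial>Q)"
    by (rule real_cond_exp_intg(2)[OF int f0 meas(2), symmetric])
  also have "\<dots> = (\<integral>\<gamma>. f (\<gamma> 0) * semigroup P t g (\<gamma> 0) \<partial>Q)"
    using AE by (intro integral_cong_AE borel_measurable_times meas borel_measurable_cond_exp2)
  also have "\<dots> = (\<integral>x. f x * semigroup P t g x \<partial>initial_law Q)"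
    unfolding initial_law_def by (intro integral_distr[OF ev0Q, symmetric]) measurable
  finally show ?thesis .
qed

lemma pair_expectation_L:
  assumes Q: "markov_law P Q" and f: "f \<in> bounded_borel" and g: "g \<in> L" and t: "0 \<le> t"
  shows "(\<integral>\<gamma>. f (\<gamma> 0) * g (\<gamma> t) \<partial>Q) = (\<integral>x. f x * semigroup P t g x \<partial>initial_law Q)"
  by (rule markov_pair_expectation[OF Q f L_bounded_borel[OF g] t
        bounded_borelD(1)[OF L_bounded_borel[OF semigroup_L[OF t g]]]])

lemma stationary_expectation:
  assumes Q: "markov_law P Q" and inv: "invariant_measure A (initial_law Q)" and g: "g \<in> L" and t: "0 \<le> t"
  shows "(\<integral>\<gamma>. g (\<gamma> t) \<partial>Q) = (\<integral>\<gamma>. g (\<gamma> 0) \<partial>Q)"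
proof -
  have one: "(\<lambda>x. 1) \<in> bounded_borel" by (intro bounded_borelI[where M=1]) auto
  have "(\<integral>\<gamma>. g (\<gamma> s) \<partial>Q) = (\<integral>x. g x \<partial>initial_law Q)" if s: "0 \<le> s" for s
    using pair_expectation_L[OF Q one g s] stationary[OF inv g s] by simp
  then show ?thesis using t by simp
qed

lemma stationary_marginals:
  assumes Q: "markov_law P Q" and inv: "invariant_measure A (initial_law Q)" and t: "0 \<le> t"
    and B: "B \<in> sets borel"
  shows "measure Q {\<gamma>\<in>space Q. \<gamma> t \<in> B} = measure Q {\<gamma>\<in>space Q. \<gamma> 0 \<in> B}"
proof -
  have ev: "(\<lambda>\<gamma>. \<gamma> t) \<in> Q \<rightarrow>\<^sub>M borel" "(\<lambda>\<gamma>. \<gamma> 0) \<in> Q \<rightarrow>\<^sub>M borel"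
    using eval_markov_law[OF Q] t by auto
  have "(\<integral>\<gamma>. 1 * indicator B (\<gamma> t) \<partial>Q) = (\<integral>\<gamma>. 1 * (indicator B (\<gamma> 0) :: real) \<partial>Q)"
    by (rule weighted_law_determining[OF prob_markov_law[OF Q] ev, where K=1 and ?w1.0="\<lambda>_. 1" and ?w2.0="\<lambda>_. 1"])
      (use B stationary_expectation[OF Q inv _ t] in auto)
  moreover have "(\<integral>\<gamma>. 1 * (indicator B (\<gamma> s) :: real) \<partial>Q) = measure Q {\<gamma>\<in>space Q. \<gamma> s \<in> B}" for s
  proof -
    have "(\<integral>\<gamma>. 1 * (indicator B (\<gamma> s) :: real) \<partial>Q) = (\<integral>\<gamma>. indicator {\<gamma>\<in>space Q. \<gamma> s \<in> B} \<gamma> \<partial>Q)"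
      by (intro Bochner_Integration.integral_cong) (auto simp: indicator_def)
    moreover have "{\<gamma>\<in>space Q. \<gamma> s \<in> B} \<inter> space Q = {\<gamma>\<in>space Q. \<gamma> s \<in> B}" by auto
    ultimately show ?thesis by simp
  qed
  ultimately show ?thesis by simp
qed

lemma reversible_exchangeable:
  assumes Q: "markov_law P Q" and inv: "invariant_measure A (initial_law Q)"
    and rev: "reversible_measure A (initial_law Q)" and t: "0 \<le> t"
    and B: "B \<in> sets borel" and C: "C \<in> sets borel"
  shows "measure Q {\<gamma>\<in>space Q. \<gamma> 0 \<in> B \<and> \<gamma> t \<in> C} = measure Q {\<gamma>\<in>space Q. \<gamma> t \<in> B \<and> \<gamma> 0 \<in> C}"
proof (rule exchangeable_pair[OF prob_markov_law[OF Q] _ _ _ _ B C])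
  fix f g assume f: "f \<in> L" and g: "g \<in> L"
  have "(\<integral>\<gamma>. f (\<gamma> 0) * g (\<gamma> t) \<partial>Q) = (\<integral>\<gamma>. g (\<gamma> 0) * f (\<gamma> t) \<partial>Q)"
    unfolding pair_expectation_L[OF Q L_bounded_borel[OF f] g t] pair_expectation_L[OF Q L_bounded_borel[OF g] f t]
    using reversible_symmetric[OF rev f g t] by (simp add: mult.commute)
  then show "(\<integral>\<gamma>. f (\<gamma> 0) * g (\<gamma> t) \<partial>Q) = (\<integral>\<gamma>. f (\<gamma> t) * g (\<gamma> 0) \<partial>Q)" by (simp add: mult.commute)
qed (use eval_markov_law[OF Q] t stationary_expectation[OF Q inv _ t] in auto)

end

section \<open>Lipschitz paths and differential inclusions\<close>

text \<open>The difference D of the distribution functions is nondecreasing and right continuous,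
  and its Stieltjes measure is the excess of N over M: the sum \<open>?S\<close> agrees with N on
  half-open intervals, hence everywhere.\<close>

lemma measure_le_of_Ioc:
  fixes M N :: "real measure"
  assumes M: "finite_measure M" "sets M = sets borel" and N: "finite_measure N" "sets N = sets borel"
    and le: "\<And>a b. a < b \<Longrightarrow> measure M {a<..b} \<le> measure N {a<..b}"
    and A: "A \<in> sets borel"
  shows "emeasure M A \<le> emeasure N A"
proof -
  interpret M: finite_borel_measure M by (intro finite_borel_measure.intro finite_borel_measure_axioms.intro M)
  interpret N: finite_borel_measure N by (intro finite_borel_measure.intro finite_borel_measure_axioms.intro N)
  define D where "D x = cdf N x - cdf M x" for x
  have incr: "D b - D a = measure N {a<..b} - measure M {a<..b}" if "a < b" for a b
    using M.cdf_diff_eq[OF that] N.cdf_diff_eq[OF that] by (simp add: D_def)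
  have mono: "D a \<le> D b" if "a \<le> b" for a b
    using incr[of a b] le[of a b] that by (cases "a = b") auto
  have cont: "continuous (at_right a) D" for a
    unfolding D_def by (intro continuous_intros M.cdf_is_right_cont N.cdf_is_right_cont)
  let ?K = "interval_measure D"
  let ?S = "measure_of UNIV (sets borel) (\<lambda>A. emeasure ?K A + emeasure M A)"
  have S: "emeasure ?S B = emeasure ?K B + emeasure M B" if "B \<in> sets borel" for B
  proof (rule emeasure_measure_of_sigma[OF _ _ _ that])
    show "sigma_algebra UNIV (sets borel :: real set set)" using sets.sigma_algebra_axioms[of borel] by simp
    show "countably_additive (sets borel) (\<lambda>A. emeasure ?K A + emeasure M A)"
    proof (rule countably_additiveI)
      fix F :: "nat \<Rightarrow> real set" assume F: "range F \<subseteq> sets borel" "disjoint_family F"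
      then have "(\<Sum>i. emeasure ?K (F i) + emeasure M (F i)) = (\<Sum>i. emeasure ?K (F i)) + (\<Sum>i. emeasure M (F i))"
        by (intro suminf_add[symmetric]) auto
      also have "\<dots> = emeasure ?K (\<Union>i. F i) + emeasure M (\<Union>i. F i)"
        using F M(2) by (subst (1 2) suminf_emeasure) auto
      finally show "(\<Sum>i. emeasure ?K (F i) + emeasure M (F i)) = emeasure ?K (\<Union>i. F i) + emeasure M (\<Union>i. F i)" .
    qed
  qed (simp add: positive_def)
  have "?S = N"
  proof (rule measure_eqI_generator_eq[where E="range (\<lambda>(a, b). {a<..b})" and \<Omega>=UNIV
        and A="\<lambda>i. {- real i<..real i}"])
    show "Int_stable (range (\<lambda>(a, b). {a<..b::real}))" by (auto simp: Int_stable_def)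
    have "sets borel = sigma_sets UNIV (range (\<lambda>(a, b). {a<..b::real}))"
      by (simp add: borel_sigma_sets_Ioc)
    then show "sets ?S = sigma_sets UNIV (range (\<lambda>(a, b). {a<..b}))" "sets N = sigma_sets UNIV (range (\<lambda>(a, b). {a<..b}))"
      using N(2) sets.sigma_sets_eq[of "borel :: real measure"] by (simp_all add: sets_measure_of)
    show "(\<Union>i. {- real i<..real i}) = UNIV" by (rule UN_Ioc_eq_UNIV)
    show "range (\<lambda>i. {- real i<..real i}) \<subseteq> range (\<lambda>(a, b). {a<..b})" by auto
    show "emeasure ?S {- real i<..real i} \<noteq> \<infinity>" for i
      by (subst S) (simp_all add: emeasure_interval_measure_Ioc[OF _ mono cont] M.emeasure_eq_measure)
    fix X assume "X \<in> range (\<lambda>(a, b). {a<..b::real})"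
    then obtain a b where X: "X = {a<..b}" by auto
    show "emeasure ?S X = emeasure N X"
    proof (cases "a < b")
      case True
      have "emeasure ?S X = emeasure ?K X + emeasure M X" by (rule S) (simp add: X)
      also have "\<dots> = ennreal (D b - D a) + ennreal (measure M {a<..b})"
        using True X by (simp add: emeasure_interval_measure_Ioc[OF _ mono cont] M.emeasure_eq_measure)
      also have "\<dots> = ennreal (measure N {a<..b})"
        using le[OF True] by (simp add: incr[OF True] flip: ennreal_plus)
      finally show ?thesis by (simp add: X N.emeasure_eq_measure)
    qed (auto simp: X S)
  qed auto
  then have "emeasure N A = emeasure ?K A + emeasure M A" using S[OF A] by simp
  then show ?thesis by simp
qed

lemma density_integrable:
  fixes \<phi> :: "real \<Rightarrow> real"
  assumes \<phi>: "integrable lborel \<phi>" "\<And>x. 0 \<le> \<phi> x"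
  shows "finite_measure (density lborel (\<lambda>x. ennreal (\<phi> x)))"
    and "A \<in> sets borel \<Longrightarrow> measure (density lborel (\<lambda>x. ennreal (\<phi> x))) A = (LINT x:A|lborel. \<phi> x)"
proof -
  have [measurable]: "\<phi> \<in> borel_measurable borel" using \<phi>(1) by auto
  have e: "emeasure (density lborel (\<lambda>x. ennreal (\<phi> x))) A = ennreal (LINT x:A|lborel. \<phi> x)"
    if [measurable]: "A \<in> sets borel" for A
  proof -
    have "emeasure (density lborel (\<lambda>x. ennreal (\<phi> x))) A = (\<integral>\<^sup>+x. ennreal (indicator A x *\<^sub>R \<phi> x) \<partial>lborel)"
      by (subst emeasure_density) (auto intro!: nn_integral_cong simp: indicator_def)
    also have "\<dots> = ennreal (\<integral>x. indicator A x *\<^sub>R \<phi> x \<partial>lborel)"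
      using \<phi> by (intro nn_integral_eq_integral integrable_mult_indicator) auto
    finally show ?thesis by (simp add: set_lebesgue_integral_def)
  qed
  show "finite_measure (density lborel (\<lambda>x. ennreal (\<phi> x)))"
    using e[of UNIV] by (intro finite_measureI) simp
  show "measure (density lborel (\<lambda>x. ennreal (\<phi> x))) A = (LINT x:A|lborel. \<phi> x)" if "A \<in> sets borel"
    unfolding measure_def e[OF that] set_lebesgue_integral_def
    using \<phi>(2) by (intro enn2real_ennreal integral_nonneg) auto
qed

text \<open>Take the positive and the negative part as densities. The hypothesis puts the first
  measure below the second on intervals, hence also on \<open>{x. 0 < u x}\<close>, where the second
  vanishes.\<close>

lemma AE_nonpos_of_interval_integrals:
  fixes f :: "real \<Rightarrow> real"
  assumes f: "set_integrable lborel {a..b} f"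
    and le: "\<And>c d. a \<le> c \<Longrightarrow> c \<le> d \<Longrightarrow> d \<le> b \<Longrightarrow> (LINT x:{c..d}|lborel. f x) \<le> 0"
  shows "AE x in lborel. x \<in> {a..b} \<longrightarrow> f x \<le> 0"
proof -
  define u where "u x = indicator {a..b} x *\<^sub>R f x" for x
  have u: "integrable lborel u" using f unfolding set_integrable_def u_def .
  then have [measurable]: "u \<in> borel_measurable borel" by auto
  have pos: "integrable lborel (\<lambda>x. max 0 (u x))" and neg: "integrable lborel (\<lambda>x. max 0 (- u x))"
    using u by (auto intro!: integrable_max)
  let ?M = "density lborel (\<lambda>x. ennreal (max 0 (u x)))" and ?N = "density lborel (\<lambda>x. ennreal (max 0 (- u x)))"
  have "emeasure ?M {x. 0 < u x} \<le> emeasure ?N {x. 0 < u x}"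
  proof (rule measure_le_of_Ioc)
    show "finite_measure ?M" "finite_measure ?N" using density_integrable(1)[OF pos] density_integrable(1)[OF neg] by auto
    fix c d :: real assume cd: "c < d"
    have si: "set_integrable lborel {c<..d} (\<lambda>x. max 0 (u x))" "set_integrable lborel {c<..d} (\<lambda>x. max 0 (- u x))"
      unfolding set_integrable_def by (intro integrable_mult_indicator pos neg; simp)+
    have "measure ?M {c<..d} - measure ?N {c<..d} =
        (LINT x:{c<..d}|lborel. max 0 (u x)) - (LINT x:{c<..d}|lborel. max 0 (- u x))"
      using density_integrable(2)[OF pos, of "{c<..d}"] density_integrable(2)[OF neg, of "{c<..d}"] by simp
    also have "\<dots> = (LINT x:{c<..d}|lborel. max 0 (u x) - max 0 (- u x))"
      using si by (rule set_integral_diff(2)[symmetric])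
    also have "\<dots> = (LINT x:{c<..d}|lborel. u x)"
      by (intro set_lebesgue_integral_cong) (auto simp: max_def)
    also have "\<dots> = (LINT x:{max a c..min b d}|lborel. f x)"
      unfolding set_lebesgue_integral_def
    proof (rule integral_cong_AE)
      show "AE x in lborel. indicator {c<..d} x *\<^sub>R u x = indicator {max a c..min b d} x *\<^sub>R f x"
        using AE_lborel_singleton[of c] by eventually_elim (auto simp: u_def indicator_def)
      have "(\<lambda>x. indicator {max a c..min b d} x *\<^sub>R f x) = (\<lambda>x. indicator {max a c..min b d} x *\<^sub>R u x)"
        by (auto simp: u_def indicator_def fun_eq_iff)
      then show "(\<lambda>x. indicator {max a c..min b d} x *\<^sub>R f x) \<in> borel_measurable lborel" by simp
    qed simp
    also have "\<dots> \<le> 0"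
      using le[of "max a c" "min b d"] cd by (cases "max a c \<le> min b d") (auto simp: set_lebesgue_integral_def)
    finally show "measure ?M {c<..d} \<le> measure ?N {c<..d}" by simp
  qed auto
  also have "emeasure ?N {x. 0 < u x} = 0"
  proof -
    have "emeasure ?N {x. 0 < u x} = (\<integral>\<^sup>+x. ennreal (max 0 (- u x)) * indicator {x. 0 < u x} x \<partial>lborel)"
      by (rule emeasure_density) measurable
    also have "\<dots> = (\<integral>\<^sup>+(x::real). 0 \<partial>lborel)"
      by (intro nn_integral_cong) (auto simp: indicator_def ennreal_neg)
    finally show ?thesis by simp
  qed
  finally have "emeasure ?M {x. 0 < u x} = 0" by simp
  then have "{x. 0 < u x} \<in> null_sets ?M" by (intro null_setsI) auto
  then have "AE x in lborel. x \<in> {x. 0 < u x} \<longrightarrow> ennreal (max 0 (u x)) = 0"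
    by (subst (asm) null_sets_density_iff) auto
  then show ?thesis
    by eventually_elim (auto simp: u_def indicator_def split: if_splits)
qed

text \<open>Adding \<open>C * x\<close> makes F nondecreasing with slope at most
  \<open>2 * C\<close>, so the Stieltjes measure lies below that multiple of Lebesgue measure. The
  Radon-Nikodym density minus C is the derivative of F.\<close>

lemma lipschitz_real_integral:
  fixes F :: "real \<Rightarrow> real"
  assumes ab: "a \<le> b" and C: "0 \<le> C"
    and lip: "\<And>x y. x \<in> {a..b} \<Longrightarrow> y \<in> {a..b} \<Longrightarrow> \<bar>F y - F x\<bar> \<le> C * \<bar>y - x\<bar>"
  obtains g where "g \<in> borel_measurable borel" "set_integrable lborel {a..b} g"
    "\<And>x. x \<in> {a..b} \<Longrightarrow> F x = F a + (LINT s:{a..x}|lborel. g s)"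
proof -
  \<comment> \<open>Clamping extends the function to the whole line and confines its Stieltjes
    measure to \<open>{a..b}\<close>, which makes it finite.\<close>
  define cl where "cl x = max a (min b x)" for x
  define G where "G x = F (cl x) + C * cl x" for x
  have cl: "cl x \<in> {a..b}" for x using ab by (auto simp: cl_def)
  have cl_mono: "cl x \<le> cl y" if "x \<le> y" for x y using that by (auto simp: cl_def)
  have cl_lip: "\<bar>cl y - cl x\<bar> \<le> \<bar>y - x\<bar>" for x y by (auto simp: cl_def)
  have G_incr: "0 \<le> G y - G x" "G y - G x \<le> 2 * C * (cl y - cl x)" if "x \<le> y" for x y
    using lip[OF cl[of x] cl[of y]] cl_mono[OF that] by (auto simp: G_def algebra_simps abs_le_iff)
  have mono: "G x \<le> G y" if "x \<le> y" for x y using G_incr[OF that] by simp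
  have "\<bar>G y - G x\<bar> \<le> 2 * C * \<bar>y - x\<bar>" for x y
  proof -
    have "\<bar>G y - G x\<bar> \<le> 2 * C * \<bar>cl y - cl x\<bar>"
    proof (cases "x \<le> y")
      case True then show ?thesis using G_incr[OF True] cl_mono[OF True] by simp
    next
      case False
      then have "y \<le> x" by simp
      from G_incr[OF this] cl_mono[OF this] show ?thesis by (simp add: abs_minus_commute[of "G y"] abs_minus_commute[of "cl y"])
    qed
    also have "\<dots> \<le> 2 * C * \<bar>y - x\<bar>" using C cl_lip by (intro mult_left_mono) auto
    finally show ?thesis .
  qed
  then have "(2 * C)-lipschitz_on UNIV G" using C by (auto intro!: lipschitz_onI simp: dist_real_def)
  then have "continuous_on UNIV G" by (rule lipschitz_on_continuous_on)
  then have cont: "continuous (at_right x) G" for x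
    by (auto simp: continuous_on_eq_continuous_within intro: continuous_within_subset)
  let ?M = "interval_measure G" and ?\<phi> = "\<lambda>x. 2 * C * indicator {a..b} x"
  let ?N = "density lborel (\<lambda>x. ennreal (?\<phi> x))"
  have \<phi>: "integrable lborel ?\<phi>" by (intro integrable_mult_right integrable_real_indicator) (auto simp: emeasure_lborel_Icc_eq)
  have Ioc: "emeasure ?M {x<..y} = ennreal (G y - G x)" if "x \<le> y" for x y
    by (rule emeasure_interval_measure_Ioc[OF that mono cont])
  have fin: "emeasure ?M UNIV \<noteq> \<infinity>"
  proof -
    have "emeasure ?M UNIV = (SUP i. emeasure ?M {- real i<..real i})"
      unfolding UN_Ioc_eq_UNIV[symmetric] by (rule SUP_emeasure_incseq[symmetric]) (auto simp: incseq_def)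
    also have "\<dots> \<le> ennreal (2 * C * (b - a))"
    proof (rule SUP_least)
      fix i
      have "G (real i) - G (- real i) \<le> 2 * C * (b - a)"
        using C cl[of "real i"] cl[of "- real i"]
        by (intro order_trans[OF G_incr(2)] mult_left_mono) auto
      then show "emeasure ?M {- real i<..real i} \<le> ennreal (2 * C * (b - a))"
        by (subst Ioc) (auto intro: ennreal_leI)
    qed
    also have "\<dots> < \<infinity>" by simp
    finally show ?thesis by simp
  qed
  have finM: "finite_measure ?M" by (rule finite_measureI) (use fin in simp)
  have le: "emeasure ?M A \<le> emeasure ?N A" if "A \<in> sets borel" for A
  proof (rule measure_le_of_Ioc[OF finM _ _ _ _ that])
    show "finite_measure ?N" using C by (intro density_integrable(1) \<phi>) auto
    fix x y :: real assume xy: "x < y"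
    have "measure ?N {x<..y} = (LINT s:{x<..y}|lborel. ?\<phi> s)"
      using C by (intro density_integrable(2) \<phi>) auto
    also have "\<dots> = (\<integral>s. 2 * C * indicator {cl x..cl y} s \<partial>lborel)"
      unfolding set_lebesgue_integral_def
    proof (rule integral_cong_AE)
      show "AE s in lborel. indicator {x<..y} s *\<^sub>R ?\<phi> s = 2 * C * indicator {cl x..cl y} s"
        using AE_lborel_singleton[of x] AE_lborel_singleton[of a] AE_lborel_singleton[of b]
        by eventually_elim (auto simp: indicator_def cl_def)
    qed auto
    also have "\<dots> = 2 * C * (cl y - cl x)" using cl_mono[of x y] xy by simp
    finally show "measure ?M {x<..y} \<le> measure ?N {x<..y}"
      using G_incr[of x y] xy Ioc[of x y] by (simp add: measure_def)
  qed auto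
  have "absolutely_continuous lborel ?M"
    unfolding absolutely_continuous_def
  proof
    fix A :: "real set" assume A: "A \<in> null_sets lborel"
    then have "A \<in> null_sets ?N"
      using absolutely_continuousI_density[of "\<lambda>x. ennreal (?\<phi> x)" lborel]
      unfolding absolutely_continuous_def by auto
    then show "A \<in> null_sets ?M" using A le[of A] by (auto simp: null_sets_def)
  qed
  then obtain h where h[measurable]: "h \<in> borel_measurable borel" and dens: "density lborel h = ?M"
    using sigma_finite_measure.Radon_Nikodym[OF sigma_finite_lborel, of ?M] by auto
  have "(\<integral>\<^sup>+x. h x \<partial>lborel) = emeasure ?M UNIV"
    unfolding dens[symmetric] by (subst emeasure_density) auto
  with fin have h_fin: "AE x in lborel. h x \<noteq> \<infinity>" by (intro nn_integral_PInf_AE) auto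
  define g0 where "g0 x = enn2real (h x)" for x
  have g0_h: "AE x in lborel. ennreal (g0 x) = h x"
    using h_fin by eventually_elim (simp add: g0_def less_top)
  have [measurable]: "g0 \<in> borel_measurable borel" unfolding g0_def by measurable
  have dens0: "density lborel (\<lambda>x. ennreal (g0 x)) = ?M"
    unfolding dens[symmetric] by (rule density_cong[OF _ _ g0_h]) auto
  have int0: "integrable lborel g0"
  proof (rule integrableI_nonneg)
    have "(\<integral>\<^sup>+x. ennreal (g0 x) \<partial>lborel) = emeasure ?M UNIV"
      unfolding dens0[symmetric] by (subst emeasure_density) auto
    then show "(\<integral>\<^sup>+x. ennreal (g0 x) \<partial>lborel) < \<infinity>" using fin by (simp add: less_top)
  qed (auto simp: g0_def)
  have val: "(LINT s:{a..x}|lborel. g0 s) = F x - F a + C * (x - a)" if x: "x \<in> {a..b}" for x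
  proof -
    have "(LINT s:{a..x}|lborel. g0 s) = (LINT s:{a<..x}|lborel. g0 s)"
      unfolding set_lebesgue_integral_def
      by (rule integral_cong_AE) (use AE_lborel_singleton[of a] in \<open>auto simp: indicator_def elim!: eventually_mono\<close>)
    also have "\<dots> = measure ?M {a<..x}"
      unfolding dens0[symmetric] by (rule density_integrable(2)[OF int0, symmetric]) (auto simp: g0_def)
    also have "\<dots> = G x - G a" using Ioc[of a x] G_incr[of a x] x by (simp add: measure_def)
    also have "\<dots> = F x - F a + C * (x - a)" using x ab by (simp add: G_def cl_def algebra_simps)
    finally show ?thesis .
  qed
  define g where "g x = g0 x - C" for x
  have "set_integrable lborel {a..x} g0" for x
    unfolding set_integrable_def by (rule integrable_mult_indicator[OF _ int0]) simp
  moreover have "set_integrable lborel {a..x} (\<lambda>_. C)" for x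
    unfolding set_integrable_def
    by (intro integrable_scaleR_left integrable_real_indicator) (auto simp: emeasure_lborel_Icc_eq)
  ultimately have si: "set_integrable lborel {a..x} g0" "set_integrable lborel {a..x} (\<lambda>_. C)" for x
    by blast+
  show thesis
  proof (rule that[of g])
    show "g \<in> borel_measurable borel" unfolding g_def by measurable
    show "set_integrable lborel {a..b} g" unfolding g_def using si by (intro set_integral_diff(1))
    fix x assume x: "x \<in> {a..b}"
    have "(LINT s:{a..x}|lborel. g s) = (LINT s:{a..x}|lborel. g0 s) - (LINT s:{a..x}|lborel. C)"
      unfolding g_def using si by (rule set_integral_diff(2))
    also have "(LINT s:{a..x}|lborel. C) = C * (x - a)"
      using x by (simp add: set_lebesgue_integral_def)
    finally show "F x = F a + (LINT s:{a..x}|lborel. g s)" using val[OF x] by simp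
  qed
qed

lemma lipschitz_integral:
  fixes F :: "real \<Rightarrow> 'a::euclidean_space"
  assumes ab: "a \<le> b" and C: "0 \<le> C"
    and lip: "\<And>x y. x \<in> {a..b} \<Longrightarrow> y \<in> {a..b} \<Longrightarrow> norm (F y - F x) \<le> C * \<bar>y - x\<bar>"
  obtains g where "g \<in> borel_measurable borel" "set_integrable lborel {a..b} g"
    "\<And>x. x \<in> {a..b} \<Longrightarrow> F x = F a + (LINT s:{a..x}|lborel. g s)"
proof -
  have "\<forall>i\<in>(Basis :: 'a set). \<exists>g. g \<in> borel_measurable borel \<and> set_integrable lborel {a..b} g \<and>
      (\<forall>x\<in>{a..b}. F x \<bullet> i = F a \<bullet> i + (LINT s:{a..x}|lborel. g s))"
  proof
    fix i :: 'a assume i: "i \<in> Basis"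
    have lip_i: "\<bar>F y \<bullet> i - F x \<bullet> i\<bar> \<le> C * \<bar>y - x\<bar>" if "x \<in> {a..b}" "y \<in> {a..b}" for x y
      using lip[OF that] Basis_le_norm[OF i, of "F y - F x"] by (simp add: inner_diff_left)
    show "\<exists>g. g \<in> borel_measurable borel \<and> set_integrable lborel {a..b} g \<and>
      (\<forall>x\<in>{a..b}. F x \<bullet> i = F a \<bullet> i + (LINT s:{a..x}|lborel. g s))"
      by (rule lipschitz_real_integral[of a b C "\<lambda>x. F x \<bullet> i", OF ab C lip_i]) blast+
  qed
  from bchoice[OF this] obtain g where g: "\<forall>i\<in>Basis. g i \<in> borel_measurable borel \<and>
      set_integrable lborel {a..b} (g i) \<and> (\<forall>x\<in>{a..b}. F x \<bullet> i = F a \<bullet> i + (LINT s:{a..x}|lborel. g i s))"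
    by (rule exE)
  have gi: "integrable lborel (\<lambda>s. indicator {a..x} s *\<^sub>R g i s)" if "i \<in> Basis" "x \<in> {a..b}" for i x
  proof -
    have "set_integrable lborel {a..x} (g i)"
      by (rule set_integrable_subset[of _ "{a..b}"]) (use g that in auto)
    then show ?thesis unfolding set_integrable_def .
  qed
  have si: "integrable lborel (\<lambda>s. indicator {a..x} s *\<^sub>R g i s *\<^sub>R i)" if "i \<in> Basis" "x \<in> {a..b}" for i x
    using integrable_scaleR_left[of i lborel, OF gi[OF that]] by simp
  show thesis
  proof (rule that[of "\<lambda>s. \<Sum>i\<in>Basis. g i s *\<^sub>R i"])
    show "(\<lambda>s. \<Sum>i\<in>Basis. g i s *\<^sub>R i) \<in> borel_measurable borel"
      using g by (intro borel_measurable_sum borel_measurable_scaleR borel_measurable_const) auto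
    show "set_integrable lborel {a..b} (\<lambda>s. \<Sum>i\<in>Basis. g i s *\<^sub>R i)"
      unfolding set_integrable_def scaleR_sum_right
      by (intro Bochner_Integration.integrable_sum si) (use ab in auto)
    fix x assume x: "x \<in> {a..b}"
    have "(LINT s:{a..x}|lborel. \<Sum>i\<in>Basis. g i s *\<^sub>R i) =
        (\<Sum>i\<in>Basis. \<integral>s. indicator {a..x} s *\<^sub>R g i s *\<^sub>R i \<partial>lborel)"
      unfolding set_lebesgue_integral_def scaleR_sum_right
      by (intro Bochner_Integration.integral_sum si x)
    also have "\<dots> = (\<Sum>i\<in>Basis. (LINT s:{a..x}|lborel. g i s) *\<^sub>R i)"
      unfolding set_lebesgue_integral_def
      using integral_scaleR_left[OF gi[OF _ x]] by (intro sum.cong HOL.refl) simp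
    also have "\<dots> = (\<Sum>i\<in>Basis. ((F x - F a) \<bullet> i) *\<^sub>R i)"
      using g x by (intro sum.cong HOL.refl) (metis add_diff_cancel_left' inner_diff_left)
    also have "\<dots> = F x - F a" by (rule euclidean_representation)
    finally show "F x = F a + (LINT s:{a..x}|lborel. \<Sum>i\<in>Basis. g i s *\<^sub>R i)" by simp
  qed
qed

section \<open>Differential inclusions by Euler polygons\<close>

text \<open>The \<open>v k\<close> are approximate selections without any continuity. The polygons
  share the Lipschitz constant C, so a subsequence converges uniformly; the velocities need not
  converge, yet every bound \<open>l \<bullet> v k x \<le> \<phi> x + e\<close> passes to the limit
  after integration in time. One curve serves all l and \<phi>, so its velocity is caught in an
  intersection of half-spaces.\<close>

lemma euler_inclusion:
  fixes v :: "nat \<Rightarrow> 'a::euclidean_space \<Rightarrow> 'a"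
  assumes C: "0 \<le> C" "\<And>k x. norm (v k x) \<le> C" and T: "0 \<le> T"
  obtains \<gamma> where "\<gamma> 0 = y"
    "\<And>s t. s \<in> {0..T} \<Longrightarrow> t \<in> {0..T} \<Longrightarrow> norm (\<gamma> t - \<gamma> s) \<le> C * \<bar>t - s\<bar>"
    "\<And>l \<phi> a b. continuous_on UNIV \<phi> \<Longrightarrow>
      (\<And>e. e > 0 \<Longrightarrow> \<exists>K. \<forall>k\<ge>K. \<forall>x\<in>cball y (C * T). l \<bullet> v k x \<le> \<phi> x + e) \<Longrightarrow>
      0 \<le> a \<Longrightarrow> a \<le> b \<Longrightarrow> b \<le> T \<Longrightarrow> l \<bullet> (\<gamma> b - \<gamma> a) \<le> integral {a..b} (\<lambda>s. \<phi> (\<gamma> s))"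
proof -
  define h where "h k = 1 / (real k + 1)" for k :: nat
  have h: "0 < h k" for k by (simp add: h_def)
  define x where "x k = rec_nat y (\<lambda>_ z. z + h k *\<^sub>R v k z)" for k
  have x0: "x k 0 = y" and xSuc: "x k (Suc i) = x k i + h k *\<^sub>R v k (x k i)" for k i
    by (simp_all add: x_def)
  define N where "N k r = nat \<lfloor>r / h k\<rfloor>" for k and r :: real
  define u where "u k r = v k (x k (N k r))" for k r
  have u_norm: "norm (u k r) \<le> C" for k r by (simp add: u_def C)
  have int: "u k integrable_on {a..b}" for k a b
  proof -
    have "N k \<in> borel \<rightarrow>\<^sub>M count_space UNIV" unfolding N_def by measurable
    then have [measurable]: "u k \<in> borel_measurable borel"
      unfolding u_def by (rule measurable_compose) simp
    have "integrable lborel (\<lambda>r. C * indicator {a..b} r)"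
      by (intro integrable_mult_right integrable_real_indicator) (auto simp: emeasure_lborel_Icc_eq)
    then have "set_integrable lborel {a..b} (u k)"
      unfolding set_integrable_def
    proof (rule Bochner_Integration.integrable_bound)
      show "AE r in lborel. norm (indicator {a..b} r *\<^sub>R u k r) \<le> norm (C * indicator {a..b} r)"
        using u_norm C(1) by (intro AE_I2) (auto simp: indicator_def)
    qed simp
    then show ?thesis by (rule set_borel_integral_eq_integral)
  qed
  define p where "p k t = y + integral {0..t} (u k)" for k t
  have p_diff: "p k t - p k s = integral {s..t} (u k)" if "0 \<le> s" "s \<le> t" for k s t
    using Henstock_Kurzweil_Integration.integral_combine[OF that int[of k 0 t]] by (simp add: p_def algebra_simps)
  have p_lip': "norm (p k t - p k s) \<le> C * (t - s)" if "0 \<le> s" "s \<le> t" for k s t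
  proof -
    have "norm (integral {s..t} (u k)) \<le> integral {s..t} (\<lambda>_. C)"
      by (rule integral_norm_bound_integral) (use int u_norm in auto)
    then show ?thesis using that by (simp add: p_diff content_real mult.commute)
  qed
  have p_lip: "norm (p k t - p k s) \<le> C * \<bar>t - s\<bar>" if "0 \<le> s" "0 \<le> t" for k s t
    using p_lip'[of s t k] p_lip'[of t s k] that by (cases "s \<le> t") (auto simp: norm_minus_commute)
  have p0: "p k 0 = y" for k by (simp add: p_def)
  have node: "p k (real i * h k) = x k i" for k i
  proof (induction i)
    case 0 then show ?case by (simp add: p0 x0)
  next
    case (Suc i)
    let ?a = "real i * h k" and ?b = "real (Suc i) * h k"
    have ab: "0 \<le> ?a" "?b = ?a + h k" using h[of k] by (auto simp: algebra_simps)
    have "integral {?a..?b} (u k) = integral {?a..?b} (\<lambda>_. v k (x k i))"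
    \<comment> \<open>The right end is left out because the step index \<open>N k\<close> jumps
      there.\<close>
    proof (rule integral_spike[of "{?b}"])
      fix r assume r: "r \<in> {?a..?b} - {?b}"
      then have "real i * h k \<le> r" "r < (real i + 1) * h k" using ab by (auto simp: algebra_simps)
      then have "real i \<le> r / h k" "r / h k < real i + 1"
        using h[of k] by (simp_all add: pos_le_divide_eq pos_divide_less_eq)
      then have "\<lfloor>r / h k\<rfloor> = int i" by (intro floor_unique) auto
      then show "v k (x k i) = u k r" by (simp add: u_def N_def)
    qed simp
    also have "\<dots> = h k *\<^sub>R v k (x k i)" using ab h[of k] by (simp add: content_real)
    finally have "p k ?b - p k ?a = h k *\<^sub>R v k (x k i)" using p_diff[of ?a ?b k] ab h[of k] by simp
    then show ?case using Suc.IH xSuc[of k i] by (simp add: algebra_simps)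
  qed
  have N: "0 \<le> real (N k r) * h k" "real (N k r) * h k \<le> r" "r - real (N k r) * h k \<le> h k" if r: "0 \<le> r" for k r
  proof -
    have "0 \<le> r / h k" using r h[of k] by simp
    then have "real (N k r) \<le> r / h k" "r / h k < real (N k r) + 1" unfolding N_def by linarith+
    then show "real (N k r) * h k \<le> r" "r - real (N k r) * h k \<le> h k"
      using h[of k] by (simp_all add: field_simps)
    show "0 \<le> real (N k r) * h k" using h[of k] by simp
  qed
  have near: "norm (x k (N k r) - p k r) \<le> C * h k" if r: "0 \<le> r" for k r
  proof -
    have "norm (p k r - p k (real (N k r) * h k)) \<le> C * (r - real (N k r) * h k)"
      using N[OF r] by (intro p_lip') auto
    also have "\<dots> \<le> C * h k" using N[OF r] C by (intro mult_left_mono) auto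
    finally show ?thesis by (simp add: node norm_minus_commute)
  qed
  \<comment> \<open>All Euler nodes up to T lie within reach of y, so it suffices to bound
    \<open>l \<bullet> v k x\<close> on this ball.\<close>
  have in_ball: "x k (N k r) \<in> cball y (C * T)" if r: "r \<in> {0..T}" for k r
  proof -
    have "norm (p k (real (N k r) * h k) - p k 0) \<le> C * (real (N k r) * h k - 0)"
      using N[of r k] r by (intro p_lip') auto
    also have "\<dots> \<le> C * T" using N[of r k] r C by (intro mult_left_mono) auto
    finally show ?thesis by (simp add: node p0 dist_norm norm_minus_commute)
  qed
  obtain \<gamma> r where \<gamma>_cont: "continuous_on {0..T} \<gamma>" and r: "strict_mono (r :: nat \<Rightarrow> nat)"
    and conv: "\<And>e. 0 < e \<Longrightarrow> \<exists>N. \<forall>n s. n \<ge> N \<and> s \<in> {0..T} \<longrightarrow> norm (p (r n) s - \<gamma> s) < e"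
  proof (rule Arzela_Ascoli[of "{0..T}" p "norm y + C * T"])
    fix n s assume s: "s \<in> {0..T}"
    have "norm (p n s) \<le> norm y + norm (p n s - p n 0)"
      using norm_triangle_ineq[of y "p n s - y"] by (simp add: p0)
    also have "norm (p n s - p n 0) \<le> C * T"
      using p_lip'[of 0 s n] s C by (auto intro: order_trans mult_left_mono)
    finally show "norm (p n s) \<le> norm y + C * T" by simp
  next
    fix s e :: real assume s: "s \<in> {0..T}" and e: "0 < e"
    have "norm (p n s - p n s') < e" if "s' \<in> {0..T}" "norm (s - s') < e / (C + 1)" for n s'
    proof -
      have "norm (p n s - p n s') \<le> C * \<bar>s - s'\<bar>" using s that by (intro p_lip) auto
      also have "\<dots> \<le> (C + 1) * \<bar>s - s'\<bar>" by (intro mult_right_mono) auto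
      also have "\<dots> < e" using that(2) C(1) by (simp add: pos_less_divide_eq mult.commute)
      finally show ?thesis .
    qed
    then show "\<exists>d>0. \<forall>n s'. s' \<in> {0..T} \<and> norm (s - s') < d \<longrightarrow> norm (p n s - p n s') < e"
      using e C(1) by (intro exI[of _ "e / (C + 1)"]) auto
  qed auto
  have lim: "(\<lambda>n. p (r n) s) \<longlonglongrightarrow> \<gamma> s" if "s \<in> {0..T}" for s
    unfolding LIMSEQ_iff using conv that by blast
  have \<gamma>0: "\<gamma> 0 = y"
    using LIMSEQ_unique[OF lim[of 0]] T by (simp add: p0)
  have \<gamma>_lip: "norm (\<gamma> t - \<gamma> s) \<le> C * \<bar>t - s\<bar>" if "s \<in> {0..T}" "t \<in> {0..T}" for s t
    using that p_lip
    by (intro tendsto_upperbound[OF tendsto_norm[OF tendsto_diff[OF lim lim]] always_eventually]) auto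
  have \<gamma>_ball: "\<gamma> s \<in> cball y (C * T)" if s: "s \<in> {0..T}" for s
  proof -
    have "norm (\<gamma> s - \<gamma> 0) \<le> C * s" using \<gamma>_lip[of 0 s] s by simp
    also have "\<dots> \<le> C * T" using s C by (intro mult_left_mono) auto
    finally show ?thesis by (simp add: \<gamma>0 dist_norm norm_minus_commute)
  qed
  have ineq: "l \<bullet> (\<gamma> b - \<gamma> a) \<le> integral {a..b} (\<lambda>s. \<phi> (\<gamma> s))"
    if \<phi>: "continuous_on UNIV \<phi>"
      and le: "\<And>e. e > 0 \<Longrightarrow> \<exists>K. \<forall>k\<ge>K. \<forall>x\<in>cball y (C * T). l \<bullet> v k x \<le> \<phi> x + e"
      and ab: "0 \<le> a" "a \<le> b" "b \<le> T" for l \<phi> a b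
  proof -
    have cont: "continuous_on {a..b} (\<lambda>s. \<phi> (\<gamma> s))"
      by (rule continuous_on_compose2[OF \<phi> continuous_on_subset[OF \<gamma>_cont]]) (use ab in auto)
    \<comment> \<open>One e comes from the assumed bound at the Euler node, the other from the
      modulus of \<phi> between the node and \<open>\<gamma> s\<close>.\<close>
    have main: "l \<bullet> (\<gamma> b - \<gamma> a) \<le> integral {a..b} (\<lambda>s. \<phi> (\<gamma> s)) + 2 * e * (b - a)" if e: "e > 0" for e
    proof -
      have "uniformly_continuous_on (cball y (C * T)) \<phi>"
        by (intro compact_uniformly_continuous continuous_on_subset[OF \<phi>]) auto
      then obtain \<delta> where \<delta>: "\<delta> > 0" "\<And>w z. w \<in> cball y (C * T) \<Longrightarrow> z \<in> cball y (C * T) \<Longrightarrow>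
          dist z w < \<delta> \<Longrightarrow> dist (\<phi> z) (\<phi> w) < e"
        using e unfolding uniformly_continuous_on_def by blast
      obtain K where K: "\<And>k x. k \<ge> K \<Longrightarrow> x \<in> cball y (C * T) \<Longrightarrow> l \<bullet> v k x \<le> \<phi> x + e"
        using le[OF e] by blast
      obtain n1 where n1: "\<And>n s. n \<ge> n1 \<Longrightarrow> s \<in> {0..T} \<Longrightarrow> norm (p (r n) s - \<gamma> s) < \<delta> / 2"
        using conv[of "\<delta> / 2"] \<delta>(1) by auto
      obtain n2 :: nat where n2: "2 * C / \<delta> < real n2" using reals_Archimedean2 by blast
      have "l \<bullet> (p (r n) b - p (r n) a) \<le> integral {a..b} (\<lambda>s. \<phi> (\<gamma> s)) + 2 * e * (b - a)"
        if n: "n \<ge> max n1 (max n2 K)" for n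
      proof -
        have rn: "n \<le> r n" using r by (rule seq_suble)
        have "C * h (r n) < \<delta> / 2"
        proof -
          have "2 * C / \<delta> < real (r n) + 1" using n2 n rn by linarith
          then show ?thesis using \<delta>(1) by (simp add: h_def field_simps)
        qed
        have le: "l \<bullet> u (r n) s \<le> \<phi> (\<gamma> s) + 2 * e" if s: "s \<in> {a..b}" for s
        proof -
          have s': "s \<in> {0..T}" using s ab by auto
          let ?x = "x (r n) (N (r n) s)"
          have "dist ?x (\<gamma> s) \<le> norm (?x - p (r n) s) + norm (p (r n) s - \<gamma> s)"
            unfolding dist_norm by (rule norm_diff_triangle_le) auto
          also have "\<dots> < \<delta>"
            using near[of s "r n"] n1[of n s] n s' \<open>C * h (r n) < \<delta> / 2\<close> by auto
          finally have "dist (\<phi> ?x) (\<phi> (\<gamma> s)) < e" using \<delta>(2) in_ball[OF s'] \<gamma>_ball[OF s'] by blast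
          moreover have "l \<bullet> v (r n) ?x \<le> \<phi> ?x + e" using n rn in_ball[OF s'] by (intro K) auto
          ultimately show ?thesis by (simp add: u_def dist_real_def abs_less_iff)
        qed
        have "l \<bullet> (p (r n) b - p (r n) a) = integral {a..b} (\<lambda>s. l \<bullet> u (r n) s)"
          using ab int integral_linear[OF int[of "r n" a b] bounded_linear_inner_right[of l]]
          by (simp add: p_diff comp_def)
        also have "\<dots> \<le> integral {a..b} (\<lambda>s. \<phi> (\<gamma> s) + 2 * e)"
        proof (rule integral_le)
          show "(\<lambda>s. l \<bullet> u (r n) s) integrable_on {a..b}"
            using integrable_linear[OF int[of "r n" a b] bounded_linear_inner_right[of l]] by (simp add: comp_def)
          show "(\<lambda>s. \<phi> (\<gamma> s) + 2 * e) integrable_on {a..b}"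
            by (intro integrable_continuous_real continuous_intros cont)
        qed (rule le)
        also have "\<dots> = integral {a..b} (\<lambda>s. \<phi> (\<gamma> s)) + 2 * e * (b - a)"
          using ab cont by (subst Henstock_Kurzweil_Integration.integral_add)
            (auto intro!: integrable_continuous_real simp: content_real)
        finally show ?thesis .
      qed
      then have "\<forall>\<^sub>F n in sequentially. l \<bullet> (p (r n) b - p (r n) a) \<le> integral {a..b} (\<lambda>s. \<phi> (\<gamma> s)) + 2 * e * (b - a)"
        unfolding eventually_sequentially by blast
      then show ?thesis
        using ab by (intro tendsto_upperbound[OF tendsto_inner[OF tendsto_const tendsto_diff[OF lim lim]]]) auto
    qed
    show ?thesis
    proof (rule field_le_epsilon)
      fix e :: real assume e: "0 < e"
      have "2 * (e / (2 * (b - a) + 1)) * (b - a) \<le> e" using ab e by (simp add: field_simps)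
      then show "l \<bullet> (\<gamma> b - \<gamma> a) \<le> integral {a..b} (\<lambda>s. \<phi> (\<gamma> s)) + e"
        using main[of "e / (2 * (b - a) + 1)"] e ab by (simp add: divide_pos_pos)
    qed
  qed
  show thesis by (rule that[OF \<gamma>0 \<gamma>_lip ineq])
qed

section \<open>Dual pairs of Hamiltonian and Lagrangian, and uniqueness of velocities\<close>

locale dual_pair =
  fixes H :: "'a::euclidean_space \<Rightarrow> 'a \<Rightarrow> real" and L :: "'a \<Rightarrow> 'a \<Rightarrow> ereal"
  assumes cont: "continuous_on UNIV (\<lambda>(z, \<xi>). H z \<xi>)"
    and dual: "hamiltonian_lagrangian H L"
begin

lemma cont_fst: "continuous_on UNIV (\<lambda>z. H z \<xi>)"
  using continuous_on_compose2[OF cont, of UNIV "\<lambda>z. (z, \<xi>)"] by (simp add: continuous_intros)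

lemma cont_snd: "continuous_on UNIV (H z)"
  using continuous_on_compose2[OF cont, of UNIV "\<lambda>\<xi>. (z, \<xi>)"] by (simp add: continuous_intros)

lemma L_nonneg: "0 \<le> L z v"
  using dual unfolding hamiltonian_lagrangian_def by blast

lemma L_eq: "L z v = legendre (\<lambda>\<xi>. ereal (H z \<xi>)) v"
  using dual unfolding hamiltonian_lagrangian_def by blast

lemma H_eq: "ereal (H z \<xi>) = legendre (L z) \<xi>"
  using dual unfolding hamiltonian_lagrangian_def by blast

lemma fenchel: "ereal (v \<bullet> \<xi> - H z \<xi>) \<le> L z v"
  unfolding L_eq legendre_def by (rule SUP_upper2[of \<xi>]) auto

text \<open>An almost maximiser in the transform that gives H. By Fenchel-Young such a velocity is
  an e-subgradient of \<open>H z\<close> at p, which is the input of the Euler scheme.\<close>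

lemma near_optimal:
  assumes e: "e > 0"
  obtains v where "L z v \<le> ereal (v \<bullet> p - H z p + e)"
proof -
  have "ereal (H z p - e) < (SUP v. ereal (p \<bullet> v) - L z v)"
    using H_eq[of z p] e unfolding legendre_def by (metis diff_less_eq ereal_less_eq(3) less_add_same_cancel1 less_ereal.simps(1))
  then obtain v where v: "ereal (H z p - e) < ereal (p \<bullet> v) - L z v" by (auto simp: less_SUP_iff)
  then have "L z v \<le> ereal (v \<bullet> p - H z p + e)"
    using L_nonneg[of z v] by (cases "L z v") (auto simp: inner_commute)
  then show thesis by (rule that)
qed

lemma H_bounded:
  obtains M where "0 \<le> M" "\<And>z \<xi>. z \<in> cball z0 r \<Longrightarrow> \<xi> \<in> cball p q \<Longrightarrow> \<bar>H z \<xi>\<bar> \<le> M"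
proof -
  have "compact ((\<lambda>(z, \<xi>). H z \<xi>) ` (cball z0 r \<times> cball p q))"
    by (intro compact_continuous_image continuous_on_subset[OF cont] compact_Times) auto
  then obtain M where "\<And>w. w \<in> (\<lambda>(z, \<xi>). H z \<xi>) ` (cball z0 r \<times> cball p q) \<Longrightarrow> norm w \<le> M"
    using compact_imp_bounded bounded_iff by metis
  then have "\<bar>H z \<xi>\<bar> \<le> max M 0" if "z \<in> cball z0 r" "\<xi> \<in> cball p q" for z \<xi>
    using that by (force simp: le_max_iff_disj)
  then show thesis by (intro that[of "max M 0"]) auto
qed

lemma L_le_of_subgradient:
  assumes "\<And>\<xi>. (\<xi> - p) \<bullet> v \<le> H z \<xi> - H z p"
  shows "L z v \<le> ereal (v \<bullet> p - H z p)"
  unfolding L_eq legendre_def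
proof (rule SUP_least)
  fix \<xi> show "ereal (v \<bullet> \<xi>) - ereal (H z \<xi>) \<le> ereal (v \<bullet> p - H z p)"
    using assms[of \<xi>] by (simp add: inner_diff_left inner_commute[of v])
qed

end

lemma integral_combine_start:
  fixes f :: "real \<Rightarrow> 'a::euclidean_space"
  assumes "set_integrable lborel {0..t} f" "0 \<le> c" "c \<le> d" "d \<le> t"
  shows "set_integrable lborel {c..d} f"
    "(LINT s:{c..d}|lborel. f s) = (LINT s:{0..d}|lborel. f s) - (LINT s:{0..c}|lborel. f s)"
proof -
  have si: "set_integrable lborel {a..b} f" if "0 \<le> a" "b \<le> t" for a b
    by (rule set_integrable_subset[OF assms(1)]) (use that in auto)
  show "set_integrable lborel {c..d} f" using assms by (intro si) auto
  have "integral {0..c} f + integral {c..d} f = integral {0..d} f"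
    using assms by (intro Henstock_Kurzweil_Integration.integral_combine set_borel_integral_eq_integral si) auto
  then show "(LINT s:{c..d}|lborel. f s) = (LINT s:{0..d}|lborel. f s) - (LINT s:{0..c}|lborel. f s)"
    using si[of c d] si[of 0 d] si[of 0 c] assms by (simp add: set_borel_integral_eq_integral(2) algebra_simps)
qed

lemma set_integral_inner:
  fixes f :: "real \<Rightarrow> 'a::euclidean_space"
  assumes "set_integrable lborel A f"
  shows "set_integrable lborel A (\<lambda>s. l \<bullet> f s)" "(LINT s:A|lborel. l \<bullet> f s) = l \<bullet> (LINT s:A|lborel. f s)"
proof -
  have eq: "indicator A s *\<^sub>R (l \<bullet> f s) = l \<bullet> (indicator A s *\<^sub>R f s)" for s by simp
  have f: "integrable lborel (\<lambda>s. indicator A s *\<^sub>R f s)" using assms unfolding set_integrable_def .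
  show "set_integrable lborel A (\<lambda>s. l \<bullet> f s)"
    unfolding set_integrable_def eq by (rule integrable_inner_right) (rule f)
  show "(LINT s:A|lborel. l \<bullet> f s) = l \<bullet> (LINT s:A|lborel. f s)"
    unfolding set_lebesgue_integral_def eq by (rule integral_inner_right) (rule f)
qed

lemma set_integral_continuous:
  fixes f :: "real \<Rightarrow> real"
  assumes "continuous_on {a..b} f"
  shows "set_integrable lborel {a..b} f" "(LINT s:{a..b}|lborel. f s) = integral {a..b} f"
  using borel_integrable_atLeastAtMost'[OF assms] by (auto intro: set_borel_integral_eq_integral)

lemma continuous_cadlag:
  assumes ext: "\<gamma> \<in> extensional {0..}" and cont: "continuous_on {0..} \<gamma>"
  shows "\<gamma> \<in> cadlag"
  unfolding cadlag_def
proof (intro CollectI conjI allI impI ext)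
  have lim: "(\<gamma> \<longlongrightarrow> \<gamma> t) (at t within {0..})" if "0 \<le> t" for t
    using cont that unfolding continuous_on_def by auto
  show "(\<gamma> \<longlongrightarrow> \<gamma> t) (at_right t)" if "0 \<le> t" for t
    by (rule tendsto_within_subset[OF lim[OF that]]) (use that in auto)
  show "\<exists>l. (\<gamma> \<longlongrightarrow> l) (at_left t)" if t: "0 < t" for t
  proof
    have "at_left t = at t within {0..<t}"
      by (rule at_within_nhd[of _ "{0<..}"]) (use t in auto)
    moreover have "(\<gamma> \<longlongrightarrow> \<gamma> t) (at t within {0..<t})"
      by (rule tendsto_within_subset[OF lim]) (use t in auto)
    ultimately show "(\<gamma> \<longlongrightarrow> \<gamma> t) (at_left t)" by simp
  qed
qed

text \<open>All interval integrals of the difference vanish, so each component is nonpositive and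
  nonnegative almost everywhere. Testing with the finitely many vectors \<open>i\<close> and
  \<open>- i\<close> yields one null set per bounded interval.\<close>

lemma has_velocity_unique:
  assumes g: "has_velocity \<gamma> g" and g': "has_velocity \<gamma> g'"
  shows "AE s in lborel. 0 \<le> s \<longrightarrow> g s = g' s"
proof -
  have le: "AE s in lborel. s \<in> {0..real n} \<longrightarrow> l \<bullet> (g s - g' s) \<le> 0" for n l
  proof (rule AE_nonpos_of_interval_integrals)
    note gn = has_velocityD(1)[OF g, of "real n"] has_velocityD(1)[OF g', of "real n"]
    have d: "set_integrable lborel {0..real n} (\<lambda>s. g s - g' s)"
      using gn by (intro set_integral_diff(1)) auto
    show "set_integrable lborel {0..real n} (\<lambda>s. l \<bullet> (g s - g' s))" by (rule set_integral_inner(1)[OF d])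
    fix c e assume ce: "0 \<le> c" "c \<le> e" "e \<le> real n"
    have zero: "(LINT s:{0..T}|lborel. g s - g' s) = 0" if "0 \<le> T" for T
    proof -
      have "(LINT s:{0..T}|lborel. g s) = (LINT s:{0..T}|lborel. g' s)"
        using has_velocityD(2)[OF g that] has_velocityD(2)[OF g' that] by (metis add_left_cancel)
      then show ?thesis
        using set_integral_diff(2)[OF has_velocityD(1)[OF g that] has_velocityD(1)[OF g' that]] by simp
    qed
    have "(LINT s:{c..e}|lborel. l \<bullet> (g s - g' s)) = l \<bullet> (LINT s:{c..e}|lborel. g s - g' s)"
      by (rule set_integral_inner(2)[OF integral_combine_start(1)[OF d ce]])
    also have "\<dots> = 0" using integral_combine_start(2)[OF d ce] zero ce by simp
    finally show "(LINT s:{c..e}|lborel. l \<bullet> (g s - g' s)) \<le> 0" by simp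
  qed
  have "countable (Basis \<union> uminus ` Basis :: 'a set)" by (intro countable_finite) auto
  then have "AE s in lborel. \<forall>n. \<forall>i\<in>Basis \<union> uminus ` Basis. s \<in> {0..real n} \<longrightarrow> i \<bullet> (g s - g' s) \<le> 0"
    unfolding AE_all_countable by (simp only: AE_ball_countable) (use le in blast)
  then show ?thesis
  proof eventually_elim
    case (elim s)
    show ?case
    proof
      assume s: "0 \<le> s"
      obtain n where n: "s \<le> real n" using real_arch_simple by blast
      have "g s \<bullet> i = g' s \<bullet> i" if i: "i \<in> Basis" for i
      proof -
        have *: "\<forall>i\<in>Basis \<union> uminus ` Basis. s \<in> {0..real n} \<longrightarrow> i \<bullet> (g s - g' s) \<le> 0"
          using elim by (rule spec)
        have "i \<bullet> (g s - g' s) \<le> 0" "(- i) \<bullet> (g s - g' s) \<le> 0"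
          using bspec[OF *, of i] bspec[OF *, of "- i"] i s n by simp_all
        then show ?thesis by (simp add: inner_diff_right inner_commute[of i])
      qed
      then show "g s = g' s" by (rule euclidean_eqI)
    qed
  qed
qed

lemma has_velocity_velocity: "has_velocity \<gamma> g \<Longrightarrow> has_velocity \<gamma> (velocity \<gamma>)"
  unfolding velocity_def using someI[of "has_velocity \<gamma>" g] by simp

text \<open>\<open>has_velocity\<close> constrains g at nonnegative times only; its values before 0
  are arbitrary, hence the indicator.\<close>

lemma velocity_measurable:
  assumes "has_velocity \<gamma> g"
  shows "(\<lambda>s. indicator {0..} s *\<^sub>R g s) \<in> borel_measurable borel"
proof (rule borel_measurable_LIMSEQ_metric)
  show "(\<lambda>s. indicator {0..real n} s *\<^sub>R g s) \<in> borel_measurable borel" for n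
    using has_velocityD(1)[OF assms, of "real n"] unfolding set_integrable_def by auto
  fix s :: real
  obtain n where n: "s \<le> real n" using real_arch_simple by blast
  have "\<forall>\<^sub>F m in sequentially. indicator {0..real m} s *\<^sub>R g s = indicator {0..} s *\<^sub>R g s"
    using eventually_ge_at_top[of n] by eventually_elim (use n in \<open>auto simp: indicator_def\<close>)
  then show "(\<lambda>m. indicator {0..real m} s *\<^sub>R g s) \<longlonglongrightarrow> indicator {0..} s *\<^sub>R g s"
    by (rule tendsto_eventually)
qed

section \<open>Optimal segments with a prescribed end point\<close>

context dual_pair begin

text \<open>A velocity in the subdifferential of \<open>H (\<gamma> s)\<close> at p is the equality
  case of Fenchel-Young. Reversed in time, the segment starts at y and follows negatives of such
  velocities, which the Euler scheme provides. C depends neither on y nor on t, so t can later be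
  chosen small in terms of it.\<close>

lemma backward_optimal_segment:
  obtains C where "0 \<le> C"
    "\<And>y t. y \<in> cball z (1/2) \<Longrightarrow> 0 < t \<Longrightarrow> C * t \<le> 1/2 \<Longrightarrow>
      \<exists>\<gamma> g. \<gamma> t = y \<and> (\<forall>r\<in>{0..t}. \<forall>s\<in>{0..t}. norm (\<gamma> s - \<gamma> r) \<le> C * \<bar>s - r\<bar>) \<and>
        g \<in> borel_measurable borel \<and> set_integrable lborel {0..t} g \<and>
        (\<forall>s\<in>{0..t}. \<gamma> s = \<gamma> 0 + (LINT r:{0..s}|lborel. g r)) \<and>
        (AE s in lborel. s \<in> {0..t} \<longrightarrow> L (\<gamma> s) (g s) \<le> ereal (g s \<bullet> p - H (\<gamma> s) p))"
proof -
  obtain M where M: "0 \<le> M" "\<And>w \<xi>. w \<in> cball z 1 \<Longrightarrow> \<xi> \<in> cball p 1 \<Longrightarrow> \<bar>H w \<xi>\<bar> \<le> M"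
    using H_bounded[of z 1 p 1] by blast
  \<comment> \<open>Testing an e-subgradient w at \<open>p + sgn w\<close> gives
    \<open>norm w \<le> 2 * M + e\<close>, and e is at most 1.\<close>
  define C where "C = 2 * M + 1"
  have C: "0 \<le> C" using M by (simp add: C_def)
  define w where "w k x = (SOME v. L x v \<le> ereal (v \<bullet> p - H x p + 1 / (real k + 1)))" for k :: nat and x
  have w: "L x (w k x) \<le> ereal (w k x \<bullet> p - H x p + 1 / (real k + 1))" for k x
    unfolding w_def by (rule someI_ex) (use near_optimal[of "1 / (real k + 1)" x p] in \<open>auto simp: add_pos_pos\<close>)
  have w': "(\<xi> - p) \<bullet> w k x \<le> H x \<xi> - H x p + 1 / (real k + 1)" for k x \<xi>
    using order_trans[OF fenchel[of "w k x" \<xi> x] w[of x k]] by (simp add: inner_diff_left inner_commute[of "w k x"])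
  \<comment> \<open>The sign reverses time. Outside the unit ball, where M says nothing, the field
    is cut off; a segment with \<open>C * t \<le> 1/2\<close> based within 1/2 of z never gets
    there.\<close>
  define v where "v k x = (if x \<in> cball z 1 then - w k x else 0)" for k x
  have v: "norm (v k x) \<le> C" for k x
  proof (cases "x \<in> cball z 1")
    case True
    have "p + sgn (w k x) \<in> cball p 1" by (simp add: dist_norm norm_sgn)
    then have "sgn (w k x) \<bullet> w k x \<le> 2 * M + 1 / (real k + 1)"
      using w'[of "p + sgn (w k x)" k x] M(2)[OF True, of p] M(2)[OF True, of "p + sgn (w k x)"] by (simp add: abs_le_iff)
    moreover have "sgn (w k x) \<bullet> w k x = norm (w k x)"
      by (cases "w k x = 0") (simp_all add: sgn_div_norm power2_norm_eq_inner[symmetric] power2_eq_square)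
    moreover have "1 / (real k + 1) \<le> 1" by simp
    ultimately have "norm (w k x) \<le> C" unfolding C_def by linarith
    then show ?thesis using True by (simp add: v_def)
  qed (simp add: v_def C)
  show thesis
  proof (rule that[OF C])
    fix y t assume y: "y \<in> cball z (1/2)" and t: "0 < t" and Ct: "C * t \<le> 1/2"
    have sub: "cball y (C * t) \<subseteq> cball z 1"
    proof
      fix x assume "x \<in> cball y (C * t)"
      then show "x \<in> cball z 1" using y Ct dist_triangle[of z x y] by simp
    qed
    show "\<exists>\<gamma> g. \<gamma> t = y \<and> (\<forall>r\<in>{0..t}. \<forall>s\<in>{0..t}. norm (\<gamma> s - \<gamma> r) \<le> C * \<bar>s - r\<bar>) \<and>
        g \<in> borel_measurable borel \<and> set_integrable lborel {0..t} g \<and>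
        (\<forall>s\<in>{0..t}. \<gamma> s = \<gamma> 0 + (LINT r:{0..s}|lborel. g r)) \<and>
        (AE s in lborel. s \<in> {0..t} \<longrightarrow> L (\<gamma> s) (g s) \<le> ereal (g s \<bullet> p - H (\<gamma> s) p))"
    proof (rule euler_inclusion[of C v t y, OF C v less_imp_le[OF t]])
      fix \<delta> assume \<delta>: "\<delta> 0 = y"
        "\<And>r s. r \<in> {0..t} \<Longrightarrow> s \<in> {0..t} \<Longrightarrow> norm (\<delta> s - \<delta> r) \<le> C * \<bar>s - r\<bar>"
        "\<And>l \<phi> a b. continuous_on UNIV \<phi> \<Longrightarrow>
          (\<And>e. e > 0 \<Longrightarrow> \<exists>K. \<forall>k\<ge>K. \<forall>x\<in>cball y (C * t). l \<bullet> v k x \<le> \<phi> x + e) \<Longrightarrow>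
          0 \<le> a \<Longrightarrow> a \<le> b \<Longrightarrow> b \<le> t \<Longrightarrow> l \<bullet> (\<delta> b - \<delta> a) \<le> integral {a..b} (\<lambda>s. \<phi> (\<delta> s))"
      define \<gamma> where "\<gamma> s = \<delta> (t - s)" for s
      have \<gamma>_lip: "norm (\<gamma> s - \<gamma> r) \<le> C * \<bar>s - r\<bar>" if "r \<in> {0..t}" "s \<in> {0..t}" for r s
        using \<delta>(2)[of "t - r" "t - s"] that by (simp add: \<gamma>_def abs_minus_commute)
      have "C-lipschitz_on {0..t} \<gamma>"
        using \<gamma>_lip C by (intro lipschitz_onI) (auto simp: dist_norm norm_minus_commute abs_minus_commute)
      then have \<gamma>_cont: "continuous_on {0..t} \<gamma>" by (rule lipschitz_on_continuous_on)
      define \<phi> where "\<phi> \<xi> x = H x \<xi> - H x p" for \<xi> x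
      have \<phi>_cont: "continuous_on UNIV (\<phi> \<xi>)" for \<xi>
        unfolding \<phi>_def by (intro continuous_intros cont_fst)
      have \<phi>\<gamma>: "continuous_on {a..b} (\<lambda>s. \<phi> \<xi> (\<gamma> s))" if "0 \<le> a" "b \<le> t" for a b \<xi>
        by (rule continuous_on_compose2[OF \<phi>_cont continuous_on_subset[OF \<gamma>_cont]]) (use that in auto)
      have incl: "(\<xi> - p) \<bullet> (\<gamma> b - \<gamma> a) \<le> integral {a..b} (\<lambda>s. \<phi> \<xi> (\<gamma> s))" if ab: "0 \<le> a" "a \<le> b" "b \<le> t" for \<xi> a b
      proof -
        have "(p - \<xi>) \<bullet> (\<delta> (t - a) - \<delta> (t - b)) \<le> integral {t - b..t - a} (\<lambda>s. \<phi> \<xi> (\<delta> s))"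
        proof (rule \<delta>(3)[OF \<phi>_cont])
          fix e :: real assume e: "e > 0"
          obtain K :: nat where K: "1 / e < real K" using reals_Archimedean2 by blast
          have "(p - \<xi>) \<bullet> v k x \<le> \<phi> \<xi> x + e" if k: "k \<ge> K" and x: "x \<in> cball y (C * t)" for k x
          proof -
            have "1 / e < real k + 1" using K k by linarith
            then have "1 / (real k + 1) \<le> e" using e by (simp add: field_simps)
            moreover have "x \<in> cball z 1" using sub x by blast
            then have "(p - \<xi>) \<bullet> v k x = (\<xi> - p) \<bullet> w k x" by (simp add: v_def inner_diff_left)
            ultimately show ?thesis using w'[of \<xi> k x] by (simp add: \<phi>_def)
          qed
          then show "\<exists>K. \<forall>k\<ge>K. \<forall>x\<in>cball y (C * t). (p - \<xi>) \<bullet> v k x \<le> \<phi> \<xi> x + e" by blast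
        qed (use ab in auto)
        moreover have "integral {t - b..t - a} (\<lambda>s. \<phi> \<xi> (\<delta> s)) = integral {a..b} (\<lambda>s. \<phi> \<xi> (\<gamma> s))"
        proof -
          have "integral {a..b} (\<lambda>s. \<phi> \<xi> (\<gamma> s)) = integral {- b..- a} (\<lambda>s. \<phi> \<xi> (\<gamma> (- s)))"
              using Henstock_Kurzweil_Integration.integral_reflect_real[of b a "\<lambda>s. \<phi> \<xi> (\<gamma> s)"] by simp
          also have "\<dots> = integral {- b..- a} ((\<lambda>s. \<phi> \<xi> (\<delta> s)) \<circ> (+) t)" by (simp add: \<gamma>_def comp_def)
          also have "\<dots> = integral {t - b..t - a} (\<lambda>s. \<phi> \<xi> (\<delta> s))"
            by (subst integral_shift_Icc_real) simp
          finally show ?thesis ..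
        qed
        ultimately show ?thesis by (simp add: \<gamma>_def inner_diff_left inner_diff_right)
      qed
      obtain g where g: "g \<in> borel_measurable borel" "set_integrable lborel {0..t} g"
        "\<And>s. s \<in> {0..t} \<Longrightarrow> \<gamma> s = \<gamma> 0 + (LINT r:{0..s}|lborel. g r)"
        using lipschitz_integral[of 0 t C \<gamma>, OF less_imp_le[OF t] C \<gamma>_lip] by blast
      have AE: "AE s in lborel. s \<in> {0..t} \<longrightarrow> (\<xi> - p) \<bullet> g s - \<phi> \<xi> (\<gamma> s) \<le> 0" for \<xi>
      proof (rule AE_nonpos_of_interval_integrals)
        show "set_integrable lborel {0..t} (\<lambda>s. (\<xi> - p) \<bullet> g s - \<phi> \<xi> (\<gamma> s))"
          by (intro set_integral_diff(1) set_integral_inner(1) g(2) set_integral_continuous(1) \<phi>\<gamma>) auto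
        fix c d assume cd: "0 \<le> c" "c \<le> d" "d \<le> t"
        have gcd: "set_integrable lborel {c..d} g" by (rule integral_combine_start(1)[OF g(2) cd])
        have "(LINT s:{c..d}|lborel. g s) = \<gamma> d - \<gamma> c"
          using integral_combine_start(2)[OF g(2) cd] g(3)[of d] g(3)[of c] cd by (simp add: algebra_simps)
        then have "(LINT s:{c..d}|lborel. (\<xi> - p) \<bullet> g s - \<phi> \<xi> (\<gamma> s)) =
            (\<xi> - p) \<bullet> (\<gamma> d - \<gamma> c) - integral {c..d} (\<lambda>s. \<phi> \<xi> (\<gamma> s))"
          using set_integral_inner[OF gcd, of "\<xi> - p"] set_integral_continuous[OF \<phi>\<gamma>[OF cd(1,3)], of \<xi>]
          by (subst set_integral_diff(2)) auto
        then show "(LINT s:{c..d}|lborel. (\<xi> - p) \<bullet> g s - \<phi> \<xi> (\<gamma> s)) \<le> 0"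
          using incl[OF cd, of \<xi>] by simp
      qed
      \<comment> \<open>The exceptional null set depends on \<xi>; a countable dense set of \<xi>
        gives a common one, and continuity of \<open>H (\<gamma> s)\<close> covers the rest.\<close>
      obtain D :: "'a set" where D: "countable D" "\<And>X. open X \<Longrightarrow> X \<noteq> {} \<Longrightarrow> \<exists>d\<in>D. d \<in> X"
        using countable_dense_exists by blast
      have "AE s in lborel. \<forall>\<xi>\<in>D. s \<in> {0..t} \<longrightarrow> (\<xi> - p) \<bullet> g s - \<phi> \<xi> (\<gamma> s) \<le> 0"
        using AE by (simp only: AE_ball_countable[OF D(1)]) simp
      then have "AE s in lborel. s \<in> {0..t} \<longrightarrow> L (\<gamma> s) (g s) \<le> ereal (g s \<bullet> p - H (\<gamma> s) p)"
      proof eventually_elim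
        case (elim s)
        show ?case
        proof
          assume s: "s \<in> {0..t}"
          define f where "f \<xi> = (\<xi> - p) \<bullet> g s - (H (\<gamma> s) \<xi> - H (\<gamma> s) p)" for \<xi>
          have f_cont: "continuous_on UNIV f" unfolding f_def by (intro continuous_intros cont_snd)
          have "f \<xi> \<le> 0" for \<xi>
          proof (rule ccontr)
            assume "\<not> f \<xi> \<le> 0"
            then have "\<xi> \<in> {\<xi>. 0 < f \<xi>}" by simp
            moreover have "open {\<xi>. 0 < f \<xi>}" using f_cont by (intro open_Collect_less) auto
            ultimately obtain d where "d \<in> D" "0 < f d" using D(2)[of "{\<xi>. 0 < f \<xi>}"] by blast
            moreover have "f d \<le> 0" if "d \<in> D" using elim that s by (simp add: f_def \<phi>_def)
            ultimately show False by force
          qed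
          then show "L (\<gamma> s) (g s) \<le> ereal (g s \<bullet> p - H (\<gamma> s) p)"
            by (intro L_le_of_subgradient) (simp add: f_def)
        qed
      qed
      then show "\<exists>\<gamma> g. \<gamma> t = y \<and> (\<forall>r\<in>{0..t}. \<forall>s\<in>{0..t}. norm (\<gamma> s - \<gamma> r) \<le> C * \<bar>s - r\<bar>) \<and>
          g \<in> borel_measurable borel \<and> set_integrable lborel {0..t} g \<and>
          (\<forall>s\<in>{0..t}. \<gamma> s = \<gamma> 0 + (LINT r:{0..s}|lborel. g r)) \<and>
          (AE s in lborel. s \<in> {0..t} \<longrightarrow> L (\<gamma> s) (g s) \<le> ereal (g s \<bullet> p - H (\<gamma> s) p))"
        using g \<gamma>_lip \<delta>(1) by (intro exI[of _ \<gamma>] exI[of _ g] conjI ballI) (auto simp: \<gamma>_def)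
    qed
  qed
qed

end

section \<open>The action along concatenated paths\<close>

lemma integral_le_nn_integral:
  fixes f :: "'a \<Rightarrow> real"
  assumes f: "integrable M f"
  shows "ereal (\<integral>x. f x \<partial>M) \<le> enn2ereal (\<integral>\<^sup>+x. ennreal (f x) \<partial>M)"
proof -
  have "(\<integral>\<^sup>+x. ennreal (f x) \<partial>M) = (\<integral>\<^sup>+x. ennreal (max 0 (f x)) \<partial>M)"
    by (intro nn_integral_cong) (auto simp: max_def ennreal_neg)
  also have "\<dots> = ennreal (\<integral>x. max 0 (f x) \<partial>M)"
    using f by (intro nn_integral_eq_integral) (auto intro!: integrable_max)
  finally have eq: "enn2ereal (\<integral>\<^sup>+x. ennreal (f x) \<partial>M) = ereal (\<integral>x. max 0 (f x) \<partial>M)"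
    by (simp add: enn2ereal_ennreal integral_nonneg)
  have "(\<integral>x. f x \<partial>M) \<le> (\<integral>x. max 0 (f x) \<partial>M)"
    using f by (intro integral_mono integrable_max) auto
  then show ?thesis unfolding eq by simp
qed

context dual_pair begin

text \<open>Integrate Fenchel-Young over \<open>{0..t}\<close>. As L is nonnegative, the bound
  survives replacing the integrand by its positive part, and the action after t can only
  add.\<close>

lemma action_lower_bound:
  assumes \<eta>: "has_velocity \<eta> g" and t: "0 \<le> t"
  shows "ereal ((\<eta> t - \<eta> 0) \<bullet> q - integral {0..t} (\<lambda>s. H (\<eta> s) q))
    \<le> enn2ereal (\<integral>\<^sup>+s\<in>{0..}. e2ennreal (L (\<eta> s) (g s)) \<partial>lborel)"
proof -
  have cont: "continuous_on {0..t} (\<lambda>s. H (\<eta> s) q)"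
    by (rule continuous_on_compose2[OF cont_fst continuous_on_subset[OF has_velocity_continuous[OF \<eta>]]]) auto
  note gt = has_velocityD[OF \<eta> t]
  define \<phi> where "\<phi> s = q \<bullet> g s - H (\<eta> s) q" for s
  have \<phi>: "set_integrable lborel {0..t} \<phi>"
    unfolding \<phi>_def by (intro set_integral_diff(1) set_integral_inner(1) gt set_integral_continuous(1) cont)
  have "(LINT s:{0..t}|lborel. \<phi> s) = (\<eta> t - \<eta> 0) \<bullet> q - integral {0..t} (\<lambda>s. H (\<eta> s) q)"
    unfolding \<phi>_def using gt
    by (subst set_integral_diff(2)[OF set_integral_inner(1)[OF gt(1)] set_integral_continuous(1)[OF cont]])
      (simp add: set_integral_inner(2)[OF gt(1)] set_integral_continuous(2)[OF cont] inner_commute)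
  moreover have b: "ereal (LINT s:{0..t}|lborel. \<phi> s) \<le> enn2ereal (\<integral>\<^sup>+s. ennreal (indicator {0..t} s *\<^sub>R \<phi> s) \<partial>lborel)"
    using \<phi> unfolding set_integrable_def set_lebesgue_integral_def by (rule integral_le_nn_integral)
  moreover have c: "(\<integral>\<^sup>+s. ennreal (indicator {0..t} s *\<^sub>R \<phi> s) \<partial>lborel) \<le>
      (\<integral>\<^sup>+s\<in>{0..}. e2ennreal (L (\<eta> s) (g s)) \<partial>lborel)"
  proof (rule nn_integral_mono)
    fix s
    have "ennreal (\<phi> s) \<le> e2ennreal (L (\<eta> s) (g s))"
      using e2ennreal_mono[OF fenchel[of "g s" q "\<eta> s"]] by (simp add: \<phi>_def inner_commute)
    then show "ennreal (indicator {0..t} s *\<^sub>R \<phi> s) \<le> e2ennreal (L (\<eta> s) (g s)) * indicator {0..} s"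
      by (auto simp: indicator_def)
  qed
  ultimately show ?thesis using order_trans[OF b c[unfolded less_eq_ennreal.rep_eq]] by simp
qed

text \<open>L is jointly lower semicontinuous, being a supremum over \<xi> of functions continuous
  in position and velocity; its sublevel sets are closed.\<close>

lemma L_measurable: "(\<lambda>w. L (fst w) (snd w)) \<in> borel_measurable borel"
  unfolding borel_measurable_iff_Iic_ereal
proof
  fix c :: ereal
  have "closed {w. ereal (snd w \<bullet> \<xi> - H (fst w) \<xi>) \<le> c}" for \<xi>
  proof (cases c)
    case (real r)
    have "continuous_on UNIV (\<lambda>w :: 'a \<times> 'a. snd w \<bullet> \<xi> - H (fst w) \<xi>)"
      by (intro continuous_intros continuous_on_compose2[OF cont_fst]) auto
    then show ?thesis using real by (auto intro!: closed_Collect_le)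
  qed auto
  then have "closed (\<Inter>\<xi>. {w. ereal (snd w \<bullet> \<xi> - H (fst w) \<xi>) \<le> c})" by auto
  moreover have "(\<lambda>w. L (fst w) (snd w)) -` {..c} \<inter> space borel = (\<Inter>\<xi>. {w. ereal (snd w \<bullet> \<xi> - H (fst w) \<xi>) \<le> c})"
    by (auto simp: L_eq legendre_def SUP_le_iff)
  ultimately show "(\<lambda>w. L (fst w) (snd w)) -` {..c} \<inter> space borel \<in> sets borel" by simp
qed

lemma action_integrand_measurable:
  assumes "has_velocity \<beta> b"
  shows "(\<lambda>s. e2ennreal (L (\<beta> s) (b s)) * indicator {0..} s) \<in> borel_measurable borel"
proof -
  \<comment> \<open>The path is controlled at nonnegative times only; freezing it at its initial
    value before 0 gives a function continuous on the line that agrees with it under the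
    indicator.\<close>
  have c: "continuous_on UNIV (\<lambda>s. \<beta> (max 0 s))"
    by (rule continuous_on_compose2[OF has_velocity_continuous[OF assms]]) (auto intro!: continuous_intros)
  have [measurable]: "(\<lambda>s. \<beta> (max 0 s)) \<in> borel_measurable borel"
    using borel_measurable_continuous_onI[OF c] .
  note [measurable] = velocity_measurable[OF assms]
  have "(\<lambda>s. (\<beta> (max 0 s), indicator {0..} s *\<^sub>R b s)) \<in> borel \<rightarrow>\<^sub>M borel" by measurable
  from measurable_compose[OF this L_measurable]
  have "(\<lambda>s. e2ennreal (L (\<beta> (max 0 s)) (indicator {0..} s *\<^sub>R b s)) * indicator {0..} s) \<in> borel_measurable borel"
    by simp
  moreover have "(\<lambda>s. e2ennreal (L (\<beta> (max 0 s)) (indicator {0..} s *\<^sub>R b s)) * indicator {0..} s) =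
      (\<lambda>s. e2ennreal (L (\<beta> s) (b s)) * indicator {0..} s)"
    by (auto simp: indicator_def max_def fun_eq_iff)
  ultimately show ?thesis by simp
qed

lemma lagrangian_rate_eq:
  assumes "has_velocity \<gamma> g"
  shows "lagrangian_rate I0 L \<gamma> = I0 (\<gamma> 0) + enn2ereal (\<integral>\<^sup>+s\<in>{0..}. e2ennreal (L (\<gamma> s) (g s)) \<partial>lborel)"
proof -
  have "(\<integral>\<^sup>+s\<in>{0..}. e2ennreal (L (\<gamma> s) (velocity \<gamma> s)) \<partial>lborel) = (\<integral>\<^sup>+s\<in>{0..}. e2ennreal (L (\<gamma> s) (g s)) \<partial>lborel)"
    using has_velocity_unique[OF has_velocity_velocity[OF assms] assms]
    by (intro nn_integral_cong_AE) (auto elim!: eventually_mono simp: indicator_def)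
  then show ?thesis using assms unfolding lagrangian_rate_def abs_cont_def by auto
qed

text \<open>On the segment the Lagrangian is at most \<phi>, whose integral is explicit; afterwards
  the cost is that of \<beta>, shifted in time. The bound holds for every \<open>I0\<close>, which
  enters through the starting point only.\<close>

lemma concatenate:
  assumes t: "0 < t" and g: "g \<in> borel_measurable borel" "set_integrable lborel {0..t} g"
    and \<gamma>: "\<And>s. s \<in> {0..t} \<Longrightarrow> \<gamma> s = \<gamma> 0 + (LINT r:{0..s}|lborel. g r)"
    and opt: "AE s in lborel. s \<in> {0..t} \<longrightarrow> L (\<gamma> s) (g s) \<le> ereal (g s \<bullet> p - H (\<gamma> s) p)"
    and \<beta>: "has_velocity \<beta> b" "\<beta> 0 = \<gamma> t"
  obtains \<Gamma> where "\<Gamma> \<in> cadlag" "\<And>s. s \<in> {0..t} \<Longrightarrow> \<Gamma> s = \<gamma> s"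
    "\<And>I0. lagrangian_rate I0 L \<Gamma> \<le> I0 (\<gamma> 0) + (ereal ((\<gamma> t - \<gamma> 0) \<bullet> p - integral {0..t} (\<lambda>s. H (\<gamma> s) p)) +
      enn2ereal (\<integral>\<^sup>+s\<in>{0..}. e2ennreal (L (\<beta> s) (b s)) \<partial>lborel))"
proof -
  \<comment> \<open>\<open>undefined\<close> at negative times is the default that
    \<open>extensional\<close> in \<open>cadlag\<close> prescribes.\<close>
  define \<Gamma> where "\<Gamma> s = (if s < 0 then undefined else if s \<le> t then \<gamma> s else \<beta> (s - t))" for s
  define G where "G s = (if s \<le> t then g s else b (s - t))" for s
  have \<Gamma>_eq: "\<Gamma> s = \<gamma> s" if "s \<in> {0..t}" for s using that by (simp add: \<Gamma>_def)
  have b_shift: "set_integrable lborel {t<..T} (\<lambda>s. b (s - t))"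
    "(LINT s:{t<..T}|lborel. b (s - t)) = (LINT s:{0..T - t}|lborel. b s)" if T: "t < T" for T
  proof -
    have int: "integrable lborel (\<lambda>s. indicator {0<..T - t} s *\<^sub>R b s)"
    proof -
      have "set_integrable lborel {0<..T - t} b"
        by (rule set_integrable_subset[OF has_velocityD(1)[OF \<beta>(1), of "T - t"]]) (use T in auto)
      then show ?thesis unfolding set_integrable_def .
    qed
    have eq: "indicator {0<..T - t} (- t + 1 * s) *\<^sub>R b (- t + 1 * s) = indicator {t<..T} s *\<^sub>R b (s - t)" for s
      by (auto simp: indicator_def)
    show "set_integrable lborel {t<..T} (\<lambda>s. b (s - t))"
      using lborel_integrable_real_affine[OF int, of 1 "- t"] unfolding eq set_integrable_def by simp
    have "(LINT s:{t<..T}|lborel. b (s - t)) = (\<integral>s. indicator {0<..T - t} s *\<^sub>R b s \<partial>lborel)"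
      unfolding set_lebesgue_integral_def
      by (subst lborel_integral_real_affine[of 1 _ "- t"]) (simp_all only: eq, simp_all)
    also have "\<dots> = (LINT s:{0..T - t}|lborel. b s)"
      unfolding set_lebesgue_integral_def
    proof (rule integral_cong_AE)
      show "AE s in lborel. indicator {0<..T - t} s *\<^sub>R b s = indicator {0..T - t} s *\<^sub>R b s"
        using AE_lborel_singleton[of 0] by eventually_elim (auto simp: indicator_def)
      show "(\<lambda>s. indicator {0<..T - t} s *\<^sub>R b s) \<in> borel_measurable lborel" using int by auto
      show "(\<lambda>s. indicator {0..T - t} s *\<^sub>R b s) \<in> borel_measurable lborel"
        using has_velocityD(1)[OF \<beta>(1), of "T - t"] T unfolding set_integrable_def by auto
    qed
    finally show "(LINT s:{t<..T}|lborel. b (s - t)) = (LINT s:{0..T - t}|lborel. b s)" .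
  qed
  have G1: "set_integrable lborel {0..T} G" "(LINT s:{0..T}|lborel. G s) = (LINT s:{0..T}|lborel. g s)"
    if "0 \<le> T" "T \<le> t" for T
  proof -
    have "(\<lambda>s. indicator {0..T} s *\<^sub>R G s) = (\<lambda>s. indicator {0..T} s *\<^sub>R g s)"
      using that by (auto simp: G_def indicator_def fun_eq_iff)
    moreover have "set_integrable lborel {0..T} g" by (rule set_integrable_subset[OF g(2)]) (use that in auto)
    ultimately show "set_integrable lborel {0..T} G" "(LINT s:{0..T}|lborel. G s) = (LINT s:{0..T}|lborel. g s)"
      unfolding set_integrable_def set_lebesgue_integral_def by (simp_all only:)
  qed
  have G2: "set_integrable lborel {t<..T} G" "(LINT s:{t<..T}|lborel. G s) = (LINT s:{0..T - t}|lborel. b s)"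
    if "t < T" for T
  proof -
    have "(\<lambda>s. indicator {t<..T} s *\<^sub>R G s) = (\<lambda>s. indicator {t<..T} s *\<^sub>R b (s - t))"
      by (auto simp: G_def indicator_def fun_eq_iff)
    then show "set_integrable lborel {t<..T} G" "(LINT s:{t<..T}|lborel. G s) = (LINT s:{0..T - t}|lborel. b s)"
      using b_shift[OF that] unfolding set_integrable_def set_lebesgue_integral_def by (simp_all only:)
  qed
  have vel: "has_velocity \<Gamma> G"
    unfolding has_velocity_def
  proof (intro allI impI)
    fix T :: real assume T: "0 \<le> T"
    show "set_integrable lborel {0..T} G \<and> \<Gamma> T = \<Gamma> 0 + (LINT s:{0..T}|lborel. G s)"
    proof (cases "T \<le> t")
      case True
      then show ?thesis using G1[OF T True] \<gamma>[of T] \<Gamma>_eq[of T] \<Gamma>_eq[of 0] T t by simp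
    next
      case False
      then have T': "t < T" by simp
      have "{0..T} = {0..t} \<union> {t<..T}" using T' t by auto
      moreover have "set_integrable lborel ({0..t} \<union> {t<..T}) G"
        using G1(1)[of t] G2(1)[OF T'] t by (intro set_integrable_Un) auto
      moreover have "(LINT s:{0..t} \<union> {t<..T}|lborel. G s) = (LINT s:{0..t}|lborel. g s) + (LINT s:{0..T - t}|lborel. b s)"
        using G1[of t] G2[OF T'] t by (subst set_integral_Un) auto
      moreover have "\<Gamma> T = \<beta> (T - t)" "\<Gamma> 0 = \<gamma> 0" using T' t by (auto simp: \<Gamma>_def)
      moreover have "\<beta> (T - t) = \<gamma> t + (LINT s:{0..T - t}|lborel. b s)"
        using has_velocityD(2)[OF \<beta>(1), of "T - t"] \<beta>(2) T' by simp
      moreover have "\<gamma> t = \<gamma> 0 + (LINT s:{0..t}|lborel. g s)" by (rule \<gamma>) (use t in auto)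
      ultimately show ?thesis by (simp add: add.assoc)
    qed
  qed
  have cad: "\<Gamma> \<in> cadlag"
    by (rule continuous_cadlag[OF _ has_velocity_continuous[OF vel]]) (auto simp: extensional_def \<Gamma>_def)
  define \<phi> where "\<phi> s = p \<bullet> g s - H (\<Gamma> s) p" for s
  have \<Gamma>_cont: "continuous_on {0..t} (\<lambda>s. H (\<Gamma> s) p)"
    by (rule continuous_on_compose2[OF cont_fst continuous_on_subset[OF has_velocity_continuous[OF vel]]]) auto
  have \<phi>: "set_integrable lborel {0..t} \<phi>"
    unfolding \<phi>_def by (intro set_integral_diff(1) set_integral_inner(1) g set_integral_continuous(1) \<Gamma>_cont)
  have \<phi>_val: "(LINT s:{0..t}|lborel. \<phi> s) = (\<gamma> t - \<gamma> 0) \<bullet> p - integral {0..t} (\<lambda>s. H (\<gamma> s) p)"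
  proof -
    have "integral {0..t} (\<lambda>s. H (\<Gamma> s) p) = integral {0..t} (\<lambda>s. H (\<gamma> s) p)"
      by (intro integral_cong) (simp add: \<Gamma>_eq)
    moreover have "\<gamma> t = \<gamma> 0 + (LINT s:{0..t}|lborel. g s)" by (rule \<gamma>) (use t in auto)
    ultimately show ?thesis
      unfolding \<phi>_def
      by (subst set_integral_diff(2)[OF set_integral_inner(1)[OF g(2)] set_integral_continuous(1)[OF \<Gamma>_cont]])
        (simp add: set_integral_inner(2)[OF g(2)] set_integral_continuous(2)[OF \<Gamma>_cont] inner_commute)
  qed
  have AE: "AE s in lborel. s \<in> {0..t} \<longrightarrow> L (\<Gamma> s) (G s) \<le> ereal (\<phi> s)"
    using opt by eventually_elim (auto simp: \<Gamma>_eq G_def \<phi>_def inner_commute)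
  \<comment> \<open>Where \<phi> dominates L it is nonnegative, so the passage to
    \<open>ennreal\<close> truncates nothing and the integral of \<phi> is recovered
    exactly.\<close>
  have \<phi>_nonneg: "AE s in lborel. 0 \<le> indicator {0..t} s *\<^sub>R \<phi> s"
    using AE
  proof eventually_elim
    case (elim s)
    show ?case
    proof (cases "s \<in> {0..t}")
      case True
      then have "0 \<le> ereal (\<phi> s)" using elim L_nonneg order_trans by blast
      then show ?thesis by (simp add: indicator_def)
    qed (auto simp: indicator_def)
  qed
  let ?F1 = "\<lambda>s. ennreal (indicator {0..t} s *\<^sub>R \<phi> s)"
  let ?F2 = "\<lambda>s. e2ennreal (L (\<beta> s) (b s)) * indicator {0..} s"
  have F1: "(\<integral>\<^sup>+s. ?F1 s \<partial>lborel) = ennreal (LINT s:{0..t}|lborel. \<phi> s)"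
    unfolding set_lebesgue_integral_def
    by (rule nn_integral_eq_integral[OF \<phi>[unfolded set_integrable_def] \<phi>_nonneg])
  have F2_meas: "?F2 \<in> borel_measurable borel" by (rule action_integrand_measurable[OF \<beta>(1)])
  have "(\<integral>\<^sup>+s\<in>{0..}. e2ennreal (L (\<Gamma> s) (G s)) \<partial>lborel) \<le> (\<integral>\<^sup>+s. ?F1 s + ?F2 (- t + 1 * s) \<partial>lborel)"
  proof (rule nn_integral_mono_AE)
    show "AE s in lborel. e2ennreal (L (\<Gamma> s) (G s)) * indicator {0..} s \<le> ?F1 s + ?F2 (- t + 1 * s)"
      using AE
    proof eventually_elim
      case (elim s)
      show ?case
      proof (cases "s \<le> t")
        case True
        show ?thesis
        proof (cases "0 \<le> s")
          case s: True
          then have "e2ennreal (L (\<Gamma> s) (G s)) \<le> e2ennreal (ereal (\<phi> s))"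
            using elim True by (intro e2ennreal_mono) auto
          then have "e2ennreal (L (\<Gamma> s) (G s)) * indicator {0..} s \<le> ?F1 s"
            using s True by (simp add: indicator_def)
          then show ?thesis by (rule order_trans) simp
        qed (simp add: indicator_def)
      next
        case False
        then have "e2ennreal (L (\<Gamma> s) (G s)) * indicator {0..} s = ?F2 (- t + 1 * s)"
          using t by (simp add: \<Gamma>_def G_def)
        then show ?thesis by simp
      qed
    qed
  qed
  also have "\<dots> = (\<integral>\<^sup>+s. ?F1 s \<partial>lborel) + (\<integral>\<^sup>+s. ?F2 (- t + 1 * s) \<partial>lborel)"
  proof (rule nn_integral_add)
    show "?F1 \<in> borel_measurable lborel" using \<phi> unfolding set_integrable_def by auto
    have "(\<lambda>s. - t + 1 * s) \<in> borel \<rightarrow>\<^sub>M borel" by measurable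
    from measurable_compose[OF this F2_meas] show "(\<lambda>s. ?F2 (- t + 1 * s)) \<in> borel_measurable lborel" by simp
  qed
  also have "(\<integral>\<^sup>+s. ?F2 (- t + 1 * s) \<partial>lborel) = (\<integral>\<^sup>+s. ?F2 s \<partial>lborel)"
    using nn_integral_real_affine[OF F2_meas, of 1 "- t"] by simp
  finally have "(\<integral>\<^sup>+s\<in>{0..}. e2ennreal (L (\<Gamma> s) (G s)) \<partial>lborel) \<le>
      ennreal (LINT s:{0..t}|lborel. \<phi> s) + (\<integral>\<^sup>+s. ?F2 s \<partial>lborel)" unfolding F1 .
  then have "enn2ereal (\<integral>\<^sup>+s\<in>{0..}. e2ennreal (L (\<Gamma> s) (G s)) \<partial>lborel) \<le>
      enn2ereal (ennreal (LINT s:{0..t}|lborel. \<phi> s) + (\<integral>\<^sup>+s. ?F2 s \<partial>lborel))"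
    by (simp only: less_eq_ennreal.rep_eq)
  also have "\<dots> = ereal (LINT s:{0..t}|lborel. \<phi> s) + enn2ereal (\<integral>\<^sup>+s. ?F2 s \<partial>lborel)"
    using integral_nonneg_AE[OF \<phi>_nonneg]
    by (simp add: plus_ennreal.rep_eq enn2ereal_ennreal set_lebesgue_integral_def)
  finally have cost: "enn2ereal (\<integral>\<^sup>+s\<in>{0..}. e2ennreal (L (\<Gamma> s) (G s)) \<partial>lborel) \<le>
      ereal ((\<gamma> t - \<gamma> 0) \<bullet> p - integral {0..t} (\<lambda>s. H (\<gamma> s) p)) + enn2ereal (\<integral>\<^sup>+s. ?F2 s \<partial>lborel)"
    unfolding \<phi>_val .
  show thesis
  proof (rule that[OF cad \<Gamma>_eq])
    fix I0 :: "'a \<Rightarrow> ereal"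
    have "\<Gamma> 0 = \<gamma> 0" using t by (intro \<Gamma>_eq) auto
    then show "lagrangian_rate I0 L \<Gamma> \<le> I0 (\<gamma> 0) + (ereal ((\<gamma> t - \<gamma> 0) \<bullet> p - integral {0..t} (\<lambda>s. H (\<gamma> s) p)) +
      enn2ereal (\<integral>\<^sup>+s\<in>{0..}. e2ennreal (L (\<beta> s) (b s)) \<partial>lborel))"
      unfolding lagrangian_rate_eq[OF vel] using cost by (intro add_mono) simp_all
  qed
qed

end

section \<open>Reversibility reflects the Hamiltonian\<close>

lemma GDERIV_unique:
  assumes "GDERIV f z :> D" "GDERIV f z :> D'" shows "D = D'"
proof -
  have "(\<lambda>h. h \<bullet> D) = (\<lambda>h. h \<bullet> D')"
    using assms unfolding gderiv_def by (rule has_derivative_unique)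
  then have "h \<bullet> D = h \<bullet> D'" for h by (rule fun_cong)
  then show ?thesis using vector_eq_ldot by blast
qed

lemma grad_eq: "GDERIV f z :> D \<Longrightarrow> grad f z = D"
  unfolding grad_def by (rule the_equality) (auto intro: GDERIV_unique)

lemma C1_grad:
  assumes "C1 f" shows "GDERIV f z :> grad f z" "continuous_on UNIV (grad f)"
proof -
  obtain D where D: "\<And>z. GDERIV f z :> D z" "continuous_on UNIV D" using assms unfolding C1_def by auto
  have "grad f = D" using grad_eq[OF D(1)] by auto
  then show "GDERIV f z :> grad f z" "continuous_on UNIV (grad f)" using D by auto
qed

lemma GDERIV_linear: "GDERIV (\<lambda>x. \<xi> \<bullet> x) z :> \<xi>"
  unfolding gderiv_def by (auto intro!: derivative_eq_intros simp: inner_commute)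

lemma C1_linear: "C1 (\<lambda>x. \<xi> \<bullet> x)"
  unfolding C1_def using GDERIV_linear by (intro exI[of _ "\<lambda>_. \<xi>"]) auto

text \<open>Mean value inequality for \<open>S x - x \<bullet> grad S z\<close>, whose derivative is
  small near z. Both points vary because the ends of the segment are near z but neither need be
  z.\<close>

lemma C1_strict_differentiable:
  fixes S :: "'a::euclidean_space \<Rightarrow> real"
  assumes S: "C1 S" and \<kappa>: "0 < \<kappa>"
  obtains r where "0 < r"
    "\<And>x y. x \<in> cball z r \<Longrightarrow> y \<in> cball z r \<Longrightarrow> \<bar>S x - S y - (x - y) \<bullet> grad S z\<bar> \<le> \<kappa> * norm (x - y)"
proof -
  have "continuous (at z) (grad S)" using C1_grad(2)[OF S] by (simp add: continuous_on_eq_continuous_within)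
  then obtain d where d: "0 < d" "\<And>x. dist x z < d \<Longrightarrow> dist (grad S x) (grad S z) < \<kappa>"
    using \<kappa> unfolding continuous_at_eps_delta by metis
  show thesis
  proof (rule that[of "d / 2"])
    fix x y assume xy: "x \<in> cball z (d / 2)" "y \<in> cball z (d / 2)"
    have "norm ((S x - x \<bullet> grad S z) - (S y - y \<bullet> grad S z)) \<le> \<kappa> * norm (x - y)"
    proof (rule differentiable_bound[OF convex_cball[of z "d / 2"] _ _ xy])
      fix w assume w: "w \<in> cball z (d / 2)"
      have "((\<lambda>x. S x - x \<bullet> grad S z) has_derivative (\<lambda>h. h \<bullet> grad S w - h \<bullet> grad S z)) (at w)"
        using C1_grad(1)[OF S, of w] unfolding gderiv_def by (auto intro!: derivative_eq_intros)
      then show "((\<lambda>x. S x - x \<bullet> grad S z) has_derivative (\<lambda>h. h \<bullet> grad S w - h \<bullet> grad S z)) (at w within cball z (d / 2))"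
        by (rule has_derivative_at_withinI)
      have "norm (grad S w - grad S z) \<le> \<kappa>"
        using d(2)[of w] w d(1) by (simp add: dist_commute dist_norm[symmetric] less_imp_le)
      show "onorm (\<lambda>h. h \<bullet> grad S w - h \<bullet> grad S z) \<le> \<kappa>"
      proof (rule onorm_bound)
        fix h
        have "norm (h \<bullet> grad S w - h \<bullet> grad S z) \<le> norm h * norm (grad S w - grad S z)"
          by (simp add: inner_diff_right[symmetric] Cauchy_Schwarz_ineq2)
        also have "\<dots> \<le> norm h * \<kappa>" using \<open>norm (grad S w - grad S z) \<le> \<kappa>\<close> by (intro mult_left_mono) auto
        finally show "norm (h \<bullet> grad S w - h \<bullet> grad S z) \<le> \<kappa> * norm h" by (simp add: mult.commute)
      qed (use \<kappa> in simp)
    qed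
    then show "\<bar>S x - S y - (x - y) \<bullet> grad S z\<bar> \<le> \<kappa> * norm (x - y)"
      by (simp add: inner_diff_left algebra_simps)
  qed (use d in simp)
qed

lemma nonpos_of_small:
  fixes a b d :: real
  assumes d: "0 < d" and le: "\<And>\<delta>. 0 < \<delta> \<Longrightarrow> \<delta> < d \<Longrightarrow> a \<le> b * \<delta>"
  shows "a \<le> 0"
proof (rule tendsto_lowerbound)
  have "((\<lambda>\<delta>. b * \<delta>) \<longlongrightarrow> b * 0) (at_right 0)" by (intro tendsto_intros)
  then show "((\<lambda>\<delta>. b * \<delta>) \<longlongrightarrow> 0) (at_right 0)" by simp
  show "\<forall>\<^sub>F \<delta> in at_right 0. a \<le> b * \<delta>"
    unfolding eventually_at_right_field using d le by auto
qed simp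

text \<open>The level set is compact and nonempty, so it has a least element; a larger value before
  it would force a still earlier crossing.\<close>

lemma first_exit:
  fixes f :: "real \<Rightarrow> real"
  assumes f: "continuous_on {a..b} f" and ab: "a \<le> b" and r: "f a \<le> r" "r \<le> f b"
  obtains \<tau> where "\<tau> \<in> {a..b}" "f \<tau> = r" "\<And>s. s \<in> {a..\<tau>} \<Longrightarrow> f s \<le> r"
proof -
  let ?A = "{s \<in> {a..b}. f s = r}"
  have "closed ?A" by (rule continuous_closed_preimage_constant[OF f]) simp
  moreover have "bounded ?A" by (rule bounded_subset[OF bounded_closed_interval[of a b]]) auto
  ultimately have A: "compact ?A" by (simp add: compact_eq_bounded_closed)
  have "?A \<noteq> {}" using IVT'[OF r ab f] by auto
  from compact_attains_inf[OF A this] obtain \<tau> where \<tau>: "\<tau> \<in> ?A" "\<forall>s\<in>?A. \<tau> \<le> s"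
    by (rule bexE)
  show thesis
  proof (rule that[of \<tau>])
    fix s assume s: "s \<in> {a..\<tau>}"
    show "f s \<le> r"
    proof (rule ccontr)
      assume "\<not> f s \<le> r"
      then obtain x where x: "a \<le> x" "x \<le> s" "f x = r"
        using IVT'[of f a r s] r(1) s \<tau>(1) continuous_on_subset[OF f, of "{a..s}"] by auto
      moreover have "x \<le> b" using x s \<tau>(1) by simp
      ultimately have "\<tau> \<le> x" using \<tau>(2) by simp
      then have "x = s" using x s by simp
      with x \<open>\<not> f s \<le> r\<close> show False by simp
    qed
  qed (use \<tau> in auto)
qed

lemma integral_bounds:
  fixes f :: "real \<Rightarrow> real"
  assumes f: "continuous_on {a..b} f" and ab: "a \<le> b"
  shows "(\<And>s. s \<in> {a..b} \<Longrightarrow> f s \<le> c) \<Longrightarrow> integral {a..b} f \<le> (b - a) * c"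
    "(\<And>s. s \<in> {a..b} \<Longrightarrow> c \<le> f s) \<Longrightarrow> (b - a) * c \<le> integral {a..b} f"
proof -
  have c: "integral {a..b} (\<lambda>_. c) = (b - a) * c" using ab by (simp add: content_real)
  have i: "f integrable_on {a..b}" using f by (rule integrable_continuous_real)
  show "integral {a..b} f \<le> (b - a) * c" if "\<And>s. s \<in> {a..b} \<Longrightarrow> f s \<le> c"
    unfolding c[symmetric] using i that by (intro integral_le) auto
  show "(b - a) * c \<le> integral {a..b} f" if "\<And>s. s \<in> {a..b} \<Longrightarrow> c \<le> f s"
    unfolding c[symmetric] using i that by (intro integral_le) auto
qed

text \<open>\<open>LDP_lagrangian\<close> leaves the initial rate existentially quantified;
  uniqueness of rate functions pins it to I.\<close>

lemma LDP_lagrangian_initial: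
  assumes Q: "LDP_lagrangian Q L" and I: "LDP euclidean (\<lambda>n. initial_law (Q n)) I"
  shows "LDP skorokhod Q (lagrangian_rate I L)"
  using Q LDP_rate_unique[OF _ I] unfolding LDP_lagrangian_def by blast

lemma finite_rateE:
  assumes "lagrangian_rate (\<lambda>z. ereal (S z)) L \<gamma> < ereal c"
  obtains g A where "has_velocity \<gamma> g" "0 \<le> A" "S (\<gamma> 0) + A < c"
    "enn2ereal (\<integral>\<^sup>+s\<in>{0..}. e2ennreal (L (\<gamma> s) (g s)) \<partial>lborel) = ereal A"
proof -
  have "abs_cont \<gamma>" using assms unfolding lagrangian_rate_def by (auto split: if_splits)
  then have vel: "has_velocity \<gamma> (velocity \<gamma>)" unfolding abs_cont_def using has_velocity_velocity by blast
  let ?A = "enn2ereal (\<integral>\<^sup>+s\<in>{0..}. e2ennreal (L (\<gamma> s) (velocity \<gamma> s)) \<partial>lborel)"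
  have "ereal (S (\<gamma> 0)) + ?A < ereal c"
    using assms \<open>abs_cont \<gamma>\<close> unfolding lagrangian_rate_def by simp
  moreover have "0 \<le> ?A" by simp
  ultimately obtain A where A: "?A = ereal A" "0 \<le> A" "S (\<gamma> 0) + A < c"
    by (cases ?A) auto
  show thesis by (rule that[OF vel A(2,3,1)])
qed

context dual_pair begin

text \<open>
  Run the optimal segment for \<open>p\<close> backwards from the starting point of an almost free path and
  continue along that path. Exchangeability of the times \<open>0\<close> and \<open>t\<close> provides an equally cheap path
  that traverses the segment in the opposite direction; bounding its cost from below with the dual
  variable \<open>dS - p\<close> and letting the segment shrink compares the two values of the Hamiltonian.
\<close>

lemma hamiltonian_reflection_le:
  assumes ldp: "LDP skorokhod Q (lagrangian_rate (\<lambda>z. ereal (S z)) L)"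
    and init: "LDP euclidean (\<lambda>n. initial_law (Q n)) (\<lambda>z. ereal (S z))" and S: "C1 S"
    and exch: "\<And>n t B C. 0 \<le> t \<Longrightarrow> B \<in> sets borel \<Longrightarrow> C \<in> sets borel \<Longrightarrow>
      measure (Q n) {\<gamma>\<in>space (Q n). \<gamma> 0 \<in> B \<and> \<gamma> t \<in> C} = measure (Q n) {\<gamma>\<in>space (Q n). \<gamma> t \<in> B \<and> \<gamma> 0 \<in> C}"
  shows "H z p \<le> H z (grad S z - p)"
proof -
  define q where "q = grad S z - p"
  have pq: "grad S z = p + q" by (simp add: q_def)
  obtain C where C: "0 \<le> C" and segment: "\<And>y t. y \<in> cball z (1/2) \<Longrightarrow> 0 < t \<Longrightarrow> C * t \<le> 1/2 \<Longrightarrow>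
      \<exists>\<gamma> g. \<gamma> t = y \<and> (\<forall>r\<in>{0..t}. \<forall>s\<in>{0..t}. norm (\<gamma> s - \<gamma> r) \<le> C * \<bar>s - r\<bar>) \<and>
        g \<in> borel_measurable borel \<and> set_integrable lborel {0..t} g \<and>
        (\<forall>s\<in>{0..t}. \<gamma> s = \<gamma> 0 + (LINT r:{0..s}|lborel. g r)) \<and>
        (AE s in lborel. s \<in> {0..t} \<longrightarrow> L (\<gamma> s) (g s) \<le> ereal (g s \<bullet> p - H (\<gamma> s) p))"
    using backward_optimal_segment[of z p] by blast
  \<comment> \<open>The dual ball contains p and every unit vector; the latter will test how far a
    path can travel.\<close>
  obtain M where M: "0 \<le> M" "\<And>w \<xi>. w \<in> cball z 1 \<Longrightarrow> \<xi> \<in> cball 0 (norm p + 1) \<Longrightarrow> \<bar>H w \<xi>\<bar> \<le> M"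
    using H_bounded[of z 1 0 "norm p + 1"] by blast
  have near: "H z p - H z q - 2 * \<kappa> - \<kappa> * C \<le> 0" if \<kappa>: "0 < \<kappa>" for \<kappa>
  proof -
    have H_near: "\<exists>d>0. \<forall>w. dist w z < d \<longrightarrow> \<bar>H w \<xi> - H z \<xi>\<bar> < \<kappa>" for \<xi>
      using cont_fst[of \<xi>] \<kappa> unfolding continuous_on_iff dist_real_def by auto
    obtain d1 where d1: "0 < d1" "\<And>w. dist w z < d1 \<Longrightarrow> \<bar>H w p - H z p\<bar> < \<kappa>" using H_near by blast
    obtain d2 where d2: "0 < d2" "\<And>w. dist w z < d2 \<Longrightarrow> \<bar>H w q - H z q\<bar> < \<kappa>" using H_near by blast
    obtain d3 where d3: "0 < d3" "\<And>x y. x \<in> cball z d3 \<Longrightarrow> y \<in> cball z d3 \<Longrightarrow>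
        \<bar>S x - S y - (x - y) \<bullet> (p + q)\<bar> \<le> \<kappa> * norm (x - y)"
      using C1_strict_differentiable[OF S \<kappa>, of z] unfolding pq by blast
    define r where "r = min (1/2) (min (d1 / 2) (min (d2 / 2) d3))"
    have r: "0 < r" "r \<le> 1/2" "r < d1" "r < d2" "r \<le> d3" using d1 d2 d3 by (auto simp: r_def min_def)
    have Hp: "\<bar>H w p - H z p\<bar> < \<kappa>" and Hq: "\<bar>H w q - H z q\<bar> < \<kappa>" if "w \<in> cball z r" for w
      using d1(2)[of w] d2(2)[of w] that r by (auto simp: dist_commute)
    have S_diff: "\<bar>S x - S y - (x - y) \<bullet> (p + q)\<bar> \<le> \<kappa> * norm (x - y)" if "x \<in> cball z r" "y \<in> cball z r" for x y
      using d3(2)[of x y] that r by auto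
    define K where "K = norm (p + q) + \<kappa>"
    have K: "0 < K" using \<kappa> by (simp add: K_def add_nonneg_pos)
    have S_lip: "\<bar>S x - S y\<bar> \<le> K * norm (x - y)" if "x \<in> cball z r" "y \<in> cball z r" for x y
      using S_diff[OF that] Cauchy_Schwarz_ineq2[of "x - y" "p + q"] by (simp add: K_def algebra_simps)
    \<comment> \<open>J bundles every rate at which length or cost accumulates, so that
      \<open>J * t \<le> r / 8\<close>. The duration t depends on \<kappa> but not on \<delta>,
      which can therefore tend to 0 first.\<close>
    define J where "J = C + K * C + norm p * C + 2 * M"
    have J: "0 \<le> J" "C \<le> J" "K * C + norm p * C + 2 * M \<le> J" using C K M by (auto simp: J_def)
    define t where "t = r / (8 * (J + 1))"
    have t: "0 < t" using r J by (simp add: t_def)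
    have Jt: "J * t \<le> r / 8" using r J by (simp add: t_def field_simps)
    have Ct: "C * t \<le> r / 8" using mult_right_mono[OF J(2), of t] Jt t by linarith
    have small: "t * (H z p - H z q - 2 * \<kappa> - \<kappa> * C) \<le> (2 * K + 1 + 2 * norm q) * \<delta>"
      if \<delta>: "0 < \<delta>" "\<delta> < r / (8 * (K + 1))" for \<delta>
    proof -
      have K\<delta>: "(K + 1) * \<delta> \<le> r / 8" using \<delta> K by (simp add: field_simps)
      have "0 < K * \<delta>" using K \<delta> by simp
      then have \<delta>r: "\<delta> \<le> r / 8" using K\<delta> by (simp add: algebra_simps)
      have "ereal (S z) < ereal (S z + \<delta>)" using \<delta> by simp
      from cheap_path_near[OF ldp init this \<delta>(1)] obtain \<beta> where
        \<beta>: "dist (\<beta> 0) z \<le> \<delta>" "lagrangian_rate (\<lambda>z. ereal (S z)) L \<beta> < ereal (S z + \<delta>)" by blast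
      obtain b A\<beta> where b: "has_velocity \<beta> b" "S (\<beta> 0) + A\<beta> < S z + \<delta>"
        "enn2ereal (\<integral>\<^sup>+s\<in>{0..}. e2ennreal (L (\<beta> s) (b s)) \<partial>lborel) = ereal A\<beta>"
        using finite_rateE[OF \<beta>(2)] by metis
      define y where "y = \<beta> 0"
      have yz: "dist y z \<le> \<delta>" using \<beta>(1) by (simp add: y_def)
      \<comment> \<open>The whole rate of \<beta> is below \<open>S z + \<delta>\<close>, and
        \<open>S y\<close> accounts for all of \<open>S z\<close> up to \<open>K * \<delta>\<close>;
        hence the action left to \<beta> is small.\<close>
      have "\<bar>S z - S y\<bar> \<le> K * norm (z - y)"
        using yz \<delta>r r by (intro S_lip) (auto simp: dist_commute)
      also have "\<dots> \<le> K * \<delta>" using yz K by (intro mult_left_mono) (auto simp: dist_norm norm_minus_commute)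
      finally have A\<beta>: "A\<beta> < (K + 1) * \<delta>" using b(2) by (simp add: y_def algebra_simps)
      have "y \<in> cball z (1/2)" "C * t \<le> 1/2" using yz \<delta>r r Ct by (auto simp: dist_commute)
      from segment[OF this(1) t this(2)] obtain \<gamma> g where \<gamma>: "\<gamma> t = y"
        and \<gamma>_lip: "\<And>u s. u \<in> {0..t} \<Longrightarrow> s \<in> {0..t} \<Longrightarrow> norm (\<gamma> s - \<gamma> u) \<le> C * \<bar>s - u\<bar>"
        and g: "g \<in> borel_measurable borel" "set_integrable lborel {0..t} g"
        and \<gamma>_int: "\<And>s. s \<in> {0..t} \<Longrightarrow> \<gamma> s = \<gamma> 0 + (LINT r:{0..s}|lborel. g r)"
        and opt: "AE s in lborel. s \<in> {0..t} \<longrightarrow> L (\<gamma> s) (g s) \<le> ereal (g s \<bullet> p - H (\<gamma> s) p)"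
        by blast
      obtain \<Gamma> where \<Gamma>: "\<Gamma> \<in> cadlag" "\<And>s. s \<in> {0..t} \<Longrightarrow> \<Gamma> s = \<gamma> s"
        "\<And>I0. lagrangian_rate I0 L \<Gamma> \<le> I0 (\<gamma> 0) + (ereal ((\<gamma> t - \<gamma> 0) \<bullet> p - integral {0..t} (\<lambda>s. H (\<gamma> s) p)) +
          enn2ereal (\<integral>\<^sup>+s\<in>{0..}. e2ennreal (L (\<beta> s) (b s)) \<partial>lborel))"
      proof -
        have "\<beta> 0 = \<gamma> t" by (simp add: \<gamma> y_def)
        from concatenate[OF t g \<gamma>_int opt b(1) this] show thesis using that by blast
      qed
      have \<gamma>_y: "norm (\<gamma> s - y) \<le> C * t" if "s \<in> {0..t}" for s
      proof -
        have "norm (\<gamma> s - \<gamma> t) \<le> C * \<bar>s - t\<bar>" using that t by (intro \<gamma>_lip) auto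
        also have "\<dots> \<le> C * t" using that C by (intro mult_left_mono) auto
        finally show ?thesis by (simp add: \<gamma>)
      qed
      have \<gamma>_r: "\<gamma> s \<in> cball z r" if "s \<in> {0..t}" for s
        using \<gamma>_y[OF that] yz \<delta>r Ct r dist_triangle[of z "\<gamma> s" y] by (simp add: dist_norm norm_minus_commute)
      have "C-lipschitz_on {0..t} \<gamma>"
        using \<gamma>_lip C by (intro lipschitz_onI) (auto simp: dist_norm)
      then have "continuous_on {0..t} \<gamma>" by (rule lipschitz_on_continuous_on)
      then have H\<gamma>: "continuous_on {0..t} (\<lambda>s. H (\<gamma> s) \<xi>)" for \<xi>
        by (rule continuous_on_compose2[OF cont_fst]) auto
      define E where "E = (y - \<gamma> 0) \<bullet> p - integral {0..t} (\<lambda>s. H (\<gamma> s) p)"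
      have zero_in: "0 \<in> {0..t}" "t \<in> {0..t}" using t by auto
      have E1: "E \<le> (y - \<gamma> 0) \<bullet> p - t * (H z p - \<kappa>)"
      proof -
        have "H z p - \<kappa> \<le> H (\<gamma> s) p" if "s \<in> {0..t}" for s
          using Hp[OF \<gamma>_r[OF that]] unfolding abs_less_iff by linarith
        then show ?thesis using integral_bounds(2)[OF H\<gamma>[of p], of "H z p - \<kappa>"] t by (simp add: E_def)
      qed
      have cb1: "w \<in> cball z 1" if "w \<in> cball z r" for w using that r by auto
      \<comment> \<open>This crude bound by M serves to confine the partner path; the sharp bound
        \<open>E1\<close> is kept for the final comparison.\<close>
      have E2: "E \<le> norm p * (C * t) + t * M"
      proof -
        have "- M \<le> H (\<gamma> s) p" if "s \<in> {0..t}" for s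
          using M(2)[of "\<gamma> s" p] cb1[OF \<gamma>_r[OF that]] by (auto simp: abs_le_iff)
        then have "- (t * M) \<le> integral {0..t} (\<lambda>s. H (\<gamma> s) p)"
          using integral_bounds(2)[OF H\<gamma>[of p], of "- M"] t by simp
        moreover have "(y - \<gamma> 0) \<bullet> p \<le> norm p * (C * t)"
        proof -
          have "(y - \<gamma> 0) \<bullet> p \<le> norm (y - \<gamma> 0) * norm p" by (rule norm_cauchy_schwarz)
          also have "\<dots> \<le> (C * t) * norm p"
            using \<gamma>_y[OF zero_in(1)] by (intro mult_right_mono) (auto simp: norm_minus_commute)
          finally show ?thesis by (simp add: mult.commute)
        qed
        ultimately show ?thesis by (simp add: E_def)
      qed
      define c where "c = S (\<gamma> 0) + E + (K + 1) * \<delta>"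
      have \<Gamma>c: "lagrangian_rate (\<lambda>z. ereal (S z)) L \<Gamma> < ereal c"
      proof (rule order.strict_trans1[OF \<Gamma>(3)])
        show "ereal (S (\<gamma> 0)) + (ereal ((\<gamma> t - \<gamma> 0) \<bullet> p - integral {0..t} (\<lambda>s. H (\<gamma> s) p)) +
            enn2ereal (\<integral>\<^sup>+s\<in>{0..}. e2ennreal (L (\<beta> s) (b s)) \<partial>lborel)) < ereal c"
          unfolding b(3) using A\<beta> by (simp add: c_def E_def \<gamma>)
      qed
      \<comment> \<open>The balls change places between the open and the closed event: \<Gamma> runs
        from \<open>\<gamma> 0\<close> to y, its partner \<eta> from near y to near
        \<open>\<gamma> 0\<close>.\<close>
      obtain \<eta> where \<eta>: "\<eta> 0 \<in> cball y \<delta>" "\<eta> t \<in> cball (\<gamma> 0) \<delta>"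
        "lagrangian_rate (\<lambda>z. ereal (S z)) L \<eta> < ereal c"
      proof (rule path_transfer[OF ldp, of 0 t 0 t "ball (\<gamma> 0) \<delta>" "ball y \<delta>" "cball y \<delta>" "cball (\<gamma> 0) \<delta>" \<Gamma> "ereal c"])
        fix n
        interpret prob_space "Q n" by (rule LDP_paths[OF ldp])
        have ev: "(\<lambda>\<gamma>. \<gamma> u) \<in> Q n \<rightarrow>\<^sub>M borel" if "0 \<le> u" for u
          using eval_measurable[OF that] measurable_cong_sets[OF LDP_paths(2)[OF ldp] HOL.refl] by blast
        note [measurable] = ev[OF order_refl] ev[OF less_imp_le[OF t]]
        have "measure (Q n) {x\<in>space (Q n). x 0 \<in> ball (\<gamma> 0) \<delta> \<and> x t \<in> ball y \<delta>} =
            measure (Q n) {x\<in>space (Q n). x t \<in> ball (\<gamma> 0) \<delta> \<and> x 0 \<in> ball y \<delta>}"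
          using t by (intro exch) auto
        also have "\<dots> \<le> measure (Q n) {x\<in>space (Q n). x 0 \<in> cball y \<delta> \<and> x t \<in> cball (\<gamma> 0) \<delta>}"
          by (rule finite_measure_mono) (auto simp: less_imp_le)
        finally show "measure (Q n) {x\<in>space (Q n). x 0 \<in> ball (\<gamma> 0) \<delta> \<and> x t \<in> ball y \<delta>} \<le>
            measure (Q n) {x\<in>space (Q n). x 0 \<in> cball y \<delta> \<and> x t \<in> cball (\<gamma> 0) \<delta>}" .
      qed (use t \<delta> \<Gamma>(1) \<Gamma>(2)[OF zero_in(1)] \<Gamma>(2)[OF zero_in(2)] \<Gamma>c \<gamma> in auto)
      obtain v A where v: "has_velocity \<eta> v" "0 \<le> A" "S (\<eta> 0) + A < c"
        "enn2ereal (\<integral>\<^sup>+s\<in>{0..}. e2ennreal (L (\<eta> s) (v s)) \<partial>lborel) = ereal A"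
        using finite_rateE[OF \<eta>(3)] by metis
      have lower: "(\<eta> u - \<eta> 0) \<bullet> \<xi> - integral {0..u} (\<lambda>s. H (\<eta> s) \<xi>) \<le> A" if "0 \<le> u" for u \<xi>
        using action_lower_bound[OF v(1) that, of \<xi>] unfolding v(4) by simp
      note \<eta>_cont = has_velocity_continuous[OF v(1)]
      have H\<eta>: "continuous_on {0..u} (\<lambda>s. H (\<eta> s) \<xi>)" for u \<xi>
        by (rule continuous_on_compose2[OF cont_fst continuous_on_subset[OF \<eta>_cont]]) auto
      have \<eta>0: "dist z (\<eta> 0) \<le> r / 4"
        using \<eta>(1) yz \<delta>r dist_triangle[of z "\<eta> 0" y] by (simp add: dist_commute)
      then have \<eta>0_r: "\<eta> 0 \<in> cball z r" using r by simp
      have y_r: "y \<in> cball z r" using \<gamma>_r[OF zero_in(2)] \<gamma> by simp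
      have S\<eta>: "S y - K * \<delta> \<le> S (\<eta> 0)"
      proof -
        have "\<bar>S y - S (\<eta> 0)\<bar> \<le> K * norm (y - \<eta> 0)" by (rule S_lip[OF y_r \<eta>0_r])
        also have "\<dots> \<le> K * \<delta>" using \<eta>(1) K by (intro mult_left_mono) (auto simp: dist_norm)
        finally show ?thesis by (simp add: abs_le_iff)
      qed
      \<comment> \<open>H is controlled near z only, so \<eta> must be confined. At a first exit it
        has moved at least \<open>3 * r / 4\<close>; testing its action with the unit vector along
        this displacement gives \<open>3 * r / 4 \<le> A + t * M\<close>, while t and \<delta> are
        so small that the right side is below \<open>3 * r / 8\<close>.\<close>
      have stay: "dist z (\<eta> s) < r" if s: "s \<in> {0..t}" for s
      proof (rule ccontr)
        assume "\<not> dist z (\<eta> s) < r"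
        then have ge: "r \<le> dist z (\<eta> s)" by simp
        have dc: "continuous_on {0..s} (\<lambda>u. dist z (\<eta> u))"
          by (intro continuous_intros continuous_on_subset[OF \<eta>_cont]) auto
        obtain \<tau> where \<tau>: "\<tau> \<in> {0..s}" "dist z (\<eta> \<tau>) = r" "\<And>u. u \<in> {0..\<tau>} \<Longrightarrow> dist z (\<eta> u) \<le> r"
          using first_exit[OF dc _ _ ge] \<eta>0 s r by auto
        define e where "e = sgn (\<eta> \<tau> - \<eta> 0)"
        have ne: "norm (\<eta> \<tau> - \<eta> 0) \<ge> 3 * r / 4"
          using dist_triangle[of z "\<eta> \<tau>" "\<eta> 0"] \<tau>(2) \<eta>0 by (simp add: dist_norm norm_minus_commute)
        have "(\<eta> \<tau> - \<eta> 0) \<bullet> e = norm (\<eta> \<tau> - \<eta> 0)"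
          unfolding e_def by (cases "\<eta> \<tau> = \<eta> 0")
            (simp_all add: sgn_div_norm power2_norm_eq_inner[symmetric] power2_eq_square)
        moreover have "integral {0..\<tau>} (\<lambda>s. H (\<eta> s) e) \<le> (\<tau> - 0) * M"
        proof (rule integral_bounds(1)[OF H\<eta>])
          fix u assume "u \<in> {0..\<tau>}"
          then have "dist z (\<eta> u) \<le> r" by (rule \<tau>(3))
          then have "\<eta> u \<in> cball z 1" using r by simp
          moreover have "e \<in> cball 0 (norm p + 1)" by (simp add: e_def norm_sgn)
          ultimately show "H (\<eta> u) e \<le> M" using M(2)[of "\<eta> u" e] by (simp add: abs_le_iff)
        qed (use \<tau> in auto)
        moreover have "(\<tau> - 0) * M \<le> t * M" using \<tau> s M by (intro mult_right_mono) auto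
        ultimately have "3 * r / 4 - t * M \<le> A" using lower[of \<tau> e] \<tau> ne by simp
        moreover have "A < K * (C * t) + 2 * (K * \<delta>) + \<delta> + norm p * (C * t) + t * M"
        proof -
          have "\<bar>S (\<gamma> 0) - S y\<bar> \<le> K * norm (\<gamma> 0 - y)" by (rule S_lip[OF \<gamma>_r[OF zero_in(1)] y_r])
          also have "\<dots> \<le> K * (C * t)" using \<gamma>_y[OF zero_in(1)] K by (intro mult_left_mono) auto
          finally have "S (\<gamma> 0) \<le> S y + K * (C * t)" by (simp add: abs_le_iff)
          then show ?thesis using v(3) S\<eta> E2 by (simp add: c_def algebra_simps)
        qed
        moreover have "K * (C * t) + norm p * (C * t) + 2 * (t * M) \<le> r / 8"
          using mult_right_mono[OF J(3), of t] Jt t by (simp add: algebra_simps)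
        moreover have "K * \<delta> + \<delta> \<le> r / 8" using K\<delta> by (simp add: algebra_simps)
        ultimately show False using r \<delta> by linarith
      qed
      have "integral {0..t} (\<lambda>s. H (\<eta> s) q) \<le> (t - 0) * (H z q + \<kappa>)"
      proof (rule integral_bounds(1)[OF H\<eta>])
        fix s assume "s \<in> {0..t}"
        then have "\<eta> s \<in> cball z r" using stay by (simp add: less_imp_le)
        from Hq[OF this] show "H (\<eta> s) q \<le> H z q + \<kappa>" unfolding abs_less_iff by linarith
      qed (use t in simp)
      then have "(\<eta> t - \<eta> 0) \<bullet> q - t * (H z q + \<kappa>) \<le> A" using lower[of t q] t by simp
      moreover have "(\<gamma> 0 - y) \<bullet> q - 2 * (norm q * \<delta>) \<le> (\<eta> t - \<eta> 0) \<bullet> q"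
      proof -
        have "((\<gamma> 0 - y) - (\<eta> t - \<eta> 0)) \<bullet> q \<le> norm ((\<gamma> 0 - \<eta> t) + (\<eta> 0 - y)) * norm q"
          using norm_cauchy_schwarz[of "(\<gamma> 0 - y) - (\<eta> t - \<eta> 0)" q] by (simp add: algebra_simps)
        also have "\<dots> \<le> (2 * \<delta>) * norm q"
        proof (rule mult_right_mono)
          show "norm ((\<gamma> 0 - \<eta> t) + (\<eta> 0 - y)) \<le> 2 * \<delta>"
            using norm_triangle_ineq[of "\<gamma> 0 - \<eta> t" "\<eta> 0 - y"] \<eta>(1,2) by (simp add: dist_norm norm_minus_commute)
        qed simp
        finally show ?thesis by (simp add: inner_diff_left algebra_simps)
      qed
      \<comment> \<open>The displacement terms with p and with q combine to
        \<open>p + q = grad S z\<close> and cancel against the difference of S. The remainder is of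
        order t, but with the free factor \<kappa>.\<close>
      moreover have "S (\<gamma> 0) - S y + (y - \<gamma> 0) \<bullet> (p + q) \<le> \<kappa> * (C * t)"
      proof -
        have "\<bar>S (\<gamma> 0) - S y - (\<gamma> 0 - y) \<bullet> (p + q)\<bar> \<le> \<kappa> * norm (\<gamma> 0 - y)"
          by (rule S_diff[OF \<gamma>_r[OF zero_in(1)] y_r])
        also have "\<dots> \<le> \<kappa> * (C * t)" using \<gamma>_y[OF zero_in(1)] \<kappa> by (intro mult_left_mono) auto
        finally show ?thesis by (simp add: inner_diff_left abs_le_iff)
      qed
      ultimately show ?thesis
        using v(3) S\<eta> E1 by (simp add: c_def inner_diff_left inner_add_right algebra_simps)
    qed
    \<comment> \<open>\<delta> tends to 0 with t fixed; the factor t is divided out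
      afterwards.\<close>
    have "t * (H z p - H z q - 2 * \<kappa> - \<kappa> * C) \<le> 0"
      by (rule nonpos_of_small[OF _ small]) (use r K in auto)
    then show ?thesis using t by (simp add: mult_le_0_iff)
  qed
  have "H z p - H z q \<le> 0"
  proof (rule nonpos_of_small[of 1])
    show "H z p - H z q \<le> (2 + C) * \<kappa>" if "0 < \<kappa>" for \<kappa>
      using near[OF that] by (simp add: algebra_simps)
  qed simp
  then show ?thesis by (simp add: q_def)
qed

end

section \<open>Stationarity makes the drift orthogonal to the entropy gradient\<close>

text \<open>The speed bound is available only while the path is in the ball, so it is applied up to
  the first exit: starting within r/2 and moving at most r/4, the path cannot have reached distance
  r. An anchor at the final time is reduced to this case by running the path backwards.\<close>

lemma stays_in_cball:
  fixes x :: "real \<Rightarrow> 'a::euclidean_space"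
  assumes x: "continuous_on {0..t} x"
    and speed: "\<And>a b. 0 \<le> a \<Longrightarrow> a \<le> b \<Longrightarrow> b \<le> t \<Longrightarrow> (\<And>s. s \<in> {a..b} \<Longrightarrow> x s \<in> cball z r) \<Longrightarrow>
      norm (x b - x a) \<le> M * (b - a)"
    and M: "0 \<le> M" "M * t \<le> r / 4" and r: "0 < r"
    and anchor: "dist z (x 0) \<le> r / 2 \<or> dist z (x t) \<le> r / 2" and s: "s \<in> {0..t}"
  shows "x s \<in> cball z r"
proof -
  have start: "dist z (y s) \<le> r"
    if y: "continuous_on {0..t} y"
      and speed: "\<And>b. 0 \<le> b \<Longrightarrow> b \<le> t \<Longrightarrow> (\<And>s. s \<in> {0..b} \<Longrightarrow> y s \<in> cball z r) \<Longrightarrow> norm (y b - y 0) \<le> M * b"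
      and y0: "dist z (y 0) \<le> r / 2" and s: "s \<in> {0..t}" for y :: "real \<Rightarrow> 'a" and s
  proof (rule ccontr)
    assume "\<not> dist z (y s) \<le> r"
    then have ge: "r \<le> dist z (y s)" by simp
    have "continuous_on {0..s} (\<lambda>u. dist z (y u))"
      by (intro continuous_intros continuous_on_subset[OF y]) (use s in auto)
    from first_exit[OF this _ _ ge] obtain \<tau> where \<tau>: "\<tau> \<in> {0..s}" "dist z (y \<tau>) = r"
      "\<And>u. u \<in> {0..\<tau>} \<Longrightarrow> dist z (y u) \<le> r"
      using y0 r s by auto
    have "norm (y \<tau> - y 0) \<le> M * \<tau>" using \<tau> s by (intro speed) auto
    also have "\<dots> \<le> M * t" using \<tau> s M by (intro mult_left_mono) auto
    finally have "dist (y 0) (y \<tau>) \<le> r / 4" using M by (simp add: dist_norm norm_minus_commute)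
    then show False using dist_triangle[of z "y \<tau>" "y 0"] y0 \<tau>(2) r by linarith
  qed
  show ?thesis
  proof (cases "dist z (x 0) \<le> r / 2")
    case True
    have "dist z (x s) \<le> r"
      by (rule start[OF x _ True s]) (use speed[of 0] in auto)
    then show ?thesis by simp
  next
    case False
    then have xt: "dist z (x (t - 0)) \<le> r / 2" using anchor by simp
    have rev: "continuous_on {0..t} (\<lambda>u. x (t - u))"
      by (rule continuous_on_compose2[OF x]) (auto intro!: continuous_intros)
    have "dist z (x (t - (t - s))) \<le> r"
    proof (rule start[OF rev _ xt])
      fix b assume b: "0 \<le> b" "b \<le> t" and in_ball: "\<And>s. s \<in> {0..b} \<Longrightarrow> x (t - s) \<in> cball z r"
      have "norm (x t - x (t - b)) \<le> M * (t - (t - b))"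
      proof (rule speed)
        fix u assume "u \<in> {t - b..t}"
        then show "x u \<in> cball z r" using in_ball[of "t - u"] by auto
      qed (use b in auto)
      then show "norm (x (t - b) - x (t - 0)) \<le> M * b" by (simp add: norm_minus_commute)
    qed (use s in auto)
    then show ?thesis by simp
  qed
qed

text \<open>W is merely continuous, so integral curves through a point need not be unique; the
  estimate is uniform over all of them. The anchor may sit at either end, because a transferred path
  may be known near z at time t rather than at time 0.\<close>

lemma flow_increment:
  fixes S :: "'a::euclidean_space \<Rightarrow> real" and W :: "'a \<Rightarrow> 'a"
  assumes S: "C1 S" and W: "continuous_on UNIV W" and \<kappa>: "0 < \<kappa>"
  obtains t r where "0 < t" "0 < r"
    "\<And>x. continuous_on {0..t} x \<Longrightarrow>
      (\<And>a b. 0 \<le> a \<Longrightarrow> a \<le> b \<Longrightarrow> b \<le> t \<Longrightarrow> x b - x a = integral {a..b} (\<lambda>s. W (x s))) \<Longrightarrow>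
      dist z (x 0) \<le> r \<or> dist z (x t) \<le> r \<Longrightarrow>
      \<bar>S (x t) - S (x 0) - t * (W z \<bullet> grad S z)\<bar> \<le> t * (\<kappa> * (norm (grad S z) + norm (W z) + \<kappa>))"
proof -
  define p where "p = grad S z"
  obtain d where d: "0 < d" "\<And>w. dist w z < d \<Longrightarrow> dist (W w) (W z) < \<kappa>"
    using W \<kappa> unfolding continuous_on_iff by (metis UNIV_I)
  obtain r0 where r0: "0 < r0" "\<And>x y. x \<in> cball z r0 \<Longrightarrow> y \<in> cball z r0 \<Longrightarrow>
      \<bar>S x - S y - (x - y) \<bullet> p\<bar> \<le> \<kappa> * norm (x - y)"
    using C1_strict_differentiable[OF S \<kappa>, of z] unfolding p_def by blast
  define r where "r = min (d / 2) r0"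
  have r: "0 < r" "r < d" "r \<le> r0" using d(1) r0(1) by (auto simp: r_def)
  define M where "M = norm (W z) + \<kappa>"
  have M: "0 < M" using \<kappa> by (simp add: M_def add_nonneg_pos)
  have W_near: "norm (W w - W z) \<le> \<kappa>" if "w \<in> cball z r" for w
    using d(2)[of w] that r by (simp add: dist_norm norm_minus_commute less_imp_le)
  have W_le: "norm (W w) \<le> M" if "w \<in> cball z r" for w
    using W_near[OF that] norm_triangle_ineq[of "W z" "W w - W z"] by (simp add: M_def)
  \<comment> \<open>Inside the ball the speed is at most M, so this duration allows a displacement
    of r/4.\<close>
  define t where "t = r / (4 * M)"
  have t: "0 < t" "M * t \<le> r / 4" using r M by (auto simp: t_def)
  show thesis
  proof (rule that[of t "r / 2"])
    fix x assume x: "continuous_on {0..t} x"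
      and flow: "\<And>a b. 0 \<le> a \<Longrightarrow> a \<le> b \<Longrightarrow> b \<le> t \<Longrightarrow> x b - x a = integral {a..b} (\<lambda>s. W (x s))"
      and anchor: "dist z (x 0) \<le> r / 2 \<or> dist z (x t) \<le> r / 2"
    have Wx: "continuous_on {a..b} (\<lambda>s. W (x s))" if "0 \<le> a" "b \<le> t" for a b
      by (rule continuous_on_compose2[OF W continuous_on_subset[OF x]]) (use that in auto)
    have speed: "norm (x b - x a) \<le> M * (b - a)"
      if ab: "0 \<le> a" "a \<le> b" "b \<le> t" and inb: "\<And>s. s \<in> {a..b} \<Longrightarrow> x s \<in> cball z r" for a b
      unfolding flow[OF ab] using inb W_le ab by (intro integral_bound Wx) auto
    have stay: "x s \<in> cball z r" if "s \<in> {0..t}" for s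
      by (rule stays_in_cball[OF x speed less_imp_le[OF M] t(2) r(1) anchor that])
    define \<Delta> where "\<Delta> = x t - x 0"
    have \<Delta>M: "norm \<Delta> \<le> M * t" using speed[of 0 t] stay t by (simp add: \<Delta>_def)
    have \<Delta>p: "\<Delta> \<bullet> p = integral {0..t} (\<lambda>s. W (x s) \<bullet> p)"
    proof -
      have "(\<lambda>s. W (x s)) integrable_on {0..t}" by (intro integrable_continuous_real Wx) auto
      from integral_linear[OF this bounded_linear_inner_left[of p]]
      show ?thesis using flow[of 0 t] t by (simp add: \<Delta>_def comp_def)
    qed
    have Wxp: "continuous_on {0..t} (\<lambda>s. W (x s) \<bullet> p)" by (intro continuous_intros Wx) auto
    have close: "\<bar>W (x s) \<bullet> p - W z \<bullet> p\<bar> \<le> \<kappa> * norm p" if "s \<in> {0..t}" for s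
    proof -
      have "\<bar>(W (x s) - W z) \<bullet> p\<bar> \<le> norm (W (x s) - W z) * norm p" by (rule Cauchy_Schwarz_ineq2)
      also have "\<dots> \<le> \<kappa> * norm p" using W_near[OF stay[OF that]] by (intro mult_right_mono) auto
      finally show ?thesis by (simp add: inner_diff_left)
    qed
    have "\<Delta> \<bullet> p \<le> (t - 0) * (W z \<bullet> p + \<kappa> * norm p)" unfolding \<Delta>p
      by (rule integral_bounds(1)[OF Wxp]) (use close t in \<open>auto simp: abs_le_iff algebra_simps\<close>)
    moreover have "(t - 0) * (W z \<bullet> p - \<kappa> * norm p) \<le> \<Delta> \<bullet> p" unfolding \<Delta>p
      by (rule integral_bounds(2)[OF Wxp]) (use close t in \<open>auto simp: abs_le_iff algebra_simps\<close>)
    moreover have "\<bar>S (x t) - S (x 0) - \<Delta> \<bullet> p\<bar> \<le> \<kappa> * (M * t)"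
    proof -
      have "x t \<in> cball z r0" "x 0 \<in> cball z r0" using stay[of t] stay[of 0] t r by auto
      from r0(2)[OF this] have "\<bar>S (x t) - S (x 0) - \<Delta> \<bullet> p\<bar> \<le> \<kappa> * norm \<Delta>" by (simp add: \<Delta>_def)
      also have "\<dots> \<le> \<kappa> * (M * t)" using \<Delta>M \<kappa> by (intro mult_left_mono) auto
      finally show ?thesis .
    qed
    ultimately have "\<bar>S (x t) - S (x 0) - t * (W z \<bullet> p)\<bar> \<le> t * (\<kappa> * (norm p + M))"
      by (simp add: abs_le_iff algebra_simps)
    then show "\<bar>S (x t) - S (x 0) - t * (W z \<bullet> grad S z)\<bar> \<le> t * (\<kappa> * (norm (grad S z) + norm (W z) + \<kappa>))"
      by (simp add: p_def M_def add.assoc)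
  qed (use t r in auto)
qed

context dual_pair begin

text \<open>For a linear Hamiltonian the action bound reads \<open>d \<bullet> q \<le> A\<close>,
  with d the defect in the integral equation; a bound valid for all q forces d to vanish.\<close>

lemma finite_rate_flow:
  assumes H: "\<And>z \<xi>. H z \<xi> = W z \<bullet> \<xi>" and W: "continuous_on UNIV W"
    and rate: "lagrangian_rate (\<lambda>z. ereal (S z)) L \<gamma> < ereal c"
  shows "continuous_on {0..} \<gamma>" "S (\<gamma> 0) < c"
    "\<And>a b. 0 \<le> a \<Longrightarrow> a \<le> b \<Longrightarrow> \<gamma> b - \<gamma> a = integral {a..b} (\<lambda>s. W (\<gamma> s))"
proof -
  obtain g A where g: "has_velocity \<gamma> g" "0 \<le> A" "S (\<gamma> 0) + A < c"
    "enn2ereal (\<integral>\<^sup>+s\<in>{0..}. e2ennreal (L (\<gamma> s) (g s)) \<partial>lborel) = ereal A"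
    using finite_rateE[OF rate] by metis
  show cont: "continuous_on {0..} \<gamma>" by (rule has_velocity_continuous[OF g(1)])
  show "S (\<gamma> 0) < c" using g by simp
  have Wint: "(\<lambda>s. W (\<gamma> s)) integrable_on {a..b}" if "0 \<le> a" for a b
    by (intro integrable_continuous_real continuous_on_compose2[OF W continuous_on_subset[OF cont]]) (use that in auto)
  have start: "\<gamma> t - \<gamma> 0 = integral {0..t} (\<lambda>s. W (\<gamma> s))" if t: "0 \<le> t" for t
  proof (rule ccontr)
    define d where "d = (\<gamma> t - \<gamma> 0) - integral {0..t} (\<lambda>s. W (\<gamma> s))"
    assume "\<gamma> t - \<gamma> 0 \<noteq> integral {0..t} (\<lambda>s. W (\<gamma> s))"
    then have d: "0 < d \<bullet> d" by (simp add: d_def)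
    have "d \<bullet> q \<le> A" for q
    proof -
      have "integral {0..t} (\<lambda>s. H (\<gamma> s) q) = integral {0..t} (\<lambda>s. W (\<gamma> s)) \<bullet> q"
        using integral_linear[OF Wint[of 0 t] bounded_linear_inner_left[of q]] by (simp add: H comp_def)
      then show ?thesis
        using action_lower_bound[OF g(1) t, of q] unfolding g(4) by (simp add: d_def inner_diff_left)
    qed
    \<comment> \<open>This multiple of d turns the bound into \<open>A + 1 \<le> A\<close>.\<close>
    from this[of "((A + 1) / (d \<bullet> d)) *\<^sub>R d"] show False using d by simp
  qed
  show "\<gamma> b - \<gamma> a = integral {a..b} (\<lambda>s. W (\<gamma> s))" if ab: "0 \<le> a" "a \<le> b" for a b
    using start[of a] start[of b] ab
      Henstock_Kurzweil_Integration.integral_combine[OF ab Wint[of 0 b]] by (simp add: algebra_simps)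
qed

text \<open>Stationarity moves the position of a cheap path to another time without raising its cost
  level, and that level bounds S at the start of the partner. Applied in both time directions this
  shows that S is almost constant along short pieces of the flow, so its derivative along W
  vanishes.\<close>

lemma drift_orthogonal:
  assumes H: "\<And>z \<xi>. H z \<xi> = W z \<bullet> \<xi>" and W: "continuous_on UNIV W"
    and ldp: "LDP skorokhod Q (lagrangian_rate (\<lambda>z. ereal (S z)) L)"
    and init: "LDP euclidean (\<lambda>n. initial_law (Q n)) (\<lambda>z. ereal (S z))" and S: "C1 S"
    and stat: "\<And>n t B. 0 \<le> t \<Longrightarrow> B \<in> sets borel \<Longrightarrow>
      measure (Q n) {\<gamma>\<in>space (Q n). \<gamma> t \<in> B} = measure (Q n) {\<gamma>\<in>space (Q n). \<gamma> 0 \<in> B}"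
  shows "W z \<bullet> grad S z = 0"
proof -
  define \<phi> where "\<phi> = W z \<bullet> grad S z"
  \<comment> \<open>The 1 dominates \<kappa> < 1, which makes the error linear in \<kappa>.\<close>
  define G where "G = norm (grad S z) + norm (W z) + 1"
  note flow = finite_rate_flow[OF H W]
  have transfer: "\<exists>\<eta>. \<eta> s' \<in> cball w \<epsilon> \<and> lagrangian_rate (\<lambda>z. ereal (S z)) L \<eta> < ereal c"
    if times: "0 \<le> s" "0 \<le> s'" and \<gamma>: "\<gamma> \<in> cadlag" "\<gamma> s \<in> ball w \<epsilon>" "lagrangian_rate (\<lambda>z. ereal (S z)) L \<gamma> < ereal c"
    for s s' w \<epsilon> \<gamma> c
  proof (rule path_transfer[OF ldp, of s s s' s' "ball w \<epsilon>" UNIV "cball w \<epsilon>" UNIV \<gamma> "ereal c"])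
    fix n
    interpret prob_space "Q n" by (rule LDP_paths[OF ldp])
    have ev[measurable]: "(\<lambda>\<gamma>. \<gamma> s') \<in> Q n \<rightarrow>\<^sub>M borel"
      using eval_measurable[OF times(2)] measurable_cong_sets[OF LDP_paths(2)[OF ldp] HOL.refl] by blast
    have "measure (Q n) {x\<in>space (Q n). x s \<in> ball w \<epsilon>} = measure (Q n) {x\<in>space (Q n). x s' \<in> ball w \<epsilon>}"
      using stat[OF times(1), of "ball w \<epsilon>" n] stat[OF times(2), of "ball w \<epsilon>" n] by simp
    also have "\<dots> \<le> measure (Q n) {x\<in>space (Q n). x s' \<in> cball w \<epsilon>}"
      by (rule finite_measure_mono) auto
    finally show "measure (Q n) {x\<in>space (Q n). x s \<in> ball w \<epsilon> \<and> x s \<in> UNIV} \<le>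
        measure (Q n) {x\<in>space (Q n). x s' \<in> cball w \<epsilon> \<and> x s' \<in> UNIV}" by simp
  qed (use times \<gamma> in auto)
  have both: "\<bar>\<phi>\<bar> - \<kappa> * G \<le> 0" if \<kappa>: "0 < \<kappa>" "\<kappa> < 1" for \<kappa>
  proof -
    obtain t r where t: "0 < t" and r: "0 < r" and incr: "\<And>x. continuous_on {0..t} x \<Longrightarrow>
      (\<And>a b. 0 \<le> a \<Longrightarrow> a \<le> b \<Longrightarrow> b \<le> t \<Longrightarrow> x b - x a = integral {a..b} (\<lambda>s. W (x s))) \<Longrightarrow>
      dist z (x 0) \<le> r \<or> dist z (x t) \<le> r \<Longrightarrow>
      \<bar>S (x t) - S (x 0) - t * \<phi>\<bar> \<le> t * (\<kappa> * (norm (grad S z) + norm (W z) + \<kappa>))"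
      using flow_increment[OF S W \<kappa>(1), of z] unfolding \<phi>_def by metis
    have incr': "\<bar>S (\<gamma> t) - S (\<gamma> 0) - t * \<phi>\<bar> \<le> t * (\<kappa> * G)"
      if rate: "lagrangian_rate (\<lambda>z. ereal (S z)) L \<gamma> < ereal c"
        and "dist z (\<gamma> 0) \<le> r \<or> dist z (\<gamma> t) \<le> r" for \<gamma> c
    proof -
      have "\<bar>S (\<gamma> t) - S (\<gamma> 0) - t * \<phi>\<bar> \<le> t * (\<kappa> * (norm (grad S z) + norm (W z) + \<kappa>))"
        using continuous_on_subset[OF flow(1)[OF rate], of "{0..t}"] flow(3)[OF rate] that(2)
        by (intro incr) auto
      also have "\<dots> \<le> t * (\<kappa> * G)" using t \<kappa> by (intro mult_left_mono) (auto simp: G_def)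
      finally show ?thesis .
    qed
    have S_cont: "isCont S w" for w
      using C1_grad(1)[OF S, of w] unfolding gderiv_def by (rule has_derivative_continuous)
    have main: "t * (\<bar>\<phi>\<bar> - \<kappa> * G) \<le> 3 * \<delta>" if \<delta>: "0 < \<delta>" for \<delta>
    proof -
      obtain \<epsilon>0 where \<epsilon>0: "0 < \<epsilon>0" "\<And>w. dist w z < \<epsilon>0 \<Longrightarrow> \<bar>S w - S z\<bar> < \<delta>"
        using S_cont[of z] \<delta> unfolding continuous_at_eps_delta dist_real_def by metis
      \<comment> \<open>Room for a radius of \<open>2 * \<epsilon>\<close>: the path starts in a
        closed ball of radius \<epsilon>, whereas the transfer begins with an open ball.\<close>
      define \<epsilon> where "\<epsilon> = min (\<epsilon>0 / 2) r / 2"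
      have \<epsilon>: "0 < \<epsilon>" "2 * \<epsilon> < \<epsilon>0" "2 * \<epsilon> \<le> r" using \<epsilon>0 r by (auto simp: \<epsilon>_def min_def)
      have "ereal (S z) < ereal (S z + \<delta>)" using \<delta> by simp
      from cheap_path_near[OF ldp init this \<epsilon>(1)] obtain \<gamma> where
        \<gamma>: "\<gamma> \<in> cadlag" "dist (\<gamma> 0) z \<le> \<epsilon>" "lagrangian_rate (\<lambda>z. ereal (S z)) L \<gamma> < ereal (S z + \<delta>)" by blast
      \<comment> \<open>S can hardly grow: \<eta> starts near \<open>\<gamma> t\<close> with a rate
        below \<open>S z + \<delta>\<close>, so \<open>S (\<gamma> t)\<close> exceeds
        \<open>S z\<close> by little.\<close>
      have "t * \<phi> \<le> 3 * \<delta> + t * (\<kappa> * G)"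
      proof -
        obtain \<epsilon>1 where \<epsilon>1: "0 < \<epsilon>1" "\<And>w. dist w (\<gamma> t) < \<epsilon>1 \<Longrightarrow> \<bar>S w - S (\<gamma> t)\<bar> < \<delta>"
          using S_cont[of "\<gamma> t"] \<delta> unfolding continuous_at_eps_delta dist_real_def by metis
        obtain \<eta> where \<eta>: "\<eta> 0 \<in> cball (\<gamma> t) (\<epsilon>1 / 2)" "lagrangian_rate (\<lambda>z. ereal (S z)) L \<eta> < ereal (S z + \<delta>)"
          using transfer[of t 0 \<gamma> "\<gamma> t" "\<epsilon>1 / 2" "S z + \<delta>"] \<gamma> t \<epsilon>1 by auto
        have "\<bar>S (\<eta> 0) - S (\<gamma> t)\<bar> < \<delta>" using \<eta>(1) \<epsilon>1 by (intro \<epsilon>1(2)) (auto simp: dist_commute)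
        moreover have "S (\<eta> 0) < S z + \<delta>" by (rule flow(2)[OF \<eta>(2)])
        moreover have "\<bar>S (\<gamma> 0) - S z\<bar> < \<delta>" using \<gamma>(2) \<epsilon> by (intro \<epsilon>0(2)) auto
        moreover have "\<bar>S (\<gamma> t) - S (\<gamma> 0) - t * \<phi>\<bar> \<le> t * (\<kappa> * G)"
          using \<gamma>(2) \<epsilon> by (intro incr'[OF \<gamma>(3)]) (auto simp: dist_commute)
        ultimately show ?thesis unfolding abs_le_iff abs_less_iff by linarith
      qed
      \<comment> \<open>S can hardly fall: \<eta> ends near z but starts where S is below
        \<open>S z + \<delta>\<close>.\<close>
      moreover have "- (t * \<phi>) \<le> 3 * \<delta> + t * (\<kappa> * G)"
      proof -
        obtain \<eta> where \<eta>: "\<eta> t \<in> cball z (2 * \<epsilon>)" "lagrangian_rate (\<lambda>z. ereal (S z)) L \<eta> < ereal (S z + \<delta>)"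
          using transfer[of 0 t \<gamma> z "2 * \<epsilon>" "S z + \<delta>"] \<gamma> t \<epsilon> by (auto simp: dist_commute)
        have "S (\<eta> 0) < S z + \<delta>" by (rule flow(2)[OF \<eta>(2)])
        moreover have "\<bar>S (\<eta> t) - S z\<bar> < \<delta>" using \<eta>(1) \<epsilon> by (intro \<epsilon>0(2)) (auto simp: dist_commute)
        moreover have "\<bar>S (\<eta> t) - S (\<eta> 0) - t * \<phi>\<bar> \<le> t * (\<kappa> * G)"
          using \<eta>(1) \<epsilon> by (intro incr'[OF \<eta>(2)]) auto
        ultimately show ?thesis using \<delta> unfolding abs_le_iff abs_less_iff by linarith
      qed
      moreover have "t * \<bar>\<phi>\<bar> = \<bar>t * \<phi>\<bar>" using t by (simp add: abs_mult)
      ultimately show ?thesis by (simp add: right_diff_distrib abs_le_iff)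
    qed
    have "t * (\<bar>\<phi>\<bar> - \<kappa> * G) \<le> 0" by (rule nonpos_of_small[of 1 _ 3]) (use main in auto)
    then show ?thesis using t by (simp add: mult_le_0_iff)
  qed
  have "\<bar>\<phi>\<bar> \<le> 0"
  proof (rule nonpos_of_small[of 1])
    show "\<bar>\<phi>\<bar> \<le> G * \<kappa>" if "0 < \<kappa>" "\<kappa> < 1" for \<kappa> using both[OF that] by (simp add: mult.commute)
  qed simp
  then show ?thesis by (simp add: \<phi>_def)
qed

end

text \<open>The conclusion has two levels because strict convexity and differentiability are
  inherited rather than created: \<open>\<Psi>s\<close> is a translate of \<open>\<H>2\<close> up to
  a constant, and \<open>\<Psi>\<close> is \<open>\<L>2\<close> plus an affine function. Starting X
  and Y in \<open>\<pi> n\<close> makes S their initial rate.\<close>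

theorem proposition3p8:
  fixes P PX PY :: "nat \<Rightarrow> real \<Rightarrow> real ^ 'd \<Rightarrow> (real ^ 'd) measure"
    and A A1 A2 :: "nat \<Rightarrow> ((real ^ 'd \<Rightarrow> real) \<times> (real ^ 'd \<Rightarrow> real)) set"
    and dom :: "nat \<Rightarrow> (real ^ 'd \<Rightarrow> real) set"
    and Z X Y :: "nat \<Rightarrow> (real \<Rightarrow> real ^ 'd) measure"
    and \<pi> :: "nat \<Rightarrow> (real ^ 'd) measure"
    and S :: "real ^ 'd \<Rightarrow> real"
    and \<L> \<L>1 \<L>2 :: "real ^ 'd \<Rightarrow> real ^ 'd \<Rightarrow> ereal"
    and \<H> \<H>1 \<H>2 :: "real ^ 'd \<Rightarrow> real ^ 'd \<Rightarrow> real"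
    and H H1 H2 :: "(real ^ 'd \<Rightarrow> real) \<Rightarrow> real ^ 'd \<Rightarrow> real"
    and F W :: "real ^ 'd \<Rightarrow> real ^ 'd"
    and \<Psi> \<Psi>s :: "real ^ 'd \<Rightarrow> real ^ 'd \<Rightarrow> ereal"
  assumes gen: "\<And>n. generates (dom n) (A n) (P n)"
    and gen1: "\<And>n. generates (dom n) (A1 n) (PX n)"
    and gen2: "\<And>n. generates (dom n) (A2 n) (PY n)"
    and decomp: "\<And>n. decomposes_on_common_core (A n) (A1 n) (A2 n)"
    and procZ: "\<And>n. markov_law (P n) (Z n)"
    and procX: "\<And>n. markov_law (PX n) (X n)" "\<And>n. initial_law (X n) = \<pi> n"
    and procY: "\<And>n. markov_law (PY n) (Y n)" "\<And>n. initial_law (Y n) = \<pi> n"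
    and invariant: "\<And>n \<nu>. invariant_measure (A n) \<nu> \<longleftrightarrow> \<nu> = \<pi> n"
      "\<And>n \<nu>. invariant_measure (A1 n) \<nu> \<longleftrightarrow> \<nu> = \<pi> n"
      "\<And>n \<nu>. invariant_measure (A2 n) \<nu> \<longleftrightarrow> \<nu> = \<pi> n"
    and LDP_\<pi>: "LDP euclidean \<pi> (\<lambda>z. ereal (S z))"
    and S: "C1 S"
    and reversible: "\<And>n. reversible_measure (A2 n) (\<pi> n)"
    and LDP_Z: "LDP_lagrangian Z \<L>"
    and LDP_X: "LDP_lagrangian X \<L>1"
    and LDP_Y: "LDP_lagrangian Y \<L>2"
    and dual: "hamiltonian_lagrangian \<H> \<L>" "hamiltonian_lagrangian \<H>1 \<L>1"
      "hamiltonian_lagrangian \<H>2 \<L>2"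
    and H_sum: "\<And>f z. C1 f \<Longrightarrow> H f z = H1 f z + H2 f z"
    and H_repr: "\<And>f z. C1 f \<Longrightarrow> H f z = \<H> z (grad f z)"
      "\<And>f z. C1 f \<Longrightarrow> H1 f z = \<H>1 z (grad f z)"
      "\<And>f z. C1 f \<Longrightarrow> H2 f z = \<H>2 z (grad f z)"
    and W: "continuous_on UNIV W" "\<And>z \<xi>. \<H>1 z \<xi> = W z \<bullet> \<xi>"
    and \<H>2: "continuous_on UNIV (\<lambda>(z, \<xi>). \<H>2 z \<xi>)" "\<And>z. convex_on UNIV (\<H>2 z)"
    and zero_cost: "\<And>z v. \<L> z v = 0 \<longleftrightarrow> v = F z"
    and \<Psi>s: "\<And>z \<xi>. \<Psi>s z \<xi> = ereal (\<H>2 z (\<xi> + (1/2) *\<^sub>R grad S z) - \<H>2 z ((1/2) *\<^sub>R grad S z))"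
    and \<Psi>: "\<And>z v. \<Psi> z v = legendre (\<Psi>s z) v"
  shows "pre_GENERIC_without_regularity F S W \<Psi> \<Psi>s \<and>
    (regular (\<lambda>z \<xi>. ereal (\<H>2 z \<xi>)) \<and> regular \<L>2 \<longrightarrow> pre_GENERIC F S W \<Psi> \<Psi>s)"
proof -
  have init_X: "LDP euclidean (\<lambda>n. initial_law (X n)) (\<lambda>z. ereal (S z))"
    and init_Y: "LDP euclidean (\<lambda>n. initial_law (Y n)) (\<lambda>z. ereal (S z))"
    using LDP_\<pi> by (simp_all add: procX(2) procY(2))
  have orth: "W z \<bullet> grad S z = 0" for z
  proof (rule dual_pair.drift_orthogonal[OF _ W(2,1) LDP_lagrangian_initial[OF LDP_X init_X] init_X S])
    have "continuous_on UNIV (\<lambda>w. W (fst w) \<bullet> snd w)"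
      by (intro continuous_intros continuous_on_compose2[OF W(1)]) auto
    then show "dual_pair \<H>1 \<L>1"
      by (intro dual_pair.intro dual(2)) (simp add: W(2) case_prod_beta)
    fix n and t :: real and B :: "(real ^ 'd) set" assume "0 \<le> t" "B \<in> sets borel"
    then show "measure (X n) {\<gamma>\<in>space (X n). \<gamma> t \<in> B} = measure (X n) {\<gamma>\<in>space (X n). \<gamma> 0 \<in> B}"
      using invariant(2)[of n "\<pi> n"]
      by (intro generated_semigroup.stationary_marginals[OF generated_semigroup.intro[OF gen1] procX(1)])
        (simp_all add: procX(2))
  qed
  have le: "\<H>2 z \<xi> \<le> \<H>2 z (grad S z - \<xi>)" for z \<xi>
  proof (rule dual_pair.hamiltonian_reflection_le[OF _ LDP_lagrangian_initial[OF LDP_Y init_Y] init_Y S])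
    show "dual_pair \<H>2 \<L>2" by (intro dual_pair.intro \<H>2(1) dual(3))
    fix n and t :: real and B C :: "(real ^ 'd) set" assume "0 \<le> t" "B \<in> sets borel" "C \<in> sets borel"
    then show "measure (Y n) {\<gamma>\<in>space (Y n). \<gamma> 0 \<in> B \<and> \<gamma> t \<in> C} =
        measure (Y n) {\<gamma>\<in>space (Y n). \<gamma> t \<in> B \<and> \<gamma> 0 \<in> C}"
      using invariant(3)[of n "\<pi> n"] reversible[of n]
      by (intro generated_semigroup.reversible_exchangeable[OF generated_semigroup.intro[OF gen2] procY(1)])
        (simp_all add: procY(2))
  qed
  have reflection: "\<H>2 z (grad S z - \<xi>) = \<H>2 z \<xi>" for z \<xi>
    using le[of z \<xi>] le[of z "grad S z - \<xi>"] by simp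
  \<comment> \<open>Linear test functions realise every gradient at every point, which turns the
    operator identity into one between functions of z and \<xi>.\<close>
  have \<H>_eq: "\<H> z \<xi> = W z \<bullet> \<xi> + \<H>2 z \<xi>" for z \<xi>
    using H_sum[OF C1_linear, of \<xi> z] H_repr[OF C1_linear, of \<xi> z]
    by (simp add: grad_eq[OF GDERIV_linear] W(2))
  \<comment> \<open>Adding \<open>W z \<bullet> \<xi>\<close> to a Hamiltonian translates its
    Lagrangian by \<open>W z\<close> in the velocity.\<close>
  have "\<L>2 z (F z - W z) = \<L> z (F z)" for z
    using dual(1,3) unfolding hamiltonian_lagrangian_def legendre_def
    by (simp add: \<H>_eq inner_diff_left diff_diff_add)
  then have zero: "\<L>2 z (F z - W z) = 0" for z using zero_cost by simp
  show ?thesis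
    by (rule pre_GENERIC_of_reflection_symmetry[OF dual(3) reflection orth zero \<Psi>s \<Psi>])
qed

end
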